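(* Let $d\ge 1$ and let $C_{a_1,a_2,\ldots,a_k}$ be a $k$-chain with $k\ge 4$ and with exactly $\binom{d+2}{2}$ vertices, i.e. $a_1,\dots,a_k$ are positive integers with $a_1+a_2+\cdots+a_k=\binom{d+2}{2}$. Then $C_{a_1,\ldots,a_k}$ is generically partially rigid in $\mathbb{R}^d$ if and only if all of the following conditions hold: (1) $a_2,a_3,\ldots,a_{k-1}\ge d+1$; (2) $a_2,a_{k-1}\ge d+2$; and (3) there is no $i$ such that $a_i=a_{i+1}=d+1$.
   Context: All graphs are finite and simple. For positive integers $a_1,\dots,a_k$, the $k$-chain $C_{a_1,\dots,a_k}$ is the graph whose vertex set is the union of $k$ pairwise disjoint sets $A_1,\dots,A_k$ with $|A_i|=a_i$, in which, for each $1\le i\le k-1$, every vertex of $A_i$ is adjacent to every vertex of $A_{i+1}$, and there are no other edges. A realization of a graph $G=(V,E)$ with $v$ vertices in $\mathbb{R}^d$ is $p=(p_1,\dots,p_v)\in\mathbb{R}^{vd}$, where $p_i\in\mathbb{R}^d$ is the location of the $i$-th vertex; it defines the framework $G(p)$. Put $f_G(p)=\frac12(\ldots,|p_i-p_j|^2,\ldots)_{\{i,j\}\in E}\in\mathbb{R}^{E}$. A realization is generic if its coordinates are algebraically independent over $\mathbb{Q}$. A flexing of $G(p)$ is a differentiable one-parameter family of realizations including $p$ such that $f_G(q)=f_G(p)$ for all $q$ in the family; $G(p)$ is locally rigid if all its flexings are trivial (come from Euclidean motions). $G(p)$ is globally rigid if for every realization $q$ in $\mathbb{R}^d$, $f_G(p)=f_G(q)$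 implies $|p_i-p_j|=|q_i-q_j|$ for all pairs of vertices $i,j$. An edge of a framework is redundant if removing it leaves a locally rigid framework; a framework is redundantly rigid if all of its edges are redundant. These properties do not depend on which generic realization is chosen; $G$ is called generically locally rigid, generically redundantly rigid, or generically globally rigid in $\mathbb{R}^d$ if its generic frameworks in $\mathbb{R}^d$ are respectively locally, redundantly, or globally rigid. A graph is $(d+1)$-connected if it has at least $d+2$ vertices and removing any at most $d$ vertices leaves a connected graph. A graph is generically partially rigid in $\mathbb{R}^d$ if it is $(d+1)$-connected and generically redundantly rigid in $\mathbb{R}^d$ but not generically globally rigid in $\mathbb{R}^d$. *)

theory Defs
  imports "HOL-Analysis.Analysis"
begin

text \<open>
  A finite simple graph is given by its vertex set and a symmetric, irreflexive adjacency relation;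
  the undirected edge between u and v is thus represented by the two pairs (u,v) and (v,u).
\<close>

definition simple_graph :: "'v set \<Rightarrow> ('v \<times> 'v) set \<Rightarrow> bool" where
  "simple_graph V E \<longleftrightarrow> finite V \<and> E \<subseteq> V \<times> V \<and> sym E \<and> irrefl E"

definition remove_edge :: "('v \<times> 'v) set \<Rightarrow> 'v \<times> 'v \<Rightarrow> ('v \<times> 'v) set" where
  "remove_edge E e = E - {e, prod.swap e}"

definition connected_graph :: "'v set \<Rightarrow> ('v \<times> 'v) set \<Rightarrow> bool" where
  "connected_graph V E \<longleftrightarrow> (\<forall>u\<in>V. \<forall>v\<in>V. (u, v) \<in> (E \<inter> V \<times> V)\<^sup>*)"

definition vertex_connected :: "nat \<Rightarrow> 'v set \<Rightarrow> ('v \<times> 'v) set \<Rightarrow> bool" where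
  "vertex_connected n V E \<longleftrightarrow>
     card V \<ge> n + 1 \<and> (\<forall>S. S \<subseteq> V \<and> card S < n \<longrightarrow> connected_graph (V - S) E)"

definition is_chain :: "nat \<Rightarrow> (nat \<Rightarrow> nat) \<Rightarrow> 'v set \<Rightarrow> ('v \<times> 'v) set \<Rightarrow> bool" where
  "is_chain k a V E \<longleftrightarrow>
     (\<exists>A. disjoint_family_on A {1..k} \<and>
          (\<forall>i\<in>{1..k}. finite (A i) \<and> card (A i) = a i) \<and>
          V = (\<Union>i\<in>{1..k}. A i) \<and>
          E = (\<Union>i\<in>{1..<k}. A i \<times> A (i + 1) \<union> A (i + 1) \<times> A i))"

lemma is_chain_simple_graph:
  assumes "is_chain k a V E"
  shows "simple_graph V E"
proof -
  from assms obtain A where disj: "disjoint_family_on A {1..k}"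
    and fin: "\<forall>i\<in>{1..k}. finite (A i) \<and> card (A i) = a i"
    and V: "V = (\<Union>i\<in>{1..k}. A i)"
    and E: "E = (\<Union>i\<in>{1..<k}. A i \<times> A (i + 1) \<union> A (i + 1) \<times> A i)"
    unfolding is_chain_def by blast
  have "A i \<inter> A (i + 1) = {}" if "i \<in> {1..<k}" for i
    using disj that unfolding disjoint_family_on_def by auto
  then have "irrefl E"
    unfolding E irrefl_def by blast
  moreover have "sym E"
    unfolding E sym_def by blast
  moreover have "E \<subseteq> V \<times> V"
    unfolding E V by fastforce
  moreover have "finite V"
    using fin unfolding V by blast
  ultimately show ?thesis
    unfolding simple_graph_def by blast
qed

lemma is_chain_card:
  assumes "is_chain k a V E"
  shows "card V = (\<Sum>i=1..k. a i)"
proof -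
  from assms obtain A where disj: "disjoint_family_on A {1..k}"
    and fin: "\<forall>i\<in>{1..k}. finite (A i) \<and> card (A i) = a i"
    and V: "V = (\<Union>i\<in>{1..k}. A i)"
    unfolding is_chain_def by blast
  have "card V = (\<Sum>i\<in>{1..k}. card (A i))"
    unfolding V using disj fin
    by (intro card_UN_disjoint) (auto simp: disjoint_family_on_def)
  then show ?thesis
    using fin by simp
qed

lemma is_chain_exists: "\<exists>V E. is_chain k a (V :: (nat \<times> nat) set) E"
  unfolding is_chain_def
  by (intro exI[of _ "\<lambda>i. {i} \<times> {..<a i}"] exI conjI refl)
     (auto simp: disjoint_family_on_def)

text \<open>
  A realization of a graph on V in the space of dimension CARD('d) is a function from vertices to
  points; its values outside V never matter.
\<close>

type_synonym ('v, 'd) realization = "'v \<Rightarrow> real ^ 'd"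

definition edge_map ::
    "('v \<times> 'v) set \<Rightarrow> ('v, 'd::finite) realization \<Rightarrow> ('v \<times> 'v \<Rightarrow> real)" where
  "edge_map E p = restrict (\<lambda>(u, v). (norm (p u - p v))\<^sup>2 / 2) E"

text \<open>
  A polynomial in the variables indexed by J is given by a finite set M of exponent vectors
  supported on J together with its rational coefficients.
\<close>

definition alg_independent_rat :: "'j set \<Rightarrow> ('j \<Rightarrow> real) \<Rightarrow> bool" where
  "alg_independent_rat J x \<longleftrightarrow>
     (\<forall>(M :: ('j \<Rightarrow> nat) set) (c :: ('j \<Rightarrow> nat) \<Rightarrow> rat).
        finite M \<and> (\<forall>m\<in>M. finite {j. m j \<noteq> 0} \<and> {j. m j \<noteq> 0} \<subseteq> J) \<and>
        (\<Sum>m\<in>M. of_rat (c m) * (\<Prod>j | m j \<noteq> 0. x j ^ m j)) = 0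
        \<longrightarrow> (\<forall>m\<in>M. c m = 0))"

definition generic_realization :: "'v set \<Rightarrow> ('v, 'd::finite) realization \<Rightarrow> bool" where
  "generic_realization V p \<longleftrightarrow> alg_independent_rat (V \<times> (UNIV :: 'd set)) (\<lambda>(v, i). p v $ i)"

definition euclidean_motion :: "(real ^ 'd \<Rightarrow> real ^ 'd::finite) \<Rightarrow> bool" where
  "euclidean_motion T \<longleftrightarrow> (\<exists>A b. orthogonal_transformation A \<and> (\<forall>x. T x = A x + b))"

definition flexing ::
    "'v set \<Rightarrow> ('v \<times> 'v) set \<Rightarrow> ('v, 'd::finite) realization \<Rightarrow> real set \<Rightarrow>
     (real \<Rightarrow> ('v, 'd) realization) \<Rightarrow> bool" where
  "flexing V E p I q \<longleftrightarrow>
     is_interval I \<and>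
     (\<forall>v\<in>V. (\<lambda>t. q t v) differentiable_on I) \<and>
     (\<exists>t\<^sub>0\<in>I. \<forall>v\<in>V. q t\<^sub>0 v = p v) \<and>
     (\<forall>t\<in>I. edge_map E (q t) = edge_map E p)"

definition trivial_flexing ::
    "'v set \<Rightarrow> ('v, 'd::finite) realization \<Rightarrow> real set \<Rightarrow>
     (real \<Rightarrow> ('v, 'd) realization) \<Rightarrow> bool" where
  "trivial_flexing V p I q \<longleftrightarrow> (\<forall>t\<in>I. \<exists>T. euclidean_motion T \<and> (\<forall>v\<in>V. q t v = T (p v)))"

definition locally_rigid ::
    "'v set \<Rightarrow> ('v \<times> 'v) set \<Rightarrow> ('v, 'd::finite) realization \<Rightarrow> bool" where
  "locally_rigid V E p \<longleftrightarrow> (\<forall>I q. flexing V E p I q \<longrightarrow> trivial_flexing V p I q)"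

definition redundantly_rigid ::
    "'v set \<Rightarrow> ('v \<times> 'v) set \<Rightarrow> ('v, 'd::finite) realization \<Rightarrow> bool" where
  "redundantly_rigid V E p \<longleftrightarrow> (\<forall>e\<in>E. locally_rigid V (remove_edge E e) p)"

definition globally_rigid ::
    "'v set \<Rightarrow> ('v \<times> 'v) set \<Rightarrow> ('v, 'd::finite) realization \<Rightarrow> bool" where
  "globally_rigid V E p \<longleftrightarrow>
     (\<forall>q :: ('v, 'd) realization. edge_map E p = edge_map E q \<longrightarrow>
        (\<forall>u\<in>V. \<forall>v\<in>V. norm (p u - p v) = norm (q u - q v)))"

text \<open>
  The first argument fixes the ambient space, whose dimension is not visible in the graph. Each
  property below holds for one generic realization iff it holds for all of them, so quantifying
  over all generic realizations is no restriction.
\<close>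

definition generically_redundantly_rigid ::
    "(real ^ 'd::finite) itself \<Rightarrow> 'v set \<Rightarrow> ('v \<times> 'v) set \<Rightarrow> bool" where
  "generically_redundantly_rigid R V E \<longleftrightarrow>
     (\<forall>p :: ('v, 'd) realization. generic_realization V p \<longrightarrow> redundantly_rigid V E p)"

definition generically_globally_rigid ::
    "(real ^ 'd::finite) itself \<Rightarrow> 'v set \<Rightarrow> ('v \<times> 'v) set \<Rightarrow> bool" where
  "generically_globally_rigid R V E \<longleftrightarrow>
     (\<forall>p :: ('v, 'd) realization. generic_realization V p \<longrightarrow> globally_rigid V E p)"

definition generically_partially_rigid ::
    "(real ^ 'd::finite) itself \<Rightarrow> 'v set \<Rightarrow> ('v \<times> 'v) set \<Rightarrow> bool" where
  "generically_partially_rigid R V E \<longleftrightarrow>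
     vertex_connected (CARD('d) + 1) V E \<and>
     generically_redundantly_rigid R V E \<and>
     \<not> generically_globally_rigid R V E"

end

theory Submission
  imports Defs
begin

text \<open>
  Write $\hat p = (p, 1)$. A velocity $v$ at $p$ becomes the homogeneous vector
  $y = (v, - p \cdot v)$, and it is an infinitesimal flex iff
  $\hat p_w \cdot y_u + \hat p_u \cdot y_w = 0$ on all edges. If consecutive inner blocks
  affinely span, this forces $y_u = S \hat p_u$ on one side of the bipartition and
  $y_u = - S^T \hat p_u$ on the other. Since $\hat p_u \cdot y_u = 0$ says that all vertices lie on
  the quadric of $S$, and $\binom{d+2}{2}$ generic points lie on no quadric, $S$ is skew and the flex
  is trivial. Dually, every equilibrium stress $\omega$ satisfies
  $\sum_w \omega_{uw} \hat p_w = 0$ at every vertex $u$, so that the edges between two blocks carry no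
  stress when both blocks have $d + 1$ points, or when an end block is attached to only $d + 1$
  points; otherwise products of affine dependencies give a stress that is nonzero at a prescribed
  edge. Removing a stress-free edge yields a flex by a constant rank argument.

  Global rigidity always fails: if all points lie on a quadric with matrix $M$, moving the two sides
  along plus and minus the top part of $M \hat p$ gives two placements with equal edge lengths. The
  number of vertices equals the number of parameters of a quadric, and near two concentric spheres
  the open mapping theorem shows that these placements fill an open set.
\<close>

section \<open>Rational polynomials and generic realizations\<close>

text \<open>Genericity is not an open condition, so a flexing may leave the generic realizations at
  once. The rigidity arguments therefore use only \<open>well_placed\<close>: no d + 1 vertices on a
  hyperplane, and the vertices on no common quadric. Both say that finitely many determinants are
  nonzero, hence are open, and motions preserve them.

  The failures of redundant and of global rigidity are needed for one generic realization only,
  because the generic properties quantify over all of them. Each failure is established on a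
  nonempty open set of configurations, and density of the generic realizations supplies a generic
  member.

  The number of vertices is the number of coefficients of a quadric. It makes the linear system of
  quadrics through the vertices square, so that a trivial kernel also gives independence of the
  matrices hat p_u hat p_u^T; this is what annihilates the diagonal of a stress. The same count
  balances unknowns and equations in the open mapping argument.\<close>

definition monom_value :: "('j \<Rightarrow> real) \<Rightarrow> ('j \<Rightarrow> nat) \<Rightarrow> real" where
  "monom_value x m = (\<Prod>j | m j \<noteq> 0. x j ^ m j)"

definition rat_polynomial :: "'j set \<Rightarrow> (('j \<Rightarrow> real) \<Rightarrow> real) \<Rightarrow> bool" where
  "rat_polynomial J F \<longleftrightarrow>
     (\<exists>M c. finite M \<and> (\<forall>m\<in>M. {j. m j \<noteq> 0} \<subseteq> J) \<and>
        F = (\<lambda>x. \<Sum>m\<in>M. of_rat (c m) * monom_value x m))"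

lemma monom_value_eq_prod:
  assumes "finite J" "{j. m j \<noteq> 0} \<subseteq> J"
  shows "monom_value x m = (\<Prod>j\<in>J. x j ^ m j)"
  unfolding monom_value_def
  by (rule prod.mono_neutral_left) (use assms in auto)

lemma monom_value_add:
  assumes "finite J" "{j. m j \<noteq> 0} \<subseteq> J" "{j. m' j \<noteq> 0} \<subseteq> J"
  shows "monom_value x (\<lambda>j. m j + m' j) = monom_value x m * monom_value x m'"
proof -
  have "{j. m j + m' j \<noteq> 0} \<subseteq> J" using assms by auto
  then show ?thesis
    using assms by (simp add: monom_value_eq_prod[of J] power_add prod.distrib)
qed

lemma alg_independent_rat_iff:
  assumes "finite J"
  shows "alg_independent_rat J x \<longleftrightarrow>
    (\<forall>M c. finite M \<and> (\<forall>m\<in>M. {j. m j \<noteq> 0} \<subseteq> J) \<and>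
       (\<Sum>m\<in>M. of_rat (c m) * monom_value x m) = 0 \<longrightarrow> (\<forall>m\<in>M. c m = 0))"
  using assms unfolding alg_independent_rat_def monom_value_def
  by (meson finite_subset)

text \<open>Distinct indices may yield the same exponent vector; their coefficients are added up in
  the fibres of \<open>m\<close>. Sums and products can thus be indexed by disjoint unions and by
  pairs instead of by sets of exponents.\<close>

lemma rat_polynomialI:
  assumes "finite I" "\<And>i. i \<in> I \<Longrightarrow> {j. m i j \<noteq> 0} \<subseteq> J"
    and F: "\<And>x. F x = (\<Sum>i\<in>I. of_rat (c i) * monom_value x (m i))"
  shows "rat_polynomial J F"
  unfolding rat_polynomial_def
proof (intro exI conjI ext)
  show "finite (m ` I)" using assms by simp
  show "\<forall>n\<in>m ` I. {j. n j \<noteq> 0} \<subseteq> J" using assms(2) by blast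
  fix x
  have "F x = (\<Sum>n\<in>m ` I. \<Sum>i | i \<in> I \<and> m i = n. of_rat (c i) * monom_value x (m i))"
    unfolding F by (rule sum.image_gen[OF \<open>finite I\<close>])
  also have "\<dots> = (\<Sum>n\<in>m ` I. of_rat (\<Sum>i | i \<in> I \<and> m i = n. c i) * monom_value x n)"
    by (simp add: of_rat_sum sum_distrib_right)
  finally show "F x = (\<Sum>n\<in>m ` I. of_rat ((\<lambda>n. \<Sum>i | i \<in> I \<and> m i = n. c i) n) * monom_value x n)" .
qed

lemma rat_polynomial_const: "rat_polynomial J (\<lambda>x. of_rat r)"
  by (rule rat_polynomialI[where I="{()}" and c="\<lambda>_. r" and m="\<lambda>_ _. 0"])
     (auto simp: monom_value_def)

lemma rat_polynomial_var:
  assumes "j \<in> J" shows "rat_polynomial J (\<lambda>x. x j)"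
  by (rule rat_polynomialI[where I="{()}" and c="\<lambda>_. 1" and m="\<lambda>_ i. if i = j then 1 else 0"])
     (use assms in \<open>auto simp: monom_value_def\<close>)

lemma rat_polynomial_add:
  assumes "rat_polynomial J F" "rat_polynomial J G"
  shows "rat_polynomial J (\<lambda>x. F x + G x)"
proof -
  obtain M c M' c' where M: "finite M" "\<forall>m\<in>M. {j. m j \<noteq> 0} \<subseteq> J"
      "F = (\<lambda>x. \<Sum>m\<in>M. of_rat (c m) * monom_value x m)"
    and M': "finite M'" "\<forall>m\<in>M'. {j. m j \<noteq> 0} \<subseteq> J"
      "G = (\<lambda>x. \<Sum>m\<in>M'. of_rat (c' m) * monom_value x m)"
    using assms unfolding rat_polynomial_def by blast
  show ?thesis
    by (rule rat_polynomialI[where I="M <+> M'" and c="case_sum c c'" and m="case_sum id id"])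
       (use M M' in \<open>auto simp: sum.Plus\<close>)
qed

lemma rat_polynomial_mult:
  assumes "finite J" "rat_polynomial J F" "rat_polynomial J G"
  shows "rat_polynomial J (\<lambda>x. F x * G x)"
proof -
  obtain M c M' c' where M: "finite M" "\<forall>m\<in>M. {j. m j \<noteq> 0} \<subseteq> J"
      "F = (\<lambda>x. \<Sum>m\<in>M. of_rat (c m) * monom_value x m)"
    and M': "finite M'" "\<forall>m\<in>M'. {j. m j \<noteq> 0} \<subseteq> J"
      "G = (\<lambda>x. \<Sum>m\<in>M'. of_rat (c' m) * monom_value x m)"
    using assms unfolding rat_polynomial_def by blast
  show ?thesis
  proof (rule rat_polynomialI[where I="M \<times> M'" and c="\<lambda>(m,m'). c m * c' m'"
        and m="\<lambda>(m,m') j. m j + m' j"])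
    show "finite (M \<times> M')" using M M' by simp
    show "{j. (case i of (m, m') \<Rightarrow> \<lambda>j. m j + m' j) j \<noteq> 0} \<subseteq> J" if "i \<in> M \<times> M'" for i
      using that M(2) M'(2) by fastforce
    show "F x * G x = (\<Sum>i\<in>M \<times> M'. of_rat (case i of (m, m') \<Rightarrow> c m * c' m') *
        monom_value x (case i of (m, m') \<Rightarrow> \<lambda>j. m j + m' j))" for x
      unfolding M(3) M'(3) sum_product sum.cartesian_product
      by (rule sum.cong)
         (use M(2) M'(2) \<open>finite J\<close> in \<open>auto simp: of_rat_mult monom_value_add[of J]\<close>)
  qed
qed

lemma rat_polynomial_0: "rat_polynomial J (\<lambda>x. 0)"
  using rat_polynomial_const[of J 0] by simp

lemma rat_polynomial_1: "rat_polynomial J (\<lambda>x. 1)"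
  using rat_polynomial_const[of J 1] by simp

lemma rat_polynomial_minus1: "rat_polynomial J (\<lambda>x. -1)"
  using rat_polynomial_const[of J "-1"] by (simp add: of_rat_minus)

lemma rat_polynomial_sum:
  assumes "\<And>i. i \<in> I \<Longrightarrow> rat_polynomial J (F i)"
  shows "rat_polynomial J (\<lambda>x. \<Sum>i\<in>I. F i x)"
  using assms
  by (induction I rule: infinite_finite_induct)
     (auto intro: rat_polynomial_0 rat_polynomial_add)

lemma rat_polynomial_prod:
  assumes "finite J" "\<And>i. i \<in> I \<Longrightarrow> rat_polynomial J (F i)"
  shows "rat_polynomial J (\<lambda>x. \<Prod>i\<in>I. F i x)"
  using assms(2)
  by (induction I rule: infinite_finite_induct)
     (auto intro: rat_polynomial_1 rat_polynomial_mult assms(1))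

lemma rat_polynomial_det:
  fixes A :: "('j \<Rightarrow> real) \<Rightarrow> real^'n^'n"
  assumes "finite J" "\<And>i k. rat_polynomial J (\<lambda>x. A x $ i $ k)"
  shows "rat_polynomial J (\<lambda>x. det (A x))"
  unfolding det_def
proof (intro rat_polynomial_sum rat_polynomial_mult rat_polynomial_prod assms)
  fix p :: "'n \<Rightarrow> 'n"
  show "rat_polynomial J (\<lambda>x. of_int (sign p))"
    by (cases "evenperm p")
       (auto simp: sign_def rat_polynomial_1 rat_polynomial_minus1)
qed

text \<open>The transfer principle behind the generic statements: one explicit point
  \<open>x0\<close> with nonzero value suffices, for then \<open>F\<close> has a nonzero
  coefficient.\<close>

lemma rat_polynomial_nonzero:
  assumes "finite J" "alg_independent_rat J x" "rat_polynomial J F" "F x0 \<noteq> 0"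
  shows "F x \<noteq> 0"
proof
  assume "F x = 0"
  obtain M c where M: "finite M" "\<forall>m\<in>M. {j. m j \<noteq> 0} \<subseteq> J"
      and F: "F = (\<lambda>x. \<Sum>m\<in>M. of_rat (c m) * monom_value x m)"
    using assms(3) unfolding rat_polynomial_def by blast
  have "\<forall>m\<in>M. c m = 0"
    using assms(2) M \<open>F x = 0\<close> unfolding alg_independent_rat_iff[OF assms(1)] F by blast
  then show False using assms(4) unfolding F by simp
qed

section \<open>Density of the generic realizations\<close>

lemma countable_finite_support:
  assumes "finite J" shows "countable {m :: 'j \<Rightarrow> nat. {j. m j \<noteq> 0} \<subseteq> J}"
proof (rule countable_subset)
  show "{m :: 'j \<Rightarrow> nat. {j. m j \<noteq> 0} \<subseteq> J}
    \<subseteq> (\<lambda>f j. if j \<in> J then f j else 0) ` (PiE J (\<lambda>_. UNIV))"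
  proof
    fix m :: "'j \<Rightarrow> nat" assume "m \<in> {m. {j. m j \<noteq> 0} \<subseteq> J}"
    then have "m = (\<lambda>j. if j \<in> J then restrict m J j else 0)" by (fastforce simp: fun_eq_iff)
    then show "m \<in> (\<lambda>f j. if j \<in> J then f j else 0) ` (PiE J (\<lambda>_. UNIV))"
      by (intro image_eqI[of _ _ "restrict m J"]) auto
  qed
  show "countable ((\<lambda>f j. if j \<in> J then f j else (0::nat)) ` (PiE J (\<lambda>_. UNIV)))"
    by (intro countable_image countable_PiE assms) auto
qed

text \<open>Collected by powers of \<open>t\<close>, the sum is a polynomial in one variable whose
  coefficients are rational polynomials in \<open>x\<close>. The coefficient of
  \<open>t ^ m0 j\<close> contains the term with \<open>c m0\<close>, so independence of
  \<open>x\<close> over \<open>J\<close> keeps it from vanishing.\<close>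

lemma finite_roots_over_independent:
  assumes J: "finite J" "j \<notin> J" and x: "alg_independent_rat J x"
    and M: "finite M" "\<And>m. m \<in> M \<Longrightarrow> {i. m i \<noteq> 0} \<subseteq> insert j J" "m0 \<in> M" "c m0 \<noteq> 0"
  shows "finite {t. (\<Sum>m\<in>M. of_rat (c m) * monom_value (x(j := t)) m) = 0}"
proof -
  define r where "r = (\<lambda>m :: 'a \<Rightarrow> nat. m(j := 0))"
  define d where "d = (\<lambda>i. \<Sum>m | m \<in> M \<and> m j = i. of_rat (c m) * monom_value x (r m))"
  define n where "n = Max ((\<lambda>m. m j) ` M)"
  have mono: "monom_value (x(j := t)) m = monom_value x (r m) * t ^ m j" if "m \<in> M" for m t
  proof -
    have "{i. r m i \<noteq> 0} \<subseteq> J" using M(2)[OF that] by (auto simp: r_def)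
    moreover have "(\<Prod>i\<in>J. (x(j := t)) i ^ m i) = (\<Prod>i\<in>J. x i ^ r m i)"
      by (rule prod.cong) (use J in \<open>auto simp: r_def\<close>)
    ultimately show ?thesis
      using J M(2)[OF that] by (simp add: monom_value_eq_prod[of J] monom_value_eq_prod[of "insert j J"])
  qed
  have le: "m j \<le> n" if "m \<in> M" for m using that M(1) by (auto simp: n_def)
  have eq: "(\<Sum>m\<in>M. of_rat (c m) * monom_value (x(j := t)) m) = (\<Sum>i\<le>n. d i * t ^ i)" for t
  proof -
    have "(\<Sum>m\<in>M. of_rat (c m) * monom_value (x(j := t)) m)
        = (\<Sum>m\<in>M. of_rat (c m) * monom_value x (r m) * t ^ m j)"
      by (rule sum.cong) (auto simp: mono)
    also have "\<dots> = (\<Sum>i\<le>n. \<Sum>m | m \<in> M \<and> m j = i. of_rat (c m) * monom_value x (r m) * t ^ m j)"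
      by (rule sum.group[symmetric]) (use M(1) le in auto)
    finally show ?thesis by (simp add: d_def sum_distrib_right)
  qed
  have "d (m0 j) \<noteq> 0"
  proof
    assume d0: "d (m0 j) = 0"
    let ?M = "{m \<in> M. m j = m0 j}"
    \<comment> \<open>On exponents with the same entry at \<open>j\<close>, erasing that entry is
      injective, so \<open>c m0\<close> is not merged with another coefficient.\<close>
    have inj: "inj_on r ?M"
      by (rule inj_on_inverseI[where g="\<lambda>m. m(j := m0 j)"]) (auto simp: r_def)
    define c' where "c' = (\<lambda>m. c (m(j := m0 j)))"
    have c': "c' (r m) = c m" if "m \<in> ?M" for m
      using that by (auto simp: c'_def r_def fun_upd_idem)
    have "(\<Sum>m\<in>r ` ?M. of_rat (c' m) * monom_value x m) = d (m0 j)"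
      unfolding d_def sum.reindex[OF inj] by (rule sum.cong) (auto simp: c')
    moreover have "\<forall>m\<in>r ` ?M. {i. m i \<noteq> 0} \<subseteq> J"
    proof
      fix m' assume "m' \<in> r ` ?M"
      then obtain m where m: "m \<in> M" "m' = r m" by blast
      show "{i. m' i \<noteq> 0} \<subseteq> J" using M(2)[OF m(1)] by (auto simp: m(2) r_def)
    qed
    ultimately have "\<forall>m\<in>r ` ?M. c' m = 0"
      using x[unfolded alg_independent_rat_iff[OF J(1)], rule_format, of "r ` ?M" c'] M(1) d0
      by auto
    then have "c' (r m0) = 0" using M(3) by blast
    then show False using c'[of m0] M by simp
  qed
  then have "\<exists>i\<le>n. d i \<noteq> 0" using le[OF M(3)] by blast
  then show ?thesis unfolding eq using polyfun_finite_roots[of d n] by simp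
qed

text \<open>Coordinates are perturbed one at a time. Given independent values on \<open>J\<close>,
  each nontrivial rational relation excludes finitely many values of the new coordinate, and there
  are countably many relations, whereas an interval is uncountable.\<close>

lemma alg_independent_rat_dense:
  assumes "finite J" "\<epsilon> > 0"
  shows "\<exists>x. alg_independent_rat J x \<and> (\<forall>j\<in>J. \<bar>x j - x0 j\<bar> < \<epsilon>)"
  using assms(1)
proof (induction J)
  case empty
  have "alg_independent_rat {} x0"
    unfolding alg_independent_rat_iff[OF finite.emptyI]
  proof (intro allI impI ballI, elim conjE)
    fix M :: "('a \<Rightarrow> nat) set" and c m
    assume M: "finite M" "\<forall>m\<in>M. {j. m j \<noteq> 0} \<subseteq> {}" "m \<in> M"
      and s: "(\<Sum>m\<in>M. of_rat (c m) * monom_value x0 m) = 0"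
    from M(2) have "m = (\<lambda>_. 0)" if "m \<in> M" for m using that by (auto simp: fun_eq_iff)
    with M(3) have "M = {\<lambda>_. 0}" by blast
    then show "c m = 0" using s M(3) by (simp add: monom_value_def)
  qed
  then show ?case by blast
next
  case (insert j J)
  obtain x where x: "alg_independent_rat J x" "\<forall>j\<in>J. \<bar>x j - x0 j\<bar> < \<epsilon>"
    using insert by blast
  let ?S = "{m :: 'a \<Rightarrow> nat. {i. m i \<noteq> 0} \<subseteq> insert j J}"
  \<comment> \<open>A polynomial is coded by its finite set of pairs of exponent and coefficient, so
    that all codes are finite subsets of one countable set. Restricting \<open>\<C>\<close> to
    countable root sets discards the codes that vanish identically in \<open>t\<close>.\<close>
  define Z where "Z = (\<lambda>A :: (('a \<Rightarrow> nat) \<times> rat) set.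
    {t. (\<Sum>(m, r)\<in>A. of_rat r * monom_value (x(j := t)) m) = 0})"
  define \<C> where "\<C> = {A. finite A \<and> A \<subseteq> ?S \<times> (UNIV :: rat set) \<and> countable (Z A)}"
  have "countable {A. finite A \<and> A \<subseteq> ?S \<times> (UNIV :: rat set)}"
    by (intro countable_Collect_finite_subset countable_SIGMA countable_finite_support)
       (use insert in auto)
  then have "countable \<C>" by (rule countable_subset[rotated]) (auto simp: \<C>_def)
  then have "countable (\<Union>A\<in>\<C>. Z A)"
    by (rule countable_UN) (auto simp: \<C>_def)
  moreover have "uncountable {x0 j - \<epsilon> <..< x0 j + \<epsilon>}"
    using assms(2) by (simp add: uncountable_open_interval)
  ultimately obtain t where t: "t \<in> {x0 j - \<epsilon> <..< x0 j + \<epsilon>}" "t \<notin> (\<Union>A\<in>\<C>. Z A)"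
    by (meson countable_subset subsetI)
  have "alg_independent_rat (insert j J) (x(j := t))"
    unfolding alg_independent_rat_iff[OF finite.insertI[OF insert(1)]]
  proof (intro allI impI ballI, elim conjE, rule ccontr)
    fix M :: "('a \<Rightarrow> nat) set" and c m
    assume M: "finite M" "\<forall>m\<in>M. {i. m i \<noteq> 0} \<subseteq> insert j J" "m \<in> M" "c m \<noteq> 0"
      and s: "(\<Sum>m\<in>M. of_rat (c m) * monom_value (x(j := t)) m) = 0"
    let ?A = "(\<lambda>m. (m, c m)) ` M"
    have Z: "Z ?A = {t. (\<Sum>m\<in>M. of_rat (c m) * monom_value (x(j := t)) m) = 0}"
      unfolding Z_def by (subst sum.reindex) (auto simp: inj_on_def)
    have "finite (Z ?A)"
      unfolding Z using finite_roots_over_independent[OF insert(1,2) x(1) M(1)] M by blast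
    then have "?A \<in> \<C>" using M by (auto simp: \<C>_def countable_finite)
    moreover have "t \<in> Z ?A" unfolding Z using s by simp
    ultimately show False using t(2) by blast
  qed
  moreover have "\<forall>i\<in>insert j J. \<bar>(x(j := t)) i - x0 i\<bar> < \<epsilon>"
    using t(1) x(2) insert(2) by (auto simp: abs_less_iff)
  ultimately show ?case by blast
qed

lemma generic_realization_dense:
  fixes p0 :: "('v, 'd::finite) realization"
  assumes "finite V" "\<epsilon> > 0"
  shows "\<exists>p :: ('v, 'd) realization. generic_realization V p \<and> (\<forall>v\<in>V. norm (p v - p0 v) < \<epsilon>)"
proof -
  define \<delta> where "\<delta> = \<epsilon> / CARD('d)"
  have d: "\<delta> > 0" using assms by (simp add: \<delta>_def)
  obtain x where x: "alg_independent_rat (V \<times> (UNIV :: 'd set)) x"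
    and xc: "\<forall>j\<in>V \<times> UNIV. \<bar>x j - (\<lambda>(v, i). p0 v $ i) j\<bar> < \<delta>"
    using alg_independent_rat_dense[of "V \<times> (UNIV :: 'd set)" \<delta> "\<lambda>(v, i). p0 v $ i"] assms(1) d
    by auto
  define p where "p = (\<lambda>v. \<chi> i. x (v, i))"
  have "(\<lambda>(v, i). p v $ i) = x" by (auto simp: p_def)
  then have "generic_realization V p" using x by (simp add: generic_realization_def)
  moreover have "norm (p v - p0 v) < \<epsilon>" if "v \<in> V" for v
  proof -
    have "norm (p v - p0 v) \<le> (\<Sum>i\<in>UNIV. \<bar>(p v - p0 v) $ i\<bar>)" by (rule norm_le_l1_cart)
    also have "\<dots> < (\<Sum>i\<in>(UNIV::'d set). \<delta>)"
      by (rule sum_strict_mono) (use that xc in \<open>auto simp: p_def\<close>)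
    also have "\<dots> = \<epsilon>" by (simp add: \<delta>_def)
    finally show ?thesis .
  qed
  ultimately show ?thesis by blast
qed

section \<open>Points in general position and on no quadric\<close>

definition hat :: "real^'d \<Rightarrow> real^'d::finite option" where
  "hat x = (\<chi> i. case i of None \<Rightarrow> 1 | Some j \<Rightarrow> x $ j)"

lemma hat_nth [simp]: "hat x $ None = 1" "hat x $ Some j = x $ j"
  by (simp_all add: hat_def)

lemma sum_option: "(\<Sum>i\<in>UNIV. f i) = f None + (\<Sum>j\<in>(UNIV :: 'd::finite set). f (Some j))"
proof -
  have "(\<Sum>i\<in>UNIV. f i) = f None + (\<Sum>i\<in>range Some. f i)"
    by (simp add: UNIV_option_conv)
  then show ?thesis by (simp add: sum.reindex)
qed

lemma inner_matrix_vector_mult: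
  "(x :: real^'n) \<bullet> (S *v y) = (\<Sum>i\<in>UNIV. \<Sum>j\<in>UNIV. S $ i $ j * (x $ i * y $ j))"
  by (simp add: inner_vec_def matrix_vector_mult_def sum_distrib_left mult_ac)

lemma transpose_nth: "transpose X $ i $ j = X $ j $ i"
  by (simp add: transpose_def)

lemma symmetric_matrix_inner_swap:
  assumes "\<And>i j. S $ i $ j = S $ j $ i"
  shows "(x :: real^'n) \<bullet> (S *v y) = y \<bullet> (S *v x)"
proof -
  have "transpose S = S" using assms by (simp add: transpose_def vec_eq_iff)
  then show ?thesis by (metis dot_lmul_matrix inner_commute transpose_matrix_vector)
qed

text \<open>Stated as a trivial annihilator: \<open>y\<close> is the coefficient vector of an affine
  function, so no hyperplane contains d + 1 of the points. In this form the condition concerns the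
  kernel of a square matrix.\<close>

definition affinely_general :: "'v set \<Rightarrow> ('v, 'd::finite) realization \<Rightarrow> bool" where
  "affinely_general V q \<longleftrightarrow>
     (\<forall>U\<subseteq>V. card U = CARD('d) + 1 \<longrightarrow> (\<forall>y. (\<forall>u\<in>U. hat (q u) \<bullet> y = 0) \<longrightarrow> y = 0))"

definition no_quadric :: "'v set \<Rightarrow> ('v, 'd::finite) realization \<Rightarrow> bool" where
  "no_quadric V q \<longleftrightarrow>
     (\<forall>S. (\<forall>i j. S $ i $ j = S $ j $ i) \<and> (\<forall>u\<in>V. hat (q u) \<bullet> (S *v hat (q u)) = 0) \<longrightarrow> S = 0)"

definition well_placed :: "'v set \<Rightarrow> ('v, 'd::finite) realization \<Rightarrow> bool" where
  "well_placed V q \<longleftrightarrow> affinely_general V q \<and> no_quadric V q"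

section \<open>Quadrics through the vertices as a square linear system\<close>

definition upper_pairs :: "('o::countable \<times> 'o) set" where
  "upper_pairs = {(i, j). to_nat i \<le> to_nat j}"

lemma upper_pairs_total: "(i, j) \<in> upper_pairs \<or> (j, i) \<in> upper_pairs"
  by (auto simp: upper_pairs_def)

lemma upper_pairs_antisym: "(i, j) \<in> upper_pairs \<Longrightarrow> (j, i) \<in> upper_pairs \<Longrightarrow> i = j"
  by (auto simp: upper_pairs_def)

lemma upper_pairs_refl: "(i, i) \<in> upper_pairs"
  by (auto simp: upper_pairs_def)

text \<open>The relation and its converse cover all pairs and meet in the diagonal. For
  \<open>'d option\<close> the count is binom(d+2,2), hence the vertices can be labelled by the
  coefficients of a symmetric matrix; this labelling is the \<open>\<psi>\<close> of the later
  lemmas. The order by \<open>to_nat\<close> is an arbitrary total order on an index type that has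
  none.\<close>

lemma card_upper_pairs: "card (upper_pairs :: ('o::finite \<times> 'o) set) = (CARD('o) + 1) choose 2"
proof -
  let ?L = "upper_pairs :: ('o \<times> 'o) set"
  have "?L \<union> ?L\<inverse> = UNIV" using upper_pairs_total by fastforce
  moreover have "?L \<inter> ?L\<inverse> = (\<lambda>i. (i, i)) ` UNIV"
    using upper_pairs_antisym upper_pairs_refl by auto
  moreover have "card ?L + card (?L\<inverse>) = card (?L \<union> ?L\<inverse>) + card (?L \<inter> ?L\<inverse>)"
    by (rule card_Un_Int) auto
  moreover have "card ((\<lambda>i :: 'o. (i, i)) ` UNIV) = CARD('o)"
    by (simp add: card_image inj_on_def)
  ultimately have "2 * card ?L = CARD('o) * CARD('o) + CARD('o)"
    by (simp add: card_cartesian_product flip: UNIV_Times_UNIV)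
  then show ?thesis by (simp add: choose_two algebra_simps)
qed

text \<open>
  The rows indexed outside \<^const>\<open>upper_pairs\<close> force a matrix in the kernel to be symmetric; this
  makes the linear system of the quadrics through the points a square one.
\<close>

definition quadric_matrix ::
    "('d option \<times> 'd option \<Rightarrow> 'v) \<Rightarrow> ('v, 'd::finite) realization
      \<Rightarrow> real^('d option \<times> 'd option)^('d option \<times> 'd option)" where
  "quadric_matrix \<psi> q = (\<chi> r c. if r \<in> upper_pairs
       then hat (q (\<psi> r)) $ fst c * hat (q (\<psi> r)) $ snd c
       else of_bool (c = r) - of_bool (c = prod.swap r))"

definition vec_of_matrix :: "real^'n^'m \<Rightarrow> real^('m \<times> 'n)" where
  "vec_of_matrix S = (\<chi> c. S $ fst c $ snd c)"

lemma vec_of_matrix_eq_0_iff: "vec_of_matrix S = 0 \<longleftrightarrow> S = 0"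
  by (simp add: vec_of_matrix_def vec_eq_iff)

lemma vec_of_matrix_surj: "\<exists>S. x = vec_of_matrix S"
  by (rule exI[of _ "\<chi> i j. x $ (i, j)"]) (simp add: vec_of_matrix_def vec_eq_iff)

lemma quadric_matrix_mult:
  "(quadric_matrix \<psi> q *v vec_of_matrix S) $ r =
     (if r \<in> upper_pairs then hat (q (\<psi> r)) \<bullet> (S *v hat (q (\<psi> r)))
      else S $ fst r $ snd r - S $ snd r $ fst r)"
proof (cases "r \<in> upper_pairs")
  case True
  have "(quadric_matrix \<psi> q *v vec_of_matrix S) $ r =
      (\<Sum>c\<in>UNIV \<times> UNIV. hat (q (\<psi> r)) $ fst c * hat (q (\<psi> r)) $ snd c * S $ fst c $ snd c)"
    using True by (simp add: matrix_vector_mult_def quadric_matrix_def vec_of_matrix_def)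
  also have "\<dots> = hat (q (\<psi> r)) \<bullet> (S *v hat (q (\<psi> r)))"
    unfolding inner_matrix_vector_mult sum.cartesian_product
    by (rule sum.cong) (auto simp: mult_ac)
  finally show ?thesis using True by simp
next
  case False
  then show ?thesis
    by (simp add: matrix_vector_mult_def quadric_matrix_def vec_of_matrix_def left_diff_distrib
        sum_subtractf)
qed

lemma invertible_iff_ker:
  "invertible A \<longleftrightarrow> (\<forall>x. (A :: real^'n^'n) *v x = 0 \<longrightarrow> x = 0)"
  using invertible_left_inverse matrix_left_invertible_ker by metis

text \<open>Expressed by a determinant, absence of a quadric can be tested by a rational polynomial
  and is seen to be an open condition.\<close>

lemma det_quadric_matrix:
  fixes q :: "('v, 'd::finite) realization"
  assumes "bij_betw \<psi> (upper_pairs :: ('d option \<times> 'd option) set) V"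
  shows "det (quadric_matrix \<psi> q) \<noteq> 0 \<longleftrightarrow> no_quadric V q"
proof -
  have V: "V = \<psi> ` upper_pairs" using assms by (simp add: bij_betw_imp_surj_on)
  have key: "quadric_matrix \<psi> q *v vec_of_matrix S = 0 \<longleftrightarrow>
     (\<forall>i j. S $ i $ j = S $ j $ i) \<and> (\<forall>u\<in>V. hat (q u) \<bullet> (S *v hat (q u)) = 0)" for S
  proof
    assume 0: "quadric_matrix \<psi> q *v vec_of_matrix S = 0"
    have "S $ i $ j = S $ j $ i" for i j
    proof (cases "(i, j) \<in> upper_pairs")
      case False
      then show ?thesis using quadric_matrix_mult[of \<psi> q S "(i, j)"] 0 by simp
    next
      case True
      then show ?thesis
        using quadric_matrix_mult[of \<psi> q S "(j, i)"] 0 upper_pairs_antisym[of i j] by (auto split: if_splits)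
    qed
    moreover have "hat (q (\<psi> r)) \<bullet> (S *v hat (q (\<psi> r))) = 0" if "r \<in> upper_pairs" for r
      using quadric_matrix_mult[of \<psi> q S r] 0 that by simp
    ultimately show "(\<forall>i j. S $ i $ j = S $ j $ i) \<and> (\<forall>u\<in>V. hat (q u) \<bullet> (S *v hat (q u)) = 0)"
      unfolding V by blast
  next
    assume "(\<forall>i j. S $ i $ j = S $ j $ i) \<and> (\<forall>u\<in>V. hat (q u) \<bullet> (S *v hat (q u)) = 0)"
    then show "quadric_matrix \<psi> q *v vec_of_matrix S = 0"
      unfolding V vec_eq_iff quadric_matrix_mult by auto
  qed
  have "det (quadric_matrix \<psi> q) \<noteq> 0 \<longleftrightarrow>
      (\<forall>S. quadric_matrix \<psi> q *v vec_of_matrix S = 0 \<longrightarrow> S = 0)"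
    unfolding invertible_det_nz[symmetric] invertible_iff_ker
    using vec_of_matrix_surj vec_of_matrix_eq_0_iff by metis
  then show ?thesis unfolding key no_quadric_def .
qed

text \<open>The matrix is square, so its transpose is invertible as well. The relation
  \<open>c\<close> becomes a kernel vector of the transpose, padded by 0 on the rows that encode
  symmetry.\<close>

lemma no_quadric_independent:
  fixes q :: "('v, 'd::finite) realization"
  assumes \<psi>: "bij_betw \<psi> (upper_pairs :: ('d option \<times> 'd option) set) V" and q: "no_quadric V q"
    and 0: "\<And>i j. (\<Sum>u\<in>V. c u * (hat (q u) $ i * hat (q u) $ j)) = 0" and u: "u \<in> V"
  shows "c u = 0"
proof -
  let ?A = "quadric_matrix \<psi> q"
  define y :: "real^('d option \<times> 'd option)" where
    "y = (\<chi> r. if r \<in> upper_pairs then c (\<psi> r) else 0)"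
  have "invertible (transpose ?A)"
    using det_quadric_matrix[OF \<psi>] q by (simp add: transpose_invertible invertible_det_nz)
  moreover have "transpose ?A *v y = 0"
  proof -
    have "(transpose ?A *v y) $ k = 0" for k
    proof -
      have "(transpose ?A *v y) $ k =
          (\<Sum>r\<in>UNIV. if r \<in> upper_pairs
              then c (\<psi> r) * (hat (q (\<psi> r)) $ fst k * hat (q (\<psi> r)) $ snd k) else 0)"
        by (simp add: matrix_vector_mult_def transpose_def y_def quadric_matrix_def
            if_distrib if_distribR mult_ac cong: if_cong)
      also have "\<dots> = (\<Sum>r\<in>upper_pairs. c (\<psi> r) * (hat (q (\<psi> r)) $ fst k * hat (q (\<psi> r)) $ snd k))"
        by (simp add: sum.If_cases)
      also have "\<dots> = (\<Sum>u\<in>V. c u * (hat (q u) $ fst k * hat (q u) $ snd k))"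
        by (rule sum.reindex_bij_betw[OF \<psi>])
      finally show ?thesis using 0 by simp
    qed
    then show ?thesis by (simp add: vec_eq_iff)
  qed
  ultimately have "y = 0" by (simp add: invertible_iff_ker)
  then have y: "y $ r = 0" for r by simp
  obtain r where "r \<in> upper_pairs" "u = \<psi> r" using \<psi> u by (auto simp: bij_betw_def)
  then show ?thesis using y[of r] by (simp add: y_def)
qed

section \<open>A concrete configuration on no quadric, and the passage to generic points\<close>

definition unit_point :: "'d option \<Rightarrow> real^'d::finite" where
  "unit_point i = (case i of None \<Rightarrow> 0 | Some j \<Rightarrow> axis j 1)"

lemma hat_unit_point: "hat (unit_point i) = (if i = None then axis None 1 else axis None 1 + axis i 1)"
  by (auto simp: vec_eq_iff unit_point_def axis_def hat_def split: option.splits)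

lemma hat_unit_point_add: "i \<noteq> None \<Longrightarrow> j \<noteq> None \<Longrightarrow>
   hat (unit_point i + unit_point j) = axis None 1 + axis i 1 + axis j 1"
  by (auto simp: vec_eq_iff unit_point_def axis_def hat_def split: option.splits)

lemma hat_uminus_unit_point: "i \<noteq> None \<Longrightarrow> hat (- unit_point i) = axis None 1 - axis i 1"
  by (auto simp: vec_eq_iff unit_point_def axis_def hat_def split: option.splits)

lemma unit_point_None [simp]: "unit_point None = 0"
  by (simp add: unit_point_def)

lemma inner_axis_matrix_axis: "axis i (1::real) \<bullet> (S *v axis j 1) = S $ i $ j"
  by (simp add: matrix_vector_mult_basis inner_axis' column_def)

text \<open>The test points are 0, e_i, -e_i and e_i + e_j, labelled by \<open>(None, None)\<close>,
  \<open>(None, i)\<close>, \<open>(i, i)\<close> and \<open>(i, j)\<close>. The origin yields the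
  constant coefficient, e_i and -e_i the linear and square ones, and e_i + e_j then the mixed
  ones.\<close>

lemma quadric_vanishing_unit_points:
  fixes S :: "real^'d::finite option^'d option"
  assumes sym: "\<And>i j. S $ i $ j = S $ j $ i"
    and 0: "\<And>i j. (i, j) \<in> upper_pairs \<Longrightarrow>
      (let x = hat (if i = j then - unit_point i else unit_point i + unit_point j) in x \<bullet> (S *v x)) = 0"
  shows "S = 0"
proof -
  note expand = inner_add_left inner_diff_left inner_add_right inner_diff_right
    matrix_vector_right_distrib matrix_vector_mult_diff_distrib inner_axis_matrix_axis
  have N: "S $ None $ None = 0"
    using 0[of None None] hat_unit_point[of "None :: 'd option"]
    by (simp add: upper_pairs_refl inner_axis_matrix_axis)
  have plus: "(let x = hat (unit_point i + unit_point j) in x \<bullet> (S *v x)) = 0" if "i \<noteq> j" for i j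
    using 0[of i j] 0[of j i] upper_pairs_total[of i j] that by (auto simp: add.commute)
  have NS: "S $ None $ i = 0 \<and> S $ i $ i = 0" if "i \<noteq> None" for i
  proof -
    have "S $ None $ i + S $ i $ None + S $ i $ i = 0"
      using plus[of None i] that N by (simp add: hat_unit_point expand)
    moreover have "S $ i $ i - S $ None $ i - S $ i $ None = 0"
      using 0[of i i] that N by (simp add: hat_uminus_unit_point expand upper_pairs_refl)
    ultimately show ?thesis using sym[of i None] by linarith
  qed
  have "S $ i $ j = 0" if "i \<noteq> None" "j \<noteq> None" "i \<noteq> j" for i j
  proof -
    have "S $ i $ j + S $ j $ i = 0"
      using plus[of i j] that N NS[of i] NS[of j] sym[of i None] sym[of j None]
      by (simp add: hat_unit_point_add expand)
    then show ?thesis using sym[of i j] by linarith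
  qed
  then have "S $ i $ j = 0" for i j
    by (cases "i = None"; cases "j = None"; cases "i = j") (use N NS sym[of i None] in auto)
  then show ?thesis by (simp add: vec_eq_iff)
qed

lemma generic_imp_no_quadric:
  fixes p :: "('v, 'd::finite) realization"
  assumes \<psi>: "bij_betw \<psi> (upper_pairs :: ('d option \<times> 'd option) set) V" and "generic_realization V p"
  shows "no_quadric V p"
proof -
  let ?J = "V \<times> (UNIV :: 'd set)"
  have V: "V = \<psi> ` upper_pairs" using \<psi> by (simp add: bij_betw_imp_surj_on)
  then have J: "finite ?J" by (intro finite_cartesian_product) auto
  define F where "F = (\<lambda>x :: 'v \<times> 'd \<Rightarrow> real. det (quadric_matrix \<psi> (\<lambda>v. \<chi> i. x (v, i))))"
  have hat: "rat_polynomial ?J (\<lambda>x. hat (\<chi> i. x (v, i)) $ k)" if "v \<in> V" for v k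
    using that by (cases k) (auto intro: rat_polynomial_1 rat_polynomial_var)
  have "rat_polynomial ?J F"
    unfolding F_def
  proof (rule rat_polynomial_det[OF J])
    fix r c :: "'d option \<times> 'd option"
    show "rat_polynomial ?J (\<lambda>x. quadric_matrix \<psi> (\<lambda>v. \<chi> i. x (v, i)) $ r $ c)"
    proof (cases "r \<in> upper_pairs")
      case True
      then have "\<psi> r \<in> V" using V by blast
      then show ?thesis unfolding quadric_matrix_def
        by (simp add: rat_polynomial_mult[OF J] hat True)
    next
      case False
      then show ?thesis using rat_polynomial_const[of ?J "of_bool (c = r) - of_bool (c = prod.swap r)"]
        by (simp add: quadric_matrix_def of_rat_diff of_bool_def split: if_splits)
    qed
  qed
  \<comment> \<open>The vertex labelled \<open>(i, j)\<close> is put at the test point with that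
    label; there the polynomial \<open>F\<close> is nonzero.\<close>
  moreover define p0 :: "('v, 'd) realization" where
    "p0 = (\<lambda>v. let (i, j) = inv_into upper_pairs \<psi> v in
       if i = j then - unit_point i else unit_point i + unit_point j)"
  have p0: "p0 (\<psi> (i, j)) = (if i = j then - unit_point i else unit_point i + unit_point j)"
    if "(i, j) \<in> upper_pairs" for i j
    unfolding p0_def using \<psi> that by (simp add: bij_betw_inv_into_left)
  have "no_quadric V p0"
    unfolding no_quadric_def
  proof (intro allI impI, elim conjE)
    fix S :: "real^'d option^'d option"
    assume sym: "\<forall>i j. S $ i $ j = S $ j $ i" and 0: "\<forall>u\<in>V. hat (p0 u) \<bullet> (S *v hat (p0 u)) = 0"
    show "S = 0"
    proof (rule quadric_vanishing_unit_points)
      show "S $ i $ j = S $ j $ i" for i j using sym by blast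
      fix i j :: "'d option" assume "(i, j) \<in> upper_pairs"
      then show "(let x = hat (if i = j then - unit_point i else unit_point i + unit_point j) in x \<bullet> (S *v x)) = 0"
        using bspec[OF 0, of "\<psi> (i, j)"] by (simp only: p0 Let_def V) blast
    qed
  qed
  then have "F (\<lambda>(v, i). p0 v $ i) \<noteq> 0"
    unfolding F_def using det_quadric_matrix[OF \<psi>, of p0] by simp
  ultimately have "F (\<lambda>(v, i). p v $ i) \<noteq> 0"
    using rat_polynomial_nonzero[OF J] assms(2) unfolding generic_realization_def by blast
  then show ?thesis
    unfolding F_def using det_quadric_matrix[OF \<psi>, of p] by simp
qed

lemma det_hat_rows:
  fixes q :: "('v, 'd::finite) realization"
  assumes "bij_betw g UNIV U"
  shows "det (\<chi> i. hat (q (g i)) :: real^'d option^'d option) \<noteq> 0 \<longleftrightarrow>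
           (\<forall>y. (\<forall>u\<in>U. hat (q u) \<bullet> y = 0) \<longrightarrow> y = 0)"
proof -
  have U: "U = range g" using assms by (simp add: bij_betw_imp_surj_on)
  show ?thesis
    unfolding invertible_det_nz[symmetric] invertible_iff_ker U
    by (simp add: vec_eq_iff matrix_vector_mul_component)
qed

lemma card_eq_bij_option:
  assumes "card U = CARD('d::finite) + 1"
  shows "\<exists>g :: 'd option \<Rightarrow> 'v. bij_betw g UNIV U"
proof -
  have "finite U" using assms by (metis card.infinite add_is_0 one_neq_zero)
  then show ?thesis
    using finite_same_card_bij[of "UNIV :: 'd option set" U] assms by (simp add: card_UNIV_option)
qed

lemma generic_imp_affinely_general:
  fixes p :: "('v, 'd::finite) realization"
  assumes "finite V" and "generic_realization V p"
  shows "affinely_general V p"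
  unfolding affinely_general_def
proof (intro allI impI)
  fix U and y :: "real^'d option"
  assume U: "U \<subseteq> V" "card U = CARD('d) + 1" and y: "\<forall>u\<in>U. hat (p u) \<bullet> y = 0"
  let ?J = "V \<times> (UNIV :: 'd set)"
  have J: "finite ?J" using assms by simp
  obtain g :: "'d option \<Rightarrow> 'v" where g: "bij_betw g UNIV U"
    using card_eq_bij_option[OF U(2)] by blast
  have gV: "g i \<in> V" for i using g U by (auto simp: bij_betw_def)
  define F where "F = (\<lambda>x :: 'v \<times> 'd \<Rightarrow> real. det (\<chi> i. hat (\<chi> k. x (g i, k)) :: real^'d option^'d option))"
  have "rat_polynomial ?J F"
    unfolding F_def
  proof (rule rat_polynomial_det[OF J])
    fix i k :: "'d option"
    show "rat_polynomial ?J (\<lambda>x. (\<chi> i. hat (\<chi> k. x (g i, k)) :: real^'d option^'d option) $ i $ k)"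
      using gV by (cases k) (auto intro: rat_polynomial_1 rat_polynomial_var)
  qed
  \<comment> \<open>The witness is a simplex: the origin and the unit vectors.\<close>
  moreover have "F (\<lambda>(v, k). unit_point (inv g v) $ k) \<noteq> 0"
  proof -
    have inv: "inv g (g i) = i" for i using g by (auto simp: bij_betw_def)
    have "y = 0" if "\<forall>u\<in>U. hat (unit_point (inv g u)) \<bullet> y = 0" for y :: "real^'d option"
    proof -
      have *: "hat (unit_point i) \<bullet> y = 0" for i
        using that inv[of i] g by (metis UNIV_I bij_betwE)
      have "y $ None = 0" using *[of None] hat_unit_point[of "None :: 'd option"]
        by (simp add: inner_axis')
      moreover have "y $ i = 0" if "i \<noteq> None" for i
        using *[of i] hat_unit_point[of i] calculation that by (simp add: inner_axis' inner_add_left)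
      ultimately show ?thesis by (metis vec_eq_iff zero_index)
    qed
    then show ?thesis using det_hat_rows[OF g, of "\<lambda>v. unit_point (inv g v)"] by (simp add: F_def)
  qed
  ultimately have "F (\<lambda>(v, i). p v $ i) \<noteq> 0"
    using rat_polynomial_nonzero[OF J] assms(2) unfolding generic_realization_def by blast
  then show "y = 0" using det_hat_rows[OF g, of p] y by (simp add: F_def)
qed

lemma generic_imp_well_placed:
  fixes p :: "('v, 'd::finite) realization"
  assumes "bij_betw \<psi> (upper_pairs :: ('d option \<times> 'd option) set) V" and "generic_realization V p"
  shows "well_placed V p"
  using generic_imp_affinely_general[OF _ assms(2)] generic_imp_no_quadric[OF assms]
    bij_betw_finite[OF assms(1)] by (simp add: well_placed_def)

lemma tendsto_det:
  fixes A :: "'t \<Rightarrow> real^'n^'n"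
  assumes "\<And>i j. ((\<lambda>t. A t $ i $ j) \<longlongrightarrow> B $ i $ j) F"
  shows "((\<lambda>t. det (A t)) \<longlongrightarrow> det B) F"
  unfolding det_def by (intro tendsto_intros assms)

lemma tendsto_hat:
  assumes "(q \<longlongrightarrow> x) F"
  shows "((\<lambda>t. hat (q t) $ i) \<longlongrightarrow> hat x $ i) F"
  by (cases i) (auto intro: tendsto_vec_nth assms)

text \<open>Finitely many determinants that are nonzero at \<open>p\<close> stay nonzero nearby. The
  filter is general because the lemma serves both for the times of a flexing and for neighbouring
  configurations.\<close>

lemma eventually_well_placed:
  fixes p :: "('v, 'd::finite) realization"
  assumes \<psi>: "bij_betw \<psi> (upper_pairs :: ('d option \<times> 'd option) set) V"
    and q: "\<And>v. v \<in> V \<Longrightarrow> ((\<lambda>t. q t v) \<longlongrightarrow> p v) F" and "well_placed V p"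
  shows "\<forall>\<^sub>F t in F. well_placed V (q t)"
proof -
  have V: "V = \<psi> ` upper_pairs" using \<psi> by (simp add: bij_betw_imp_surj_on)
  then have fin: "finite V" by simp
  have "((\<lambda>t. det (quadric_matrix \<psi> (q t))) \<longlongrightarrow> det (quadric_matrix \<psi> p)) F"
  proof (rule tendsto_det)
    fix r c :: "'d option \<times> 'd option"
    show "((\<lambda>t. quadric_matrix \<psi> (q t) $ r $ c) \<longlongrightarrow> quadric_matrix \<psi> p $ r $ c) F"
      by (cases "r \<in> upper_pairs")
         (auto simp: quadric_matrix_def V intro!: tendsto_intros tendsto_hat q)
  qed
  then have "\<forall>\<^sub>F t in F. det (quadric_matrix \<psi> (q t)) \<noteq> 0"
    using assms(3) det_quadric_matrix[OF \<psi>] by (intro tendsto_imp_eventually_ne) (auto simp: well_placed_def)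
  then have 1: "\<forall>\<^sub>F t in F. no_quadric V (q t)"
    using det_quadric_matrix[OF \<psi>] by simp
  have "\<forall>\<^sub>F t in F. \<forall>U\<in>{U. U \<subseteq> V \<and> card U = CARD('d) + 1}.
      \<forall>y. (\<forall>u\<in>U. hat (q t u) \<bullet> y = 0) \<longrightarrow> y = 0"
  proof (rule eventually_ball_finite)
    show "finite {U. U \<subseteq> V \<and> card U = CARD('d) + 1}" using fin by simp
    show "\<forall>U\<in>{U. U \<subseteq> V \<and> card U = CARD('d) + 1}.
      \<forall>\<^sub>F t in F. \<forall>y. (\<forall>u\<in>U. hat (q t u) \<bullet> y = 0) \<longrightarrow> y = 0"
    proof
      fix U assume U: "U \<in> {U. U \<subseteq> V \<and> card U = CARD('d) + 1}"
      then obtain g :: "'d option \<Rightarrow> 'v" where g: "bij_betw g UNIV U"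
        using card_eq_bij_option[of U] by blast
      have gV: "g i \<in> V" for i using g U by (auto simp: bij_betw_def)
      have "((\<lambda>t. det (\<chi> i. hat (q t (g i)) :: real^'d option^'d option)) \<longlongrightarrow>
          det (\<chi> i. hat (p (g i)) :: real^'d option^'d option)) F"
        by (rule tendsto_det) (auto intro!: tendsto_hat q gV)
      moreover have "det (\<chi> i. hat (p (g i)) :: real^'d option^'d option) \<noteq> 0"
        using det_hat_rows[OF g, of p] assms(3) U unfolding well_placed_def affinely_general_def by blast
      ultimately have "\<forall>\<^sub>F t in F. det (\<chi> i. hat (q t (g i)) :: real^'d option^'d option) \<noteq> 0"
        by (rule tendsto_imp_eventually_ne)
      then show "\<forall>\<^sub>F t in F. \<forall>y. (\<forall>u\<in>U. hat (q t u) \<bullet> y = 0) \<longrightarrow> y = 0"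
        using det_hat_rows[OF g] by simp
    qed
  qed
  with 1 show ?thesis
    by eventually_elim (auto simp: well_placed_def affinely_general_def)
qed

text \<open>A motion acts on homogeneous coordinates by an invertible matrix \<open>M\<close>.
  Hyperplanes are pulled back by the transpose of \<open>M\<close> and quadrics by the congruence
  M^T S M, so none can appear in the image. With the identity, the lemma also passes to a
  realization that agrees with \<open>p\<close> on \<open>V\<close>.\<close>

lemma well_placed_motion:
  fixes p :: "('v, 'd::finite) realization"
  assumes p: "well_placed V p" and T: "euclidean_motion T" and q: "\<And>v. v \<in> V \<Longrightarrow> q v = T (p v)"
  shows "well_placed V q"
proof -
  obtain A b where A: "orthogonal_transformation A" and T: "T = (\<lambda>x. A x + b)"
    using T unfolding euclidean_motion_def by (auto simp: fun_eq_iff)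
  define M :: "real^'d option^'d option" where
    "M = (\<chi> i j. case i of None \<Rightarrow> of_bool (j = None)
            | Some i' \<Rightarrow> (case j of None \<Rightarrow> b $ i' | Some j' \<Rightarrow> A (axis j' 1) $ i'))"
  have linA: "linear A" using A by (simp add: orthogonal_transformation_linear)
  have MN: "(M *v y) $ None = y $ None" for y
    by (simp add: M_def matrix_vector_mult_def sum_option)
  have MS: "(M *v y) $ Some i = b $ i * y $ None + A (\<chi> j. y $ Some j) $ i" for y i
  proof -
    have "A (\<chi> j. y $ Some j) = (\<Sum>j\<in>UNIV. y $ Some j *\<^sub>R A (axis j 1))"
      by (subst basis_expansion[of "\<chi> j. y $ Some j", symmetric])
         (simp add: linear_sum[OF linA] linear_cmul[OF linA] scalar_mult_eq_scaleR)
    then show ?thesis by (simp add: M_def matrix_vector_mult_def sum_option mult_ac)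
  qed
  have hat: "M *v hat x = hat (T x)" for x
  proof -
    have "(\<chi> j. hat x $ Some j) = x" by (simp add: vec_eq_iff)
    then have "(M *v hat x) $ i = hat (T x) $ i" for i
      by (cases i) (simp_all add: MN MS T add.commute)
    then show ?thesis by (simp add: vec_eq_iff)
  qed
  have "invertible M"
    unfolding invertible_iff_ker
  proof (intro allI impI)
    fix y assume "M *v y = 0"
    then have 0: "y $ None = 0" "A (\<chi> j. y $ Some j) = 0"
      using MN[of y] MS[of y] by (auto simp: vec_eq_iff)
    have "(\<chi> j. y $ Some j) = 0"
      using 0(2) A by (metis orthogonal_transformation_norm norm_eq_zero)
    then have "y $ i = 0" for i using 0(1) by (cases i) (auto simp: vec_eq_iff)
    then show "y = 0" by (simp add: vec_eq_iff)
  qed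
  then obtain M' where M': "M ** M' = mat 1" "M' ** M = mat 1" by (auto simp: invertible_def)
  have qT: "hat (q u) = M *v hat (p u)" if "u \<in> V" for u using q[OF that] hat by simp
  have "affinely_general V q"
    unfolding affinely_general_def
  proof (intro allI impI)
    fix U and y :: "real^'d option"
    assume U: "U \<subseteq> V" "card U = CARD('d) + 1" and y: "\<forall>u\<in>U. hat (q u) \<bullet> y = 0"
    have "\<forall>u\<in>U. hat (p u) \<bullet> (transpose M *v y) = 0"
      using y U(1) qT by (metis dot_lmul_matrix inner_commute subsetD transpose_matrix_vector transpose_transpose)
    then have "transpose M *v y = 0"
      using p U unfolding well_placed_def affinely_general_def by blast
    then show "y = 0"
      using \<open>invertible M\<close> transpose_invertible invertible_iff_ker by blast
  qed
  moreover have "no_quadric V q"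
    unfolding no_quadric_def
  proof (intro allI impI, elim conjE)
    fix S :: "real^'d option^'d option"
    assume sym: "\<forall>i j. S $ i $ j = S $ j $ i" and 0: "\<forall>u\<in>V. hat (q u) \<bullet> (S *v hat (q u)) = 0"
    let ?S = "transpose M ** S ** M"
    have St: "transpose S = S" using sym by (simp add: transpose_def vec_eq_iff)
    have "transpose ?S = ?S" by (simp add: matrix_transpose_mul St matrix_mul_assoc)
    then have "?S $ i $ j = ?S $ j $ i" for i j using transpose_nth[of ?S] by simp
    moreover have "hat (p u) \<bullet> (?S *v hat (p u)) = 0" if "u \<in> V" for u
    proof -
      have "hat (p u) \<bullet> (?S *v hat (p u)) = hat (p u) \<bullet> (transpose M *v (S *v (M *v hat (p u))))"
        by (simp add: matrix_vector_mul_assoc matrix_mul_assoc)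
      also have "\<dots> = (M *v hat (p u)) \<bullet> (S *v (M *v hat (p u)))"
        by (metis dot_lmul_matrix inner_commute transpose_matrix_vector transpose_transpose)
      finally show ?thesis using 0 that qT by simp
    qed
    ultimately have "?S = 0" using p unfolding well_placed_def no_quadric_def by blast
    then have "transpose M' ** ?S ** M' = 0" by simp
    then have "(transpose (M ** M')) ** S ** (M ** M') = 0"
      by (simp add: matrix_transpose_mul matrix_mul_assoc)
    then show "S = 0" by (simp add: M' transpose_mat)
  qed
  ultimately show ?thesis by (simp add: well_placed_def)
qed

section \<open>Infinitesimal rigidity and stresses of chains\<close>

text \<open>As a simp rule it rewrites a transposed matrix times a vector into a vector times a
  matrix, which would hide the alternation between S and its transpose.\<close>

declare transpose_matrix_vector [simp del]

text \<open>The conclusion is that all pairwise distances are stationary, not that \<open>v\<close>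
  comes from a skew matrix; in this form it applies directly to derivatives of distances along a
  flexing.\<close>

definition infinitesimally_rigid ::
    "'v set \<Rightarrow> ('v \<times> 'v) set \<Rightarrow> ('v, 'd::finite) realization \<Rightarrow> bool" where
  "infinitesimally_rigid V E q \<longleftrightarrow>
     (\<forall>v. (\<forall>(u, w)\<in>E. (q u - q w) \<bullet> (v u - v w) = 0) \<longrightarrow>
          (\<forall>u\<in>V. \<forall>w\<in>V. (q u - q w) \<bullet> (v u - v w) = 0))"

lemma uminus_matrix_vector_mult: "(- X) *v (y :: real^'n) = - (X *v y)"
  by (simp add: vec_eq_iff matrix_vector_mult_def sum_negf)

section \<open>Linear algebra of points in affine general position\<close>

lemma affinely_general_matrix:
  fixes q :: "('v, 'd::finite) realization"
  assumes "affinely_general V q" "U \<subseteq> V" "card U = CARD('d) + 1"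
  obtains g :: "'d option \<Rightarrow> 'v" and H H' :: "real^'d option^'d option"
  where "bij_betw g UNIV U" "\<forall>i. H $ i = hat (q (g i))" "H ** H' = mat 1" "H' ** H = mat 1"
proof -
  obtain g :: "'d option \<Rightarrow> 'v" where g: "bij_betw g UNIV U"
    using card_eq_bij_option[OF assms(3)] by blast
  let ?H = "\<chi> i. hat (q (g i))"
  have "det ?H \<noteq> 0"
    using det_hat_rows[OF g, of q] assms unfolding affinely_general_def by blast
  then have "invertible ?H" by (simp add: invertible_det_nz)
  then show ?thesis using that[OF g, of ?H] unfolding invertible_def by auto
qed

lemma affinely_general_independent:
  fixes q :: "('v, 'd::finite) realization"
  assumes "affinely_general V q" "U \<subseteq> V" "card U = CARD('d) + 1"
    and 0: "\<And>i. (\<Sum>u\<in>U. c u * hat (q u) $ i) = 0" and "u \<in> U"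
  shows "c u = 0"
proof -
  obtain g :: "'d option \<Rightarrow> 'v" and H H' :: "real^'d option^'d option"
    where g: "bij_betw g UNIV U" and H: "\<forall>i. H $ i = hat (q (g i))"
    and I: "H ** H' = mat 1" "H' ** H = mat 1"
    using affinely_general_matrix[OF assms(1-3)] by metis
  define x where "x = (\<chi> i. c (g i))"
  have "(transpose H *v x) $ i = 0" for i
    using 0[of i] sum.reindex_bij_betw[OF g, of "\<lambda>u. c u * hat (q u) $ i"]
    by (simp add: matrix_vector_mult_def transpose_def H x_def mult.commute)
  then have "transpose H *v x = 0" by (simp add: vec_eq_iff)
  moreover have "invertible (transpose H)"
    using I by (intro transpose_invertible) (auto simp: invertible_def)
  ultimately have "x = 0" by (simp add: invertible_iff_ker)
  then have x: "x $ i = 0" for i by simp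
  obtain i where "u = g i" using g \<open>u \<in> U\<close> by (auto simp: bij_betw_def)
  then show ?thesis using x[of i] by (simp add: x_def)
qed

lemma affinely_general_span:
  fixes q :: "('v, 'd::finite) realization"
  assumes "affinely_general V q" "U \<subseteq> V" "card U = CARD('d) + 1"
  obtains c where "z = (\<Sum>u\<in>U. c u *\<^sub>R hat (q u))"
proof -
  obtain g :: "'d option \<Rightarrow> 'v" and H H' :: "real^'d option^'d option"
    where g: "bij_betw g UNIV U" and H: "\<forall>i. H $ i = hat (q (g i))"
    and I: "H ** H' = mat 1" "H' ** H = mat 1"
    using affinely_general_matrix[OF assms(1-3)] by metis
  define x where "x = transpose H' *v z"
  have "transpose H *v x = transpose (H' ** H) *v z"
    by (simp add: x_def matrix_vector_mul_assoc matrix_transpose_mul)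
  then have z: "transpose H *v x = z" by (simp add: I transpose_mat)
  define c where "c = (\<lambda>u. x $ inv g u)"
  have "inv g (g i) = i" for i using g by (auto simp: bij_betw_def)
  then have "(\<Sum>u\<in>U. c u *\<^sub>R hat (q u)) = (\<Sum>i\<in>UNIV. x $ i *\<^sub>R H $ i)"
    by (subst sum.reindex_bij_betw[OF g, symmetric]) (simp add: c_def H)
  also have "\<dots> = transpose H *v x"
    by (simp add: vec_eq_iff matrix_vector_mult_def transpose_def mult.commute)
  finally show ?thesis using that z by metis
qed

lemma affinely_general_interpolate:
  fixes q :: "('v, 'd::finite) realization" and y :: "'v \<Rightarrow> real^'d option"
  assumes "affinely_general V q" "U \<subseteq> V" "card U = CARD('d) + 1"
  obtains S where "\<And>u. u \<in> U \<Longrightarrow> S *v hat (q u) = y u"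
proof -
  obtain g :: "'d option \<Rightarrow> 'v" and H H' :: "real^'d option^'d option"
    where g: "bij_betw g UNIV U" and H: "\<forall>i. H $ i = hat (q (g i))"
    and I: "H ** H' = mat 1" "H' ** H = mat 1"
    using affinely_general_matrix[OF assms(1-3)] by metis
  define Y where "Y = (\<chi> i. y (g i))"
  have row: "transpose X *v axis i 1 = X $ i" for X :: "real^'d option^'d option" and i
    by (simp add: matrix_vector_mult_basis column_def transpose_def vec_eq_iff)
  have "transpose (H' ** Y) *v hat (q (g i)) = y (g i)" for i
  proof -
    have "transpose (H' ** Y) *v hat (q (g i)) = transpose (H' ** Y) *v (transpose H *v axis i 1)"
      by (simp add: row H)
    also have "\<dots> = transpose (H ** H' ** Y) *v axis i 1"
      by (simp add: matrix_vector_mul_assoc matrix_transpose_mul matrix_mul_assoc)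
    also have "\<dots> = y (g i)" by (simp only: I row matrix_mul_lid) (simp add: Y_def)
    finally show ?thesis .
  qed
  then show ?thesis using that[of "transpose (H' ** Y)"] g by (metis bij_betw_imp_surj_on imageE)
qed

lemma affinely_general_separates:
  fixes q :: "('v, 'd::finite) realization"
  assumes "affinely_general V q" "U \<subseteq> V" "card U \<ge> CARD('d) + 1"
    and "\<And>u. u \<in> U \<Longrightarrow> hat (q u) \<bullet> y = 0"
  shows "y = 0"
proof -
  obtain U' where "U' \<subseteq> U" "card U' = CARD('d) + 1"
    using obtain_subset_with_card_n[OF assms(3)] by metis
  then show ?thesis using assms unfolding affinely_general_def by (meson subset_eq)
qed

text \<open>The chosen point is expanded in d + 1 of the others. Normalizing its coefficient to 1
  lets a product of two such dependencies isolate a prescribed edge.\<close>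

lemma affine_dependency:
  fixes q :: "('v, 'd::finite) realization"
  assumes "affinely_general V q" "U \<subseteq> V" "finite U" "card U \<ge> CARD('d) + 2" "u0 \<in> U"
  obtains c where "c u0 = 1" "(\<Sum>u\<in>U. c u *\<^sub>R hat (q u)) = 0"
proof -
  have "card (U - {u0}) \<ge> CARD('d) + 1" using assms by simp
  then obtain W where W: "W \<subseteq> U - {u0}" "card W = CARD('d) + 1"
    using obtain_subset_with_card_n by metis
  have "W \<subseteq> V" using W assms(2) by blast
  then obtain c where c: "hat (q u0) = (\<Sum>u\<in>W. c u *\<^sub>R hat (q u))"
    using affinely_general_span[OF assms(1)] W(2) by metis
  define b where "b = (\<lambda>u. if u = u0 then 1 else if u \<in> W then - c u else 0)"
  have "(\<Sum>u\<in>U. b u *\<^sub>R hat (q u)) = b u0 *\<^sub>R hat (q u0) + (\<Sum>u\<in>U - {u0}. b u *\<^sub>R hat (q u))"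
    by (rule sum.remove) (use assms in auto)
  also have "(\<Sum>u\<in>U - {u0}. b u *\<^sub>R hat (q u)) = (\<Sum>u\<in>W. b u *\<^sub>R hat (q u))"
    by (rule sum.mono_neutral_right) (use W assms(3) in \<open>auto simp: b_def\<close>)
  also have "\<dots> = - (\<Sum>u\<in>W. c u *\<^sub>R hat (q u))"
    unfolding sum_negf[symmetric] by (rule sum.cong) (use W in \<open>auto simp: b_def\<close>)
  finally have "(\<Sum>u\<in>U. b u *\<^sub>R hat (q u)) = 0" using c by (simp add: b_def)
  then show ?thesis using that[of b] by (simp add: b_def)
qed

text \<open>
  The homogeneous velocity turns the edge equation of an infinitesimal flex into the bilinear
  equation of \<open>edge_form\<close> without quadratic terms in the placement.
\<close>

definition velocity_hat :: "real^'d \<Rightarrow> real^'d \<Rightarrow> real^'d::finite option" where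
  "velocity_hat x v = (\<chi> i. case i of None \<Rightarrow> - (x \<bullet> v) | Some j \<Rightarrow> v $ j)"

lemma inner_velocity_hat: "hat x \<bullet> velocity_hat x' v = x \<bullet> v - x' \<bullet> v"
  by (simp add: inner_vec_def sum_option velocity_hat_def)

definition edge_form where
  "edge_form q v u w = hat (q w) \<bullet> velocity_hat (q u) (v u) + hat (q u) \<bullet> velocity_hat (q w) (v w)"

lemma edge_form: "edge_form q v u w = - ((q u - q w) \<bullet> (v u - v w))"
  by (simp add: edge_form_def inner_velocity_hat inner_diff_left inner_diff_right)

lemma edge_form_commute: "edge_form q v u w = edge_form q v w u"
  by (simp add: edge_form_def)

text \<open>The blocks are indexed by all natural numbers and are empty outside
  \<open>{1..k}\<close>. The end blocks thus have empty neighbours \<open>A 0\<close> and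
  \<open>A (Suc k)\<close>, which spares boundary cases in the edge set and in inductions.\<close>

locale chain =
  fixes k :: nat and A :: "nat \<Rightarrow> 'v set"
  assumes k_ge_4: "k \<ge> 4"
    and finite_block: "finite (A i)"
    and block_eq_empty_iff: "A i = {} \<longleftrightarrow> i \<notin> {1..k}"
    and disjoint_blocks: "u \<in> A i \<Longrightarrow> u \<in> A j \<Longrightarrow> i = j"
begin

definition V where "V = (\<Union>i. A i)"

definition E where "E = (\<Union>i. A i \<times> A (Suc i) \<union> A (Suc i) \<times> A i)"

definition block where "block u = (THE i. u \<in> A i)"

definition side :: "'v \<Rightarrow> real" where "side u = (- 1) ^ block u"

lemma block_eq: "u \<in> A i \<Longrightarrow> block u = i"
  unfolding block_def using disjoint_blocks by (intro the_equality) auto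

lemma V_eq: "V = (\<Union>i\<in>{1..k}. A i)"
  unfolding V_def using block_eq_empty_iff by blast

lemma finite_V: "finite V"
  unfolding V_eq using finite_block by simp

lemma block_subset_V: "A i \<subseteq> V"
  unfolding V_def by blast

lemma E_sym: "(u, w) \<in> E \<Longrightarrow> (w, u) \<in> E"
  unfolding E_def by blast

lemma E_iff: "(u, w) \<in> E \<longleftrightarrow> u \<in> V \<and> w \<in> V \<and> (block w = Suc (block u) \<or> block u = Suc (block w))"
proof
  assume "(u, w) \<in> E"
  then obtain i where "u \<in> A i \<and> w \<in> A (Suc i) \<or> u \<in> A (Suc i) \<and> w \<in> A i" by (auto simp: E_def)
  then show "u \<in> V \<and> w \<in> V \<and> (block w = Suc (block u) \<or> block u = Suc (block w))"
    using block_eq block_subset_V by blast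
next
  assume *: "u \<in> V \<and> w \<in> V \<and> (block w = Suc (block u) \<or> block u = Suc (block w))"
  then obtain i j where "u \<in> A i" "w \<in> A j" by (auto simp: V_def)
  moreover from this have "block u = i" "block w = j" by (auto simp: block_eq)
  ultimately show "(u, w) \<in> E" using * by (auto simp: E_def)
qed

lemma side_edge: "(u, w) \<in> E \<Longrightarrow> side w = - side u"
  unfolding E_iff side_def by auto

lemma side_cases: "side u = 1 \<or> side u = -1"
  unfolding side_def by (cases "even (block u)") auto

lemma sum_V_neighbours:
  fixes f :: "'v \<Rightarrow> 'b::comm_monoid_add"
  assumes "u \<in> A (Suc i)" and "\<And>w. (u, w) \<notin> E \<Longrightarrow> f w = 0"
  shows "sum f V = sum f (A i) + sum f (A (Suc (Suc i)))"
proof -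
  have "sum f V = sum f (A i \<union> A (Suc (Suc i)))"
  proof (rule sum.mono_neutral_right[OF finite_V])
    show "A i \<union> A (Suc (Suc i)) \<subseteq> V" using block_subset_V by blast
    show "\<forall>w\<in>V - (A i \<union> A (Suc (Suc i))). f w = 0"
    proof
      fix w assume w: "w \<in> V - (A i \<union> A (Suc (Suc i)))"
      have "(u, w) \<notin> E"
      proof
        assume "(u, w) \<in> E"
        then have "block w = Suc (Suc i) \<or> Suc i = Suc (block w)"
          using block_eq[OF assms(1)] by (simp add: E_iff)
        moreover obtain j where "w \<in> A j" using w by (auto simp: V_def)
        ultimately show False using w block_eq by auto
      qed
      then show "f w = 0" by (rule assms(2))
    qed
  qed
  also have "\<dots> = sum f (A i) + sum f (A (Suc (Suc i)))"
    by (rule sum.union_disjoint) (use finite_block disjoint_blocks[of _ i "Suc (Suc i)"] in auto)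
  finally show ?thesis .
qed

lemma infinitesimally_rigid_chain:
  fixes q :: "('v, 'd::finite) realization"
  assumes q: "well_placed V q" and big: "\<And>i. i \<in> {2..k - 1} \<Longrightarrow> card (A i) \<ge> CARD('d) + 1"
  shows "infinitesimally_rigid V E q"
  unfolding infinitesimally_rigid_def
proof (intro allI impI)
  fix v :: "('v, 'd) realization"
  assume flex: "\<forall>(u, w)\<in>E. (q u - q w) \<bullet> (v u - v w) = 0"
  define h where "h = (\<lambda>u. hat (q u))"
  define y where "y = (\<lambda>u. velocity_hat (q u) (v u))"
  have general: "affinely_general V q" using q by (simp add: well_placed_def)
  have edge: "h w \<bullet> y u + h u \<bullet> y w = 0" if "(u, w) \<in> E" for u w
    using edge_form[of q v u w] bspec[OF flex that] by (simp add: edge_form_def h_def y_def)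
  have diag: "h u \<bullet> y u = 0" for u by (simp add: h_def y_def inner_velocity_hat)
  have separates: "z = 0" if "i \<in> {2..k - 1}" "\<And>u. u \<in> A i \<Longrightarrow> h u \<bullet> z = 0" for i :: nat and z
    using affinely_general_separates[OF general block_subset_V[of i] big[OF that(1)]] that(2)
    unfolding h_def by blast
  have trans: "(X *v a) \<bullet> b = a \<bullet> (transpose X *v b)" for X :: "real^'d option^'d option" and a b
    by (metis dot_lmul_matrix transpose_matrix_vector transpose_transpose)
  \<comment> \<open>If y = X h on a spanning block, the edge equations at an adjacent vertex say
    that its y + X^T h is orthogonal to that block, hence zero.\<close>
  have propagate: "y w = - (transpose X) *v h w"
    if "i \<in> {2..k - 1}" "\<And>u. u \<in> A i \<Longrightarrow> y u = X *v h u" "\<And>u. u \<in> A i \<Longrightarrow> (u, w) \<in> E" for i :: nat and X w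
  proof -
    have "h u \<bullet> (y w + transpose X *v h w) = 0" if "u \<in> A i" for u
      using edge[of u w] that \<open>\<And>u. u \<in> A i \<Longrightarrow> y u = X *v h u\<close> \<open>\<And>u. u \<in> A i \<Longrightarrow> (u, w) \<in> E\<close>
      by (simp add: inner_add_right trans[symmetric] inner_commute)
    then have "y w + transpose X *v h w = 0" using separates[OF that(1)] by blast
    then show ?thesis by (simp add: eq_neg_iff_add_eq_0 uminus_matrix_vector_mult)
  qed
  have edge_Suc: "(u, w) \<in> E" "(w, u) \<in> E" if "u \<in> A i" "w \<in> A (Suc i)" for u w and i :: nat
    using that by (auto simp: E_def)
  \<comment> \<open>This is where \<open>k \<ge> 4\<close> enters: blocks 2 and 3 are adjacent and
    both inner, hence both affinely spanning.\<close>
  have i23: "2 \<in> {2..k - 1}" "3 \<in> {2..k - 1}" using k_ge_4 by auto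
  obtain U where U: "U \<subseteq> A 2" "card U = CARD('d) + 1"
    using obtain_subset_with_card_n[OF big[OF i23(1)]] by metis
  have "U \<subseteq> V" using U block_subset_V by blast
  \<comment> \<open>A matrix can be prescribed on d + 1 points of block 2 only. Block 3 is then
    forced, and since it spans in turn, it forces the remaining points of block 2.\<close>
  then obtain S where S: "\<And>u. u \<in> U \<Longrightarrow> S *v h u = y u"
    using affinely_general_interpolate[OF general _ U(2), of y] unfolding h_def by metis
  have y3: "y w = - (transpose S *v h w)" if "w \<in> A 3" for w
  proof -
    have "h u \<bullet> (y w + transpose S *v h w) = 0" if "u \<in> U" for u
      using edge[OF edge_Suc(1)[of u 2 w]] U(1) that \<open>w \<in> A 3\<close> S[OF that]
      by (auto simp: inner_add_right trans[symmetric] inner_commute numeral_3_eq_3 numeral_2_eq_2)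
    then have "y w + transpose S *v h w = 0"
      using affinely_general_separates[OF general \<open>U \<subseteq> V\<close>] U(2) unfolding h_def by auto
    then show ?thesis by (simp add: eq_neg_iff_add_eq_0)
  qed
  have y2: "y u = S *v h u" if "u \<in> A 2" for u
  proof -
    have "h w \<bullet> (y u - S *v h u) = 0" if "w \<in> A 3" for w
      using edge[OF edge_Suc(1)[of u 2 w]] that \<open>u \<in> A 2\<close> y3[OF that] trans[of S "h u" "h w"]
      by (auto simp: inner_diff_right inner_commute numeral_3_eq_3 numeral_2_eq_2)
    then have "y u - S *v h u = 0" using separates[OF i23(2)] by blast
    then show ?thesis by simp
  qed
  define X where "X = (\<lambda>i :: nat. if even i then S else - transpose S)"
  have tX: "- transpose (X i) = X (Suc i)" for i :: nat
    by (simp add: X_def) (simp add: transpose_def vec_eq_iff)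
  have ge2: "\<forall>u\<in>A i. y u = X i *v h u" if "i \<ge> 2" for i
    using that
  proof (induction i rule: dec_induct)
    case base then show ?case using y2 by (simp add: X_def)
  next
    case (step i)
    show ?case
    proof
      fix w assume w: "w \<in> A (Suc i)"
      then have "i \<in> {2..k - 1}" using step(1) block_eq_empty_iff[of "Suc i"] by auto
      from propagate[OF this, of "X i" w] show "y w = X (Suc i) *v h w"
        using step.IH w edge_Suc by (auto simp: tX)
    qed
  qed
  have y1: "y w = X 1 *v h w" if "w \<in> A 1" for w
    using propagate[OF i23(1), of S w] y2 edge_Suc[OF that] by (auto simp: X_def numeral_2_eq_2)
  have all: "y u = X (block u) *v h u" if "u \<in> V" for u
  proof -
    from that obtain i where i: "i \<in> {1..k}" "u \<in> A i" unfolding V_eq by blast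
    show ?thesis
    proof (cases "i = 1")
      case True then show ?thesis using y1 i(2) by (simp add: block_eq)
    next
      case False then show ?thesis using ge2[of i] i by (simp add: block_eq)
    qed
  qed
  \<comment> \<open>The identity \<open>diag\<close> holds for every velocity. Both sides of the
    bipartition give the same equation, as S and its transpose have the same quadratic form.\<close>
  have quad: "h u \<bullet> (S *v h u) = 0" if "u \<in> V" for u
    using diag[of u] all[OF that] trans[of S "h u" "h u"]
    by (auto simp: X_def inner_commute uminus_matrix_vector_mult split: if_splits)
  have "S + transpose S = 0"
  proof -
    have "(S + transpose S) $ i $ j = (S + transpose S) $ j $ i" for i j
      by (simp add: transpose_def)
    moreover have "h u \<bullet> ((S + transpose S) *v h u) = 0" if "u \<in> V" for u
      using quad[OF that] trans[of S "h u" "h u"]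
      by (simp add: matrix_vector_mult_add_rdistrib inner_add_right inner_commute)
    ultimately show ?thesis using q unfolding well_placed_def no_quadric_def h_def by blast
  qed
  \<comment> \<open>For skew S the two alternating values of \<open>X\<close> coincide, so one
    matrix gives the velocities on both sides, and the edge form vanishes for all pairs of
    vertices.\<close>
  then have skew: "- transpose S = S" by (simp add: eq_neg_iff_add_eq_0 neg_eq_iff_add_eq_0 add.commute)
  then have "X i = S" for i by (simp add: X_def)
  then have yS: "y u = S *v h u" if "u \<in> V" for u using all[OF that] by simp
  show "\<forall>u\<in>V. \<forall>w\<in>V. (q u - q w) \<bullet> (v u - v w) = 0"
  proof (intro ballI)
    fix u w assume "u \<in> V" "w \<in> V"
    then have "edge_form q v u w = h w \<bullet> (S *v h u) + h u \<bullet> (S *v h w)"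
      using yS by (simp add: edge_form_def h_def y_def)
    also have "h u \<bullet> (S *v h w) = - (h w \<bullet> (S *v h u))"
      using trans[of S "h u" "h w"] arg_cong[OF skew, of "\<lambda>X. h u \<bullet> (X *v h w)"]
      by (simp add: uminus_matrix_vector_mult inner_commute)
    finally show "(q u - q w) \<bullet> (v u - v w) = 0" by (simp add: edge_form)
  qed
qed

text \<open>The numbers \<open>\<alpha> x * \<beta> z\<close> form a stress on the edges at the
  block \<open>A (Suc i)\<close>. Summed against the edge forms they give 0, because in each half of
  \<open>edge_form\<close> one of the two dependencies can be factored out. All forms but the one of
  the pair \<open>u\<close>, \<open>w\<close> vanish by assumption, and that one has coefficient
  1.\<close>

lemma redundant_edge_form:
  fixes q :: "('v, 'd::finite) realization"
  assumes q: "well_placed V q" and flex: "\<And>x y. (x, y) \<in> E - {(u, w), (w, u)} \<Longrightarrow> edge_form q v x y = 0"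
    and u: "u \<in> A (Suc i)" and w: "w \<in> A i \<union> A (Suc (Suc i))"
    and "card (A (Suc i)) \<ge> CARD('d) + 2" "card (A i \<union> A (Suc (Suc i))) \<ge> CARD('d) + 2"
  shows "edge_form q v u w = 0"
proof -
  let ?W = "A i \<union> A (Suc (Suc i))" and ?y = "\<lambda>u. velocity_hat (q u) (v u)"
  have general: "affinely_general V q" using q by (simp add: well_placed_def)
  obtain \<alpha> where \<alpha>: "\<alpha> u = 1" "(\<Sum>x\<in>A (Suc i). \<alpha> x *\<^sub>R hat (q x)) = 0"
    using affine_dependency[OF general block_subset_V finite_block assms(5) u] by metis
  have W: "?W \<subseteq> V" "finite ?W" using block_subset_V finite_block by auto
  obtain \<beta> where \<beta>: "\<beta> w = 1" "(\<Sum>x\<in>?W. \<beta> x *\<^sub>R hat (q x)) = 0"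
    by (rule affine_dependency[OF general W assms(6) w])
  have other: "edge_form q v x z = 0" if "x \<in> A (Suc i)" "z \<in> ?W" "(x, z) \<noteq> (u, w)" for x z
  proof (rule flex)
    have "block x = Suc i" "block z = i \<or> block z = Suc (Suc i)" "block w = i \<or> block w = Suc (Suc i)"
      using that(1,2) w block_eq by blast+
    moreover have "x \<in> V" "z \<in> V" using that(1,2) block_subset_V by blast+
    ultimately show "(x, z) \<in> E - {(u, w), (w, u)}" using that(3) unfolding Diff_iff E_iff by auto
  qed
  have "0 = (\<Sum>x\<in>A (Suc i). \<alpha> x * ((\<Sum>z\<in>?W. \<beta> z *\<^sub>R hat (q z)) \<bullet> ?y x)) +
      (\<Sum>z\<in>?W. \<beta> z * ((\<Sum>x\<in>A (Suc i). \<alpha> x *\<^sub>R hat (q x)) \<bullet> ?y z))"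
    using \<alpha> \<beta> by simp
  also have "(\<Sum>z\<in>?W. \<beta> z * ((\<Sum>x\<in>A (Suc i). \<alpha> x *\<^sub>R hat (q x)) \<bullet> ?y z)) =
      (\<Sum>x\<in>A (Suc i). \<Sum>z\<in>?W. \<alpha> x * \<beta> z * (hat (q x) \<bullet> ?y z))"
    by (subst sum.swap) (simp add: inner_sum_left sum_distrib_left mult_ac)
  also have "(\<Sum>x\<in>A (Suc i). \<alpha> x * ((\<Sum>z\<in>?W. \<beta> z *\<^sub>R hat (q z)) \<bullet> ?y x)) =
      (\<Sum>x\<in>A (Suc i). \<Sum>z\<in>?W. \<alpha> x * \<beta> z * (hat (q z) \<bullet> ?y x))"
    by (simp add: inner_sum_left sum_distrib_left mult_ac)
  also have "(\<Sum>x\<in>A (Suc i). \<Sum>z\<in>?W. \<alpha> x * \<beta> z * (hat (q z) \<bullet> ?y x)) +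
      (\<Sum>x\<in>A (Suc i). \<Sum>z\<in>?W. \<alpha> x * \<beta> z * (hat (q x) \<bullet> ?y z)) =
      (\<Sum>x\<in>A (Suc i). \<Sum>z\<in>?W. \<alpha> x * \<beta> z * edge_form q v x z)"
    by (simp add: edge_form_def sum.distrib distrib_left)
  also have "\<dots> = (\<Sum>(x, z)\<in>A (Suc i) \<times> ?W. \<alpha> x * \<beta> z * edge_form q v x z)"
    by (rule sum.cartesian_product)
  also have "\<dots> = (\<Sum>(x, z)\<in>{(u, w)}. \<alpha> x * \<beta> z * edge_form q v x z)"
  proof (rule sum.mono_neutral_right)
    show "finite (A (Suc i) \<times> ?W)" using finite_block by simp
    show "{(u, w)} \<subseteq> A (Suc i) \<times> ?W" using u w by blast
    show "\<forall>e\<in>A (Suc i) \<times> ?W - {(u, w)}. (case e of (x, z) \<Rightarrow> \<alpha> x * \<beta> z * edge_form q v x z) = 0"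
    proof
      fix e assume e: "e \<in> A (Suc i) \<times> ?W - {(u, w)}"
      obtain x z where xz: "e = (x, z)" by (cases e)
      then have "edge_form q v x z = 0" using e by (intro other) blast+
      then show "(case e of (x, z) \<Rightarrow> \<alpha> x * \<beta> z * edge_form q v x z) = 0" by (simp add: xz)
    qed
  qed
  also have "\<dots> = edge_form q v u w" using \<alpha> \<beta> by simp
  finally show ?thesis by simp
qed

text \<open>Each edge has an end in an inner block with at least d + 2 points: the conditions on
  blocks 2 and k - 1 handle the edges at the end blocks, and of two adjacent inner blocks at most
  one has just d + 1 points. The neighbours of that block are an inner block and a nonempty one, so
  together they have at least d + 2 points as well.\<close>

lemma infinitesimally_rigid_remove_edge:
  fixes q :: "('v, 'd::finite) realization"
  assumes q: "well_placed V q" and big: "\<And>i. i \<in> {2..k - 1} \<Longrightarrow> card (A i) \<ge> CARD('d) + 1"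
    and ends: "card (A 2) \<ge> CARD('d) + 2" "card (A (k - 1)) \<ge> CARD('d) + 2"
    and pairs: "\<And>i. i \<in> {1..<k} \<Longrightarrow> \<not> (card (A i) = CARD('d) + 1 \<and> card (A (i + 1)) = CARD('d) + 1)"
    and e: "e \<in> E"
  shows "infinitesimally_rigid V (remove_edge E e) q"
  unfolding infinitesimally_rigid_def
proof (intro allI impI)
  fix v :: "('v, 'd) realization"
  assume flex: "\<forall>(u, w)\<in>remove_edge E e. (q u - q w) \<bullet> (v u - v w) = 0"
  have three: "3 \<in> {2..k - 1}" using k_ge_4 by auto
  have card_ne: "card (A i) \<ge> 1" if "i \<in> {1..k}" for i
    using that block_eq_empty_iff[of i] finite_block[of i] by (simp add: Suc_le_eq card_gt_0_iff)
  have sum2: "card (A i \<union> A (Suc (Suc i))) = card (A i) + card (A (Suc (Suc i)))" for i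
    by (rule card_Un_disjoint) (use finite_block disjoint_blocks[of _ i "Suc (Suc i)"] in auto)
  have centre: "edge_form q v u w = 0"
    if "u \<in> A (Suc i)" "w \<in> A i \<union> A (Suc (Suc i))" "e = (u, w) \<or> e = (w, u)"
      "Suc i \<in> {2..k - 1}" "card (A (Suc i)) \<ge> CARD('d) + 2" for u w i
  proof (rule redundant_edge_form[OF q _ that(1,2,5)])
    show "edge_form q v x y = 0" if "(x, y) \<in> E - {(u, w), (w, u)}" for x y
      using flex that \<open>e = (u, w) \<or> e = (w, u)\<close> by (auto simp: remove_edge_def edge_form)
    show "CARD('d) + 2 \<le> card (A i \<union> A (Suc (Suc i)))"
    proof (cases "i = 1")
      case True
      then show ?thesis
        using card_ne[of 1] big[OF three] k_ge_4 sum2[of 1] by (simp add: numeral_3_eq_3)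
    next
      case False
      then have "i \<in> {2..k - 1}" "Suc (Suc i) \<in> {1..k}" using that(4) by auto
      then show ?thesis
        using card_ne[of "Suc (Suc i)"] big[of i] sum2[of i] by linarith
    qed
  qed
  obtain i u w where uw: "u \<in> A i" "w \<in> A (Suc i)" "e = (u, w) \<or> e = (w, u)"
    using e by (auto simp: E_def)
  have ik: "i \<in> {1..k}" "Suc i \<in> {1..k}"
    using uw block_eq_empty_iff by blast+
  have "edge_form q v u w = 0"
  proof (cases "i \<ge> 2 \<and> card (A i) \<ge> CARD('d) + 2")
    case True
    then obtain j where "i = Suc j" by (cases i) auto
    then show ?thesis using centre[of u j w] uw True ik by auto
  next
    case False
    have "Suc i \<le> k - 1 \<and> card (A (Suc i)) \<ge> CARD('d) + 2"
    proof (cases "i = 1")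
      case True then show ?thesis using ends k_ge_4 by (simp add: numeral_2_eq_2)
    next
      case F: False
      then have i: "i \<ge> 2" "card (A i) < CARD('d) + 2" using False ik by auto
      then have i2: "i \<noteq> k - 1" using ends by auto
      then have "i \<in> {2..k - 1}" using i ik by auto
      then have "card (A i) = CARD('d) + 1" using i big[of i] by auto
      then have "card (A (Suc i)) \<noteq> CARD('d) + 1" using pairs[of i] ik by auto
      moreover have "Suc i \<in> {2..k - 1}" using i i2 ik by auto
      ultimately show ?thesis using big[of "Suc i"] by auto
    qed
    then show ?thesis
      using centre[of w i u] uw ik edge_form_commute[of q v u w] by auto
  qed
  then have "(q x - q y) \<bullet> (v x - v y) = 0" if "(x, y) \<in> E" for x y
  proof (cases "(x, y) \<in> remove_edge E e")
    case True then show ?thesis using flex by blast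
  next
    case False
    then have "(x, y) = (u, w) \<or> (x, y) = (w, u)" using uw(3) that by (auto simp: remove_edge_def)
    then have "edge_form q v x y = 0"
      using \<open>edge_form q v u w = 0\<close> edge_form_commute[of q v] by auto
    then show ?thesis by (simp add: edge_form)
  qed
  then show "\<forall>u\<in>V. \<forall>w\<in>V. (q u - q w) \<bullet> (v u - v w) = 0"
    using infinitesimally_rigid_chain[OF q big] unfolding infinitesimally_rigid_def by blast
qed

lemma bridge_stress_zero:
  fixes q :: "('v, 'd::finite) realization"
  assumes \<psi>: "bij_betw \<psi> (upper_pairs :: ('d option \<times> 'd option) set) V"
    and q: "well_placed V q"
    and sym: "\<And>u w. \<omega> u w = \<omega> w u" and supp: "\<And>u w. (u, w) \<notin> E \<Longrightarrow> \<omega> u w = 0"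
    and stress: "\<And>u. u \<in> V \<Longrightarrow> (\<Sum>w\<in>V. \<omega> u w *\<^sub>R (q u - q w)) = 0"
    and bridge: "card (A i) = CARD('d) + 1 \<and> card (A (Suc i)) = CARD('d) + 1
      \<or> i = 1 \<and> card (A 2) = CARD('d) + 1 \<or> i = k - 1 \<and> card (A (k - 1)) = CARD('d) + 1"
    and u: "u \<in> A i" and w: "w \<in> A (Suc i)"
  shows "\<omega> u w = 0"
proof -
  have general: "affinely_general V q" and quad: "no_quadric V q"
    using q by (simp_all add: well_placed_def)
  define h where "h = (\<lambda>u. hat (q u))"
  \<comment> \<open>These are the diagonal entries of the stress matrix. Equilibrium in homogeneous
    coordinates is \<open>hsum\<close>; the aim is to show that its right-hand side
    vanishes.\<close>
  define total where "total = (\<lambda>u. \<Sum>w\<in>V. \<omega> u w)"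
  have hsum: "(\<Sum>w\<in>V. \<omega> u w * h w $ a) = total u * h u $ a" if "u \<in> V" for u a
  proof (cases a)
    case None then show ?thesis by (simp add: total_def h_def)
  next
    case (Some j)
    have "(\<Sum>w\<in>V. \<omega> u w * (q u $ j - q w $ j)) = 0"
      using arg_cong[OF stress[OF that], of "\<lambda>x. x $ j"] by simp
    then show ?thesis
      using Some by (simp add: total_def h_def right_diff_distrib sum_subtractf sum_distrib_right)
  qed
  \<comment> \<open>The sum over u of \<open>side u * total u\<close> times hat q_u hat q_u^T is
    visibly symmetric. Rewritten through \<open>hsum\<close> it is antisymmetric, since
    \<open>\<omega>\<close> is symmetric and the sides are opposite along an edge. So it is zero,
    and independence of these rank-one matrices removes the coefficients.\<close>
  have "side u * total u = 0" if "u \<in> V" for u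
  proof (rule no_quadric_independent[OF \<psi> quad _ that])
    fix a b :: "'d option"
    have *: "(\<Sum>u\<in>V. side u * total u * (h u $ a * h u $ b)) =
        (\<Sum>u\<in>V. \<Sum>w\<in>V. side u * \<omega> u w * h w $ a * h u $ b)" for a b
    proof (rule sum.cong[OF refl])
      fix u assume "u \<in> V"
      have "side u * total u * (h u $ a * h u $ b) = side u * (total u * h u $ a) * h u $ b" by simp
      then show "side u * total u * (h u $ a * h u $ b) = (\<Sum>w\<in>V. side u * \<omega> u w * h w $ a * h u $ b)"
        unfolding hsum[OF \<open>u \<in> V\<close>, symmetric] by (simp add: sum_distrib_left sum_distrib_right mult_ac)
    qed
    have "(\<Sum>u\<in>V. side u * total u * (h u $ b * h u $ a)) =
        (\<Sum>w\<in>V. \<Sum>u\<in>V. side u * \<omega> u w * h w $ b * h u $ a)"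
      unfolding * by (rule sum.swap)
    also have "\<dots> = (\<Sum>w\<in>V. \<Sum>u\<in>V. - (side w * \<omega> w u * h u $ a * h w $ b))"
    proof (intro sum.cong refl)
      fix u w
      show "side u * \<omega> u w * h w $ b * h u $ a = - (side w * \<omega> w u * h u $ a * h w $ b)"
        using side_edge[of u w] supp[of u w] sym[of u w] by (cases "(u, w) \<in> E") auto
    qed
    also have "\<dots> = - (\<Sum>u\<in>V. side u * total u * (h u $ a * h u $ b))"
      unfolding * by (simp add: sum_negf)
    finally show "(\<Sum>u\<in>V. side u * total u * (hat (q u) $ a * hat (q u) $ b)) = 0"
      by (simp add: h_def mult_ac)
  qed
  then have "total u = 0" if "u \<in> V" for u using that side_cases[of u] by fastforce
  then have h0: "(\<Sum>w\<in>V. \<omega> u w * h w $ a) = 0" if "u \<in> V" for u a using hsum[OF that] that by simp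
  have split: "(\<Sum>w\<in>A i. \<omega> u w * h w $ a) + (\<Sum>w\<in>A (Suc (Suc i)). \<omega> u w * h w $ a) = 0"
    if "u \<in> A (Suc i)" for u i a
    using sum_V_neighbours[OF that, of "\<lambda>w. \<omega> u w * h w $ a"] h0[of u a] supp that block_subset_V
    by auto
  \<comment> \<open>The matrix of second moments of the stress between blocks i and i + 1.
    Equilibrium summed over block i + 1 says that the next such matrix is minus the transpose of
    this one; the recursion starts at the empty block 0.\<close>
  define T where "T = (\<lambda>i a b. \<Sum>u\<in>A i. \<Sum>w\<in>A (Suc i). \<omega> u w * h w $ b * h u $ a)"
  have T0: "T i a b = 0" for i a b
  proof (induction i arbitrary: a b)
    case 0
    have "A 0 = {}" using block_eq_empty_iff[of 0] by simp
    then show ?case by (simp add: T_def)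
  next
    case (Suc i)
    have "0 = (\<Sum>u\<in>A (Suc i). ((\<Sum>w\<in>A i. \<omega> u w * h w $ b) + (\<Sum>w\<in>A (Suc (Suc i)). \<omega> u w * h w $ b)) * h u $ a)"
      using split by simp
    also have "\<dots> = (\<Sum>u\<in>A (Suc i). \<Sum>w\<in>A i. \<omega> u w * h w $ b * h u $ a) + T (Suc i) a b"
      by (simp add: T_def distrib_right sum.distrib sum_distrib_right)
    also have "(\<Sum>u\<in>A (Suc i). \<Sum>w\<in>A i. \<omega> u w * h w $ b * h u $ a) = T i b a"
      unfolding T_def by (subst sum.swap) (simp add: sym mult_ac)
    finally show ?case using Suc by simp
  qed
  from bridge show ?thesis
  proof (elim disjE conjE)
    \<comment> \<open>Vanishing of \<open>T i\<close> is a relation among the points of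
      \<open>A i\<close> whose coefficients are themselves sums over \<open>A (Suc i)\<close>;
      independence of the two blocks is applied in turn.\<close>
    assume c: "card (A i) = CARD('d) + 1" "card (A (Suc i)) = CARD('d) + 1"
    have "(\<Sum>w\<in>A (Suc i). \<omega> u w * h w $ b) = 0" for b
    proof (rule affinely_general_independent[OF general block_subset_V c(1) _ u])
      show "(\<Sum>u\<in>A i. (\<Sum>w\<in>A (Suc i). \<omega> u w * h w $ b) * hat (q u) $ a) = 0" for a
        using T0[of i a b] by (simp add: T_def h_def sum_distrib_right)
    qed
    then show ?thesis
      using affinely_general_independent[OF general block_subset_V c(2) _ w, of "\<omega> u"]
      by (simp add: h_def)
  next
    \<comment> \<open>An end block has a single neighbouring block, so equilibrium at one vertex is
      already a relation among d + 1 independent points.\<close>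
    assume i: "i = 1" "card (A 2) = CARD('d) + 1"
    have "(\<Sum>w\<in>A 2. \<omega> u w * h w $ a) = 0" for a
      using split[of u 0 a] u i block_eq_empty_iff[of 0] by (simp add: numeral_2_eq_2)
    then show ?thesis
      using affinely_general_independent[OF general block_subset_V i(2), of "\<omega> u" w] w i
      by (simp add: h_def numeral_2_eq_2)
  next
    assume i: "i = k - 1" "card (A (k - 1)) = CARD('d) + 1"
    have "A (Suc (Suc (k - 1))) = {}" using block_eq_empty_iff[of "Suc (Suc (k - 1))"] by auto
    then have "(\<Sum>u\<in>A (k - 1). \<omega> w u * h u $ a) = 0" for a
      using split[of w "k - 1" a] w i by simp
    then have "\<omega> w u = 0"
      using affinely_general_independent[OF general block_subset_V i(2), of "\<omega> w" u] u i
      by (simp add: h_def)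
    then show ?thesis using sym by simp
  qed
qed

end

section \<open>From infinitesimal to local rigidity\<close>

lemma card_placed_vertices:
  assumes "bij_betw \<psi> (upper_pairs :: ('d::finite option \<times> 'd option) set) V"
  shows "card V = (CARD('d) + 2) choose 2"
  using bij_betw_same_card[OF assms] card_upper_pairs[where 'o="'d option"]
  by (simp add: card_UNIV_option)

text \<open>Equal distances give equal Gram matrices of the difference vectors. The map from
  \<open>a u\<close> to \<open>b u\<close> is extended linearly from a basis among the
  \<open>a u\<close>; equality of inner products shows that the extension is orthogonal and has the
  right values at the remaining vertices too.\<close>

lemma congruent_imp_euclidean_motion:
  fixes p q :: "('v, 'd::finite) realization"
  assumes p: "affinely_general V p" and card: "card V \<ge> CARD('d) + 1"
    and dist: "\<And>u w. u \<in> V \<Longrightarrow> w \<in> V \<Longrightarrow> norm (p u - p w) = norm (q u - q w)"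
  obtains T where "euclidean_motion T" "\<And>u. u \<in> V \<Longrightarrow> q u = T (p u)"
proof -
  from card obtain u0 where u0: "u0 \<in> V" by (cases "V = {}") auto
  define a where "a = (\<lambda>u. p u - p u0)"
  define b where "b = (\<lambda>u. q u - q u0)"
  have ab: "a u \<bullet> a w = b u \<bullet> b w" if "u \<in> V" "w \<in> V" for u w
  proof -
    have polar: "x \<bullet> y = ((norm x)\<^sup>2 + (norm y)\<^sup>2 - (norm (x - y))\<^sup>2) / 2" for x y :: "real^'d"
      by (simp add: power2_norm_eq_inner inner_diff_left inner_diff_right inner_commute)
    have "a u - a w = p u - p w" "b u - b w = q u - q w" by (simp_all add: a_def b_def)
    then show ?thesis
      using dist[OF that] dist[OF that(1) u0] dist[OF that(2) u0]
      by (simp add: polar[of "a u"] polar[of "b u"]) (simp add: a_def b_def)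
  qed
  obtain B where B: "B \<subseteq> a ` V" "independent B" "a ` V \<subseteq> span B"
    using maximal_independent_subset[of "a ` V"] by blast
  have "span B = UNIV"
  proof (rule ccontr)
    assume "span B \<noteq> UNIV"
    then obtain x where x: "x \<noteq> 0" "\<And>y. y \<in> span B \<Longrightarrow> x \<bullet> y = 0"
      using span_not_univ_subset_hyperplane[of B] by blast
    define y :: "real^'d option" where
      "y = (\<chi> i. case i of None \<Rightarrow> - (x \<bullet> p u0) | Some j \<Rightarrow> x $ j)"
    have "hat (p u) \<bullet> y = x \<bullet> a u" for u
      by (simp add: y_def inner_vec_def sum_option a_def sum_subtractf right_diff_distrib mult.commute)
    then have "hat (p u) \<bullet> y = 0" if "u \<in> V" for u using x(2)[of "a u"] B(3) that by auto
    then have "y = 0" using affinely_general_separates[OF p subset_refl card] by blast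
    then have "x $ j = 0" for j unfolding y_def vec_eq_iff by (metis option.simps(5) vec_lambda_beta zero_index)
    then show False using x(1) by (simp add: vec_eq_iff)
  qed
  define b' where "b' = (\<lambda>x. b (inv_into V a x))"
  have b': "\<exists>u\<in>V. x = a u \<and> b' x = b u" if "x \<in> B" for x
    using B(1) that unfolding b'_def by (metis f_inv_into_f inv_into_into subsetD)
  obtain f where f: "linear f" "\<And>x. x \<in> B \<Longrightarrow> f x = b' x"
    using linear_independent_extend[OF B(2), of b'] by blast
  have fb: "f z \<bullet> b u = z \<bullet> a u" if "u \<in> V" for z u
  proof -
    have "z \<in> span B" using \<open>span B = UNIV\<close> by simp
    then show ?thesis
    proof (induction rule: span_induct_alt)
      case base then show ?case using linear_0[OF f(1)] by simp
    next
      case (step c x y)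
      then show ?case using b'[of x] f ab that
        by (auto simp: linear_add linear_cmul inner_add_left)
    qed
  qed
  have ff: "f z \<bullet> f z' = z \<bullet> z'" for z z'
  proof -
    have "z' \<in> span B" using \<open>span B = UNIV\<close> by simp
    then show ?thesis
    proof (induction rule: span_induct_alt)
      case base then show ?case using linear_0[OF f(1)] by simp
    next
      case (step c x y)
      then show ?case using b'[of x] f fb
        by (auto simp: linear_add linear_cmul inner_add_right)
    qed
  qed
  have fa: "f (a u) = b u" if "u \<in> V" for u
  proof -
    have "(f (a u) - b u) \<bullet> (f (a u) - b u) = 0"
      using ff[of "a u" "a u"] fb[OF that, of "a u"] ab[OF that that]
      by (simp add: inner_diff_left inner_diff_right inner_commute)
    then show ?thesis by simp
  qed
  show ?thesis
  proof
    have "orthogonal_transformation f" using f(1) ff by (simp add: orthogonal_transformation_def)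
    then show "euclidean_motion (\<lambda>x. f x + (q u0 - f (p u0)))"
      unfolding euclidean_motion_def by blast
    show "q u = f (p u) + (q u0 - f (p u0))" if "u \<in> V" for u
      using fa[OF that] linear_diff[OF f(1), of "p u" "p u0"] by (simp add: a_def b_def algebra_simps)
  qed
qed

lemma edge_map_eq_iff:
  "edge_map F p = edge_map F q \<longleftrightarrow> (\<forall>(u, w)\<in>F. norm (p u - p w) = norm (q u - q w))"
proof
  assume *: "edge_map F p = edge_map F q"
  show "\<forall>(u, w)\<in>F. norm (p u - p w) = norm (q u - q w)"
  proof clarify
    fix u w assume "(u, w) \<in> F"
    then have "(norm (p u - p w))\<^sup>2 = (norm (q u - q w))\<^sup>2"
      using fun_cong[OF *, of "(u, w)"] by (simp add: edge_map_def)
    then show "norm (p u - p w) = norm (q u - q w)" by simp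
  qed
next
  assume "\<forall>(u, w)\<in>F. norm (p u - p w) = norm (q u - q w)"
  then show "edge_map F p = edge_map F q"
    by (auto simp: edge_map_def fun_eq_iff restrict_def)
qed

text \<open>
  Infinitesimal rigidity is only needed along the flexing: it forces the derivatives of all
  pairwise distances to vanish, so the set of times congruent to the start is open as well as closed.
\<close>

lemma infinitesimally_rigid_imp_locally_rigid:
  fixes p :: "('v, 'd::finite) realization"
  assumes \<psi>: "bij_betw \<psi> (upper_pairs :: ('d option \<times> 'd option) set) V"
    and F: "F \<subseteq> V \<times> V"
    and rigid: "\<And>q :: ('v, 'd) realization. well_placed V q \<Longrightarrow> infinitesimally_rigid V F q"
    and p: "well_placed V p"
  shows "locally_rigid V F p"
  unfolding locally_rigid_def
proof (intro allI impI)
  fix I :: "real set" and q :: "real \<Rightarrow> ('v, 'd) realization"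
  assume flex: "flexing V F p I q"
  then obtain t0 where I: "is_interval I" and t0: "t0 \<in> I" "\<And>v. v \<in> V \<Longrightarrow> q t0 v = p v"
    and diff: "\<And>v. v \<in> V \<Longrightarrow> (\<lambda>t. q t v) differentiable_on I"
    and edges: "\<And>t. t \<in> I \<Longrightarrow> edge_map F (q t) = edge_map F p"
    unfolding flexing_def by blast
  have conn: "connected I" using I is_interval_connected by blast
  have general: "affinely_general V p" using p by (simp add: well_placed_def)
  have card: "card V \<ge> CARD('d) + 1"
    using card_placed_vertices[OF \<psi>] by (simp add: choose_two)
  define D where "D = {t \<in> I. \<forall>u\<in>V. \<forall>w\<in>V. norm (p u - p w) = norm (q t u - q t w)}"
  have motion: "\<exists>T. euclidean_motion T \<and> (\<forall>v\<in>V. q t v = T (p v))" if "t \<in> D" for t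
  proof -
    from that have "\<And>u w. u \<in> V \<Longrightarrow> w \<in> V \<Longrightarrow> norm (p u - p w) = norm (q t u - q t w)"
      by (simp add: D_def)
    from congruent_imp_euclidean_motion[OF general card this] show ?thesis by metis
  qed
  have cont: "continuous_on I (\<lambda>t. q t v)" if "v \<in> V" for v
    using diff[OF that] by (rule differentiable_imp_continuous_on)
  have "D = I"
  \<comment> \<open>Derivatives within a one-point interval are not unique; there \<open>t0\<close>
    is the only time.\<close>
  proof (cases "\<exists>x. I = {x}")
    case True
    then show ?thesis using t0 by (auto simp: D_def)
  next
    case False
    have lim: "at t within I \<noteq> bot" if "t \<in> I" for t
      using connected_imp_perfect[OF conn that] False by (simp add: trivial_limit_within)
    have deriv0: "((\<lambda>t. (norm (q t u - q t w))\<^sup>2) has_derivative (\<lambda>h. 0)) (at t within I)"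
      if "t \<in> I" "well_placed V (q t)" "u \<in> V" "w \<in> V" for t u w
    proof -
      have "\<exists>v'. ((\<lambda>t. q t v) has_vector_derivative v') (at t within I)" if "v \<in> V" for v
        using diff[OF that] \<open>t \<in> I\<close> unfolding differentiable_on_def
        by (meson vector_derivative_works)
      then obtain v where v: "\<And>u. u \<in> V \<Longrightarrow> ((\<lambda>t. q t u) has_vector_derivative v u) (at t within I)"
        by metis
      have d: "((\<lambda>t. (norm (q t u - q t w))\<^sup>2) has_vector_derivative
          2 * ((q t u - q t w) \<bullet> (v u - v w))) (at t within I)" if "u \<in> V" "w \<in> V" for u w
      proof -
        have "((\<lambda>t. q t u - q t w) has_derivative (\<lambda>h. h *\<^sub>R (v u - v w))) (at t within I)"
          using has_vector_derivative_diff[OF v[OF that(1)] v[OF that(2)]]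
          by (simp add: has_vector_derivative_def)
        from has_derivative_inner[OF this this] show ?thesis
          by (simp add: power2_norm_eq_inner has_vector_derivative_def inner_commute algebra_simps)
      qed
      have "(q t u - q t w) \<bullet> (v u - v w) = 0" if "(u, w) \<in> F" for u w
      proof -
        have "u \<in> V" "w \<in> V" using F that by auto
        have "norm (q s u - q s w) = norm (p u - p w)" if "s \<in> I" for s
          using edges[OF that] \<open>(u, w) \<in> F\<close> unfolding edge_map_eq_iff by auto
        then have "((\<lambda>t. (norm (q t u - q t w))\<^sup>2) has_vector_derivative 0) (at t within I)"
          using has_vector_derivative_const[of "(norm (p u - p w))\<^sup>2" "at t within I"] \<open>t \<in> I\<close>
          by (subst has_vector_derivative_cong_ev[where g="\<lambda>_. (norm (p u - p w))\<^sup>2"]) auto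
        then have "2 * ((q t u - q t w) \<bullet> (v u - v w)) = 0"
          using d[OF \<open>u \<in> V\<close> \<open>w \<in> V\<close>] lim[OF \<open>t \<in> I\<close>] vector_derivative_unique_within by blast
        then show ?thesis by simp
      qed
      then have "(q t u - q t w) \<bullet> (v u - v w) = 0"
        using rigid[OF that(2)] that(3,4) unfolding infinitesimally_rigid_def by blast
      then show ?thesis using d[OF that(3,4)] by (simp add: has_vector_derivative_def)
    qed
    \<comment> \<open>At a time in \<open>D\<close> the realization is a moved copy of
      \<open>p\<close>, hence well placed, and it stays so at nearby times; there all squared
      distances have derivative zero.\<close>
    have open_D: "openin (top_of_set I) D"
      unfolding openin_contains_ball
    proof (intro conjI ballI)
      show "D \<subseteq> I" by (auto simp: D_def)
      fix t assume t: "t \<in> D"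
      then have "t \<in> I" by (simp add: D_def)
      obtain T where "euclidean_motion T" "\<forall>v\<in>V. q t v = T (p v)" using motion[OF t] by blast
      then have wt: "well_placed V (q t)" using well_placed_motion[OF p, of T "q t"] by blast
      have "\<forall>\<^sub>F s in at t within I. well_placed V (q s)"
        by (rule eventually_well_placed[OF \<psi> _ wt])
           (use cont \<open>t \<in> I\<close> in \<open>simp add: continuous_on_def\<close>)
      then obtain e where e: "e > 0" "\<And>s. s \<in> I \<Longrightarrow> s \<noteq> t \<Longrightarrow> dist s t < e \<Longrightarrow> well_placed V (q s)"
        unfolding eventually_at by blast
      let ?J = "ball t e \<inter> I"
      have "convex ?J" using I by (intro convex_Int) (auto simp: is_interval_convex_1)
      have "?J \<subseteq> D"
      proof
        fix s assume s: "s \<in> ?J"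
        have "norm (p u - p w) = norm (q s u - q s w)" if "u \<in> V" "w \<in> V" for u w
        proof -
          have "\<exists>c. \<forall>x\<in>?J. (norm (q x u - q x w))\<^sup>2 = c"
          proof (rule has_derivative_zero_constant[OF \<open>convex ?J\<close>])
            fix x assume "x \<in> ?J"
            then have "well_placed V (q x)" using e(2)[of x] wt by (auto simp: dist_commute)
            then show "((\<lambda>t. (norm (q t u - q t w))\<^sup>2) has_derivative (\<lambda>h. 0)) (at x within ?J)"
              using deriv0[of x u w] that \<open>x \<in> ?J\<close> by (auto intro: has_derivative_subset)
          qed
          then have "(norm (q s u - q s w))\<^sup>2 = (norm (q t u - q t w))\<^sup>2"
            using s \<open>t \<in> I\<close> e(1) by (metis IntI centre_in_ball)
          then have "norm (q s u - q s w) = norm (q t u - q t w)" by simp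
          then show ?thesis using t that by (simp add: D_def)
        qed
        then show "s \<in> D" using s by (simp add: D_def)
      qed
      then show "\<exists>e>0. ball t e \<inter> I \<subseteq> D" using e(1) by blast
    qed
    define C where "C = (\<lambda>(u, w). {t \<in> I. norm (q t u - q t w) = norm (p u - p w)})"
    have "V \<noteq> {}" using card by auto
    then have "D = \<Inter> (C ` (V \<times> V))" by (auto simp: D_def C_def)
    moreover have "closedin (top_of_set I) (C (u, w))" if "u \<in> V" "w \<in> V" for u w
      unfolding C_def prod.case
      by (rule continuous_closedin_preimage_constant) (intro continuous_intros cont that)
    ultimately have "closedin (top_of_set I) D"
      using \<open>V \<noteq> {}\<close> by (auto intro!: closedin_Inter)
    moreover have "t0 \<in> D" using t0 by (simp add: D_def)
    ultimately show ?thesis using conn open_D unfolding connected_clopen by blast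
  qed
  then show "trivial_flexing V p I q" unfolding trivial_flexing_def using motion by blast
qed

section \<open>Flexes from a stress-free edge\<close>

lemma span_image_finite_sum:
  fixes h :: "'j \<Rightarrow> 'a::real_vector"
  assumes "finite J" "x \<in> span (h ` J)"
  obtains c where "x = (\<Sum>j\<in>J. c j *\<^sub>R h j)"
proof -
  have "\<exists>c. x = (\<Sum>j\<in>J. c j *\<^sub>R h j)"
    using assms(2)
  proof (induction rule: span_induct_alt)
    case base
    show ?case by (rule exI[of _ "\<lambda>_. 0"]) simp
  next
    case (step a y z)
    then obtain c j where c: "z = (\<Sum>j\<in>J. c j *\<^sub>R h j)" and j: "j \<in> J" "y = h j" by blast
    have "a *\<^sub>R y = (\<Sum>i\<in>J. (if i = j then a else 0) *\<^sub>R h i)"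
      using j assms(1) by (simp add: if_distribR sum.delta if_distrib[of "\<lambda>x. x *\<^sub>R _"] cong: if_cong)
    then have "a *\<^sub>R y + z = (\<Sum>i\<in>J. ((if i = j then a else 0) + c i) *\<^sub>R h i)"
      by (simp add: c scaleR_left_distrib sum.distrib)
    then show ?case by (rule exI[of _ "\<lambda>i. (if i = j then a else 0) + c i"])
  qed
  then show ?thesis using that by blast
qed

text \<open>
  A point of maximal rank is regular for the family \<open>f\<close>; as the gradient of \<open>f e\<close> is independent of
  the others, one can move along the fibre of the others so that \<open>f e\<close> has unit speed.
\<close>

lemma constant_rank_path:
  fixes f :: "'j \<Rightarrow> 'a::euclidean_space \<Rightarrow> real" and r :: "'j \<Rightarrow> 'a \<Rightarrow> 'a"
  assumes Om: "open Om" "p \<in> Om"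
    and deriv: "\<And>j q. j \<in> insert e F \<Longrightarrow> (f j has_derivative (\<lambda>h. r j q \<bullet> h)) (at q)"
    and cont: "\<And>j. j \<in> insert e F \<Longrightarrow> continuous_on UNIV (r j)"
    and maximal: "\<And>q. q \<in> Om \<Longrightarrow> dim ((\<lambda>j. r j q) ` F) \<le> dim ((\<lambda>j. r j p) ` F)"
    and indep: "r e p \<notin> span ((\<lambda>j. r j p) ` F)"
  shows "\<exists>U \<delta> \<gamma>. open U \<and> p \<in> U \<and> (\<forall>q\<in>U. dim ((\<lambda>j. r j q) ` F) = dim ((\<lambda>j. r j p) ` F)) \<and>
    \<delta> > 0 \<and> \<gamma> 0 = p \<and>
    (\<forall>t\<in>ball 0 \<delta>. \<gamma> differentiable (at (t :: real)) \<and> (\<forall>j\<in>F. f j (\<gamma> t) = f j p) \<and>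
       f e (\<gamma> t) = f e p + t)"
proof -
  define R where "R = (\<lambda>q. (\<lambda>j. r j q) ` F)"
  obtain B0 where B0: "B0 \<subseteq> R p" "independent B0" "R p \<subseteq> span B0" "card B0 = dim (R p)"
    using basis_exists[of "R p"] by metis
  define b1 where "b1 = r e p"
  have b1: "b1 \<notin> span B0"
    using indep span_mono[OF B0(1)] unfolding b1_def R_def by blast
  then have b1_notin: "b1 \<notin> B0" using span_base by blast
  have ind1: "independent (insert b1 B0)" using b1 B0(2) by (simp add: independent_insert)
  define B where "B = extend_basis (insert b1 B0)"
  have B: "insert b1 B0 \<subseteq> B" "independent B" "span B = UNIV"
    unfolding B_def using ind1 extend_basis_superset independent_extend_basis span_extend_basis by auto
  have finB: "finite B" using B(2) independent_imp_finite by blast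
  have coeff: "c b = 0" if "(\<Sum>b\<in>B. c b *\<^sub>R b) = 0" "b \<in> B" for c b
    using B(2) finB that independentD by blast
  define lab where "lab = (\<lambda>b. if b = b1 then e else (SOME j. j \<in> F \<and> r j p = b))"
  have lab: "lab b \<in> F \<and> r (lab b) p = b" if "b \<in> B0" for b
  proof -
    have "\<exists>j. j \<in> F \<and> r j p = b" using B0(1) that by (auto simp: R_def)
    from someI_ex[OF this] show ?thesis using that b1_notin by (auto simp: lab_def)
  qed
  have lab1: "lab b1 = e" by (simp add: lab_def)
  have lab_in: "lab b \<in> insert e F" if "b \<in> insert b1 B0" for b using that lab lab1 by auto
  have lab_p: "r (lab b) p = b" if "b \<in> insert b1 B0" for b using that lab lab1 b1_def by auto
  \<comment> \<open>New coordinates around \<open>p\<close>: members of the family for the selected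
    gradients and for \<open>e\<close>, linear functions for the rest of the basis \<open>B\<close>.
    At \<open>p\<close> the gradient of \<open>\<phi> b\<close> is \<open>b\<close> itself, which
    makes the derivative of \<open>\<Psi>\<close> injective there.\<close>
  define \<phi> where "\<phi> = (\<lambda>b q. if b \<in> insert b1 B0 then f (lab b) q - f (lab b) p else b \<bullet> (q - p))"
  define G where "G = (\<lambda>b q. if b \<in> insert b1 B0 then r (lab b) q else b)"
  have \<phi>_deriv: "(\<phi> b has_derivative (\<lambda>h. G b q \<bullet> h)) (at q)" for b q
  proof (cases "b \<in> insert b1 B0")
    case True
    then have eq: "\<phi> b = (\<lambda>q. f (lab b) q - f (lab b) p)" "G b q = r (lab b) q" by (auto simp: \<phi>_def G_def)
    show ?thesis unfolding eq
      using has_derivative_diff[OF deriv[OF lab_in[OF True]] has_derivative_const] by simp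
  next
    case False
    then have eq: "\<phi> b = (\<lambda>q. b \<bullet> (q - p))" "G b q = b" by (auto simp: \<phi>_def G_def)
    show ?thesis unfolding eq by (auto intro!: derivative_eq_intros)
  qed
  have G_cont: "continuous_on S (G b)" for b S
  proof (cases "b \<in> insert b1 B0")
    case True
    then have "G b = r (lab b)" by (auto simp: G_def)
    then show ?thesis using cont[OF lab_in[OF True]] continuous_on_subset by auto
  next
    case False
    then have "G b = (\<lambda>_. b)" by (auto simp: G_def)
    then show ?thesis by simp
  qed
  define \<Psi> where "\<Psi> = (\<lambda>q. \<Sum>b\<in>B. \<phi> b q *\<^sub>R b)"
  define \<Psi>' where "\<Psi>' = (\<lambda>q. \<Sum>b\<in>B. blinfun_scaleR_left b o\<^sub>L blinfun_inner_right (G b q))"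
  have \<Psi>': "blinfun_apply (\<Psi>' q) v = (\<Sum>b\<in>B. (G b q \<bullet> v) *\<^sub>R b)" for q v
    by (simp add: \<Psi>'_def blinfun.sum_left)
  have derf: "(\<Psi> has_derivative blinfun_apply (\<Psi>' q)) (at q)" for q
  proof -
    have "(\<Psi> has_derivative (\<lambda>v. \<Sum>b\<in>B. (G b q \<bullet> v) *\<^sub>R b)) (at q)"
      unfolding \<Psi>_def
      by (intro has_derivative_sum has_derivative_scaleR_left \<phi>_deriv)
    then show ?thesis by (simp add: \<Psi>'[abs_def])
  qed
  have contf: "continuous_on Om \<Psi>'"
  proof (rule continuous_on_blinfun_componentwise)
    show "continuous_on Om (\<lambda>q. blinfun_apply (\<Psi>' q) i)" for i
      unfolding \<Psi>' by (intro continuous_intros G_cont)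
  qed
  have "\<phi> b p = 0" for b by (auto simp: \<phi>_def)
  then have \<Psi>p: "\<Psi> p = 0" by (simp add: \<Psi>_def)
  have "inj (blinfun_apply (\<Psi>' p))"
  proof (subst linear_injective_0)
    show "linear (blinfun_apply (\<Psi>' p))"
      by (simp add: blinfun.bounded_linear_right bounded_linear.linear)
    show "\<forall>v. blinfun_apply (\<Psi>' p) v = 0 \<longrightarrow> v = 0"
    proof (intro allI impI)
      fix v assume v: "blinfun_apply (\<Psi>' p) v = 0"
      have "G b p = b" for b using lab_p by (auto simp: G_def)
      then have "(\<Sum>b\<in>B. (b \<bullet> v) *\<^sub>R b) = 0" using v \<Psi>' by simp
      then have b0: "b \<bullet> v = 0" if "b \<in> B" for b using coeff[of "\<lambda>b. b \<bullet> v"] that by blast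
      have "z \<bullet> v = 0" if "z \<in> span B" for z
        using that by (induction rule: span_induct_alt) (simp_all add: b0 inner_add_left)
      then show "v = 0" using B(3) inner_eq_zero_iff by blast
    qed
  qed
  then obtain h where h: "linear h" "h \<circ> blinfun_apply (\<Psi>' p) = id"
    using linear_injective_left_inverse[of "blinfun_apply (\<Psi>' p)"]
    by (metis blinfun.bounded_linear_right bounded_linear.linear)
  have inv: "Blinfun h o\<^sub>L \<Psi>' p = id_blinfun"
  proof (rule blinfun_eqI)
    fix v
    have "blinfun_apply (Blinfun h) = h"
      using h(1) by (simp add: bounded_linear_Blinfun_apply linear_conv_bounded_linear)
    then show "blinfun_apply (Blinfun h o\<^sub>L \<Psi>' p) v = blinfun_apply id_blinfun v"
      using fun_cong[OF h(2), of v] by simp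
  qed
  obtain U V g g' where U: "open U" "U \<subseteq> Om" "p \<in> U" and V: "open V" "\<Psi> p \<in> V"
    and hom: "homeomorphism U V \<Psi> g"
    and g': "\<And>y. y \<in> V \<Longrightarrow> (g has_derivative g' y) (at y)"
    and bij: "\<And>y. y \<in> V \<Longrightarrow> bij (blinfun_apply (\<Psi>' (g y)))"
    by (rule inverse_function_theorem[OF Om(1) derf contf Om(2) inv]) blast
  have gU: "g y \<in> U" and \<Psi>g: "\<Psi> (g y) = y" if "y \<in> V" for y
    using hom that by (auto simp: homeomorphism_def)
  have g\<Psi>: "g (\<Psi> q) = q" "\<Psi> q \<in> V" if "q \<in> U" for q
    using hom that by (auto simp: homeomorphism_def)
  \<comment> \<open>At \<open>q\<close> in \<open>U\<close> the derivative is onto, so some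
    \<open>v\<close> has the coefficients \<open>c b\<close> as its inner products with the selected
    gradients. Pairing the relation with \<open>v\<close> gives a vanishing sum of squares.\<close>
  have indep_near: "c b = 0"
    if q: "q \<in> U" and c: "(\<Sum>b\<in>B0. c b *\<^sub>R r (lab b) q) = 0" and b: "b \<in> B0" for q c b
  proof -
    define c' where "c' = (\<lambda>b. if b \<in> B0 then c b else 0)"
    have "surj (blinfun_apply (\<Psi>' q))" using bij[OF g\<Psi>(2)[OF q]] g\<Psi>(1)[OF q] by (simp add: bij_is_surj)
    then obtain v where v: "(\<Sum>b\<in>B. (G b q \<bullet> v) *\<^sub>R b) = (\<Sum>b\<in>B. c' b *\<^sub>R b)"
      unfolding \<Psi>'[symmetric] by (metis surjD)
    have "(\<Sum>b\<in>B. (G b q \<bullet> v - c' b) *\<^sub>R b) = 0"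
      using v by (simp add: scaleR_left_diff_distrib sum_subtractf)
    then have eq: "G b q \<bullet> v = c' b" if "b \<in> B" for b
      using coeff[of "\<lambda>b. G b q \<bullet> v - c' b" b] that by simp
    have "0 = (\<Sum>b\<in>B0. c b *\<^sub>R r (lab b) q) \<bullet> v" using c by simp
    also have "\<dots> = (\<Sum>b\<in>B0. c b * c b)"
      unfolding inner_sum_left
    proof (rule sum.cong)
      fix b assume b: "b \<in> B0"
      then have "r (lab b) q \<bullet> v = c b" using eq[of b] B(1) by (auto simp: G_def c'_def)
      then show "c b *\<^sub>R r (lab b) q \<bullet> v = c b * c b" by simp
    qed simp
    finally have "(\<Sum>b\<in>B0. c b * c b) = 0" by simp
    moreover have "finite B0" using finB B(1) by (meson finite_subset insert_subset)
    ultimately show ?thesis using b by (simp add: sum_nonneg_eq_0_iff)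
  qed
  define X where "X = (\<lambda>q. (\<lambda>b. r (lab b) q) ` B0)"
  have finB0: "finite B0" using finB B(1) by (meson finite_subset insert_subset)
  have X: "X q \<subseteq> R q" "independent (X q)" "card (X q) = dim (R p)" if "q \<in> U" for q
  proof -
    show "X q \<subseteq> R q" using lab by (auto simp: X_def R_def)
    have inj: "inj_on (\<lambda>b. r (lab b) q) B0"
    proof (rule inj_onI, rule ccontr)
      fix b b' assume b: "b \<in> B0" "b' \<in> B0" "r (lab b) q = r (lab b') q" "b \<noteq> b'"
      define c where "c = (\<lambda>x. if x = b then 1 else if x = b' then - 1 else 0 :: real)"
      have "(\<Sum>x\<in>B0. c x *\<^sub>R r (lab x) q) = (\<Sum>x\<in>{b, b'}. c x *\<^sub>R r (lab x) q)"
        by (rule sum.mono_neutral_right) (use b finB0 in \<open>auto simp: c_def\<close>)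
      also have "\<dots> = 0" using b by (simp add: c_def)
      finally show False using indep_near[OF that, of c b] b by (simp add: c_def)
    qed
    then show "card (X q) = dim (R p)" unfolding X_def B0(4)[symmetric] by (rule card_image)
    show "independent (X q)"
    proof (rule independent_if_scalars_zero)
      show "finite (X q)" using finB0 by (simp add: X_def)
      fix c x assume c: "(\<Sum>x\<in>X q. c x *\<^sub>R x) = 0" and "x \<in> X q"
      then obtain b where b: "b \<in> B0" "x = r (lab b) q" by (auto simp: X_def)
      have "(\<Sum>b\<in>B0. c (r (lab b) q) *\<^sub>R r (lab b) q) = 0"
        using c unfolding X_def by (simp add: sum.reindex[OF inj])
      from indep_near[OF that this b(1)] show "c x = 0" by (simp add: b)
    qed
  qed
  \<comment> \<open>Maximality at \<open>p\<close> bounds the rank above, independence of the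
    selected gradients bounds it below. The selected gradients therefore span all gradients of the
    family \<open>F\<close> throughout \<open>U\<close>.\<close>
  have dim_eq: "dim (R q) = dim (R p)" if "q \<in> U" for q
  proof (rule antisym)
    show "dim (R q) \<le> dim (R p)" using maximal U(2) that unfolding R_def by blast
    show "dim (R p) \<le> dim (R q)"
      using X[OF that] by (metis dim_eq_card_independent dim_subset)
  qed
  have span_X: "R q \<subseteq> span (X q)" if "q \<in> U" for q
    using card_ge_dim_independent[of "X q" "R q"] X[OF that] dim_eq[OF that] by simp
  have "open ((\<lambda>t :: real. t *\<^sub>R b1) -` V)"
    using V(1) by (intro open_vimage continuous_intros)
  moreover have "0 \<in> (\<lambda>t :: real. t *\<^sub>R b1) -` V" using V(2) by (simp add: \<Psi>p)
  ultimately obtain \<delta> where \<delta>: "\<delta> > 0" "ball 0 \<delta> \<subseteq> (\<lambda>t :: real. t *\<^sub>R b1) -` V"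
    unfolding open_contains_ball by blast
  \<comment> \<open>Along the inverse image of the line through \<open>b1\<close>, all new
    coordinates but the one of \<open>e\<close> stay fixed.\<close>
  define \<gamma> where "\<gamma> = (\<lambda>t. g (t *\<^sub>R b1))"
  define D where "D = (\<lambda>t. g' (t *\<^sub>R b1) b1)"
  have inV: "t *\<^sub>R b1 \<in> V" if "t \<in> ball 0 \<delta>" for t using \<delta>(2) that by blast
  have \<gamma>_deriv: "(\<gamma> has_derivative (\<lambda>h. h *\<^sub>R D t)) (at t)" if "t \<in> ball 0 \<delta>" for t
  proof -
    have "((\<lambda>t. t *\<^sub>R b1) has_derivative (\<lambda>h. h *\<^sub>R b1)) (at t)"
      by (auto intro!: derivative_eq_intros)
    from has_derivative_compose[OF this, of g "g' (t *\<^sub>R b1)"] g'[OF inV[OF that]]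
    have "(\<gamma> has_derivative (\<lambda>h. g' (t *\<^sub>R b1) (h *\<^sub>R b1))) (at t)"
      unfolding \<gamma>_def by blast
    moreover have "linear (g' (t *\<^sub>R b1))"
      using g'[OF inV[OF that]] has_derivative_linear by blast
    ultimately show ?thesis by (simp add: D_def linear_cmul)
  qed
  have \<phi>\<gamma>: "\<phi> b (\<gamma> t) = (if b = b1 then t else 0)" if "t \<in> ball 0 \<delta>" "b \<in> B" for t b
  proof -
    have "\<Psi> (\<gamma> t) = t *\<^sub>R b1" using \<Psi>g[OF inV[OF that(1)]] by (simp add: \<gamma>_def)
    also have "\<dots> = (\<Sum>b\<in>B. (if b = b1 then t else 0) *\<^sub>R b)"
      using B(1) finB by (simp add: if_distribR sum.delta if_distrib[of "\<lambda>x. x *\<^sub>R _"] cong: if_cong)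
    finally have "(\<Sum>b\<in>B. (\<phi> b (\<gamma> t) - (if b = b1 then t else 0)) *\<^sub>R b) = 0"
      unfolding \<Psi>_def by (simp add: scaleR_left_diff_distrib sum_subtractf)
    from coeff[OF this that(2)] show ?thesis by simp
  qed
  have f_lab: "f (lab b) (\<gamma> t) = f (lab b) p" if "t \<in> ball 0 \<delta>" "b \<in> B0" for t b
    using \<phi>\<gamma>[OF that(1), of b] that(2) B(1) b1_notin by (auto simp: \<phi>_def split: if_splits)
  have f_e: "f e (\<gamma> t) = f e p + t" if "t \<in> ball 0 \<delta>" for t
    using \<phi>\<gamma>[OF that, of b1] B(1) by (simp add: \<phi>_def lab1)
  have \<gamma>0: "\<gamma> 0 = p" using g\<Psi>(1)[OF U(3)] by (simp add: \<gamma>_def \<Psi>p)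
  have \<gamma>U: "\<gamma> t \<in> U" if "t \<in> ball 0 \<delta>" for t using gU[OF inV[OF that]] by (simp add: \<gamma>_def)
  have f\<gamma>_deriv: "((\<lambda>t. f j (\<gamma> t)) has_derivative (\<lambda>h. h * (r j (\<gamma> t) \<bullet> D t))) (at t)"
    if "t \<in> ball 0 \<delta>" "j \<in> F" for t j
    using has_derivative_compose[OF \<gamma>_deriv[OF that(1)], of "f j" "\<lambda>h. r j (\<gamma> t) \<bullet> h"]
      deriv[of j "\<gamma> t"] that(2) by simp
  have ortho: "r (lab b) (\<gamma> t) \<bullet> D t = 0" if "t \<in> ball 0 \<delta>" "b \<in> B0" for t b
  proof -
    have "((\<lambda>t. f (lab b) (\<gamma> t)) has_derivative (\<lambda>h. 0)) (at t)"
      using has_derivative_transform_within_open[OF has_derivative_const open_ball that(1), of "f (lab b) p"]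
        f_lab that(2) by fastforce
    from has_derivative_unique[OF this f\<gamma>_deriv[OF that(1)]] lab[OF that(2)]
    show ?thesis by (metis mult_1)
  qed
  \<comment> \<open>Members of \<open>F\<close> that were not selected are constant too: their
    gradients lie in the span of the selected ones, to which the velocity of the path is
    orthogonal.\<close>
  have f_const: "f j (\<gamma> t) = f j p" if "t \<in> ball 0 \<delta>" "j \<in> F" for t j
  proof -
    have "\<exists>c. \<forall>x\<in>ball (0 :: real) \<delta>. f j (\<gamma> x) = c"
    proof (rule has_derivative_zero_constant)
      fix s :: real assume s: "s \<in> ball 0 \<delta>"
      have "z \<bullet> D s = 0" if "z \<in> span (X (\<gamma> s))" for z
        using that by (induction rule: span_induct_alt) (auto simp: inner_add_left X_def ortho[OF s])
      moreover have "r j (\<gamma> s) \<in> span (X (\<gamma> s))"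
        using span_X[OF \<gamma>U[OF s]] that(2) by (auto simp: R_def)
      ultimately show "((\<lambda>x. f j (\<gamma> x)) has_derivative (\<lambda>h. 0)) (at s within ball 0 \<delta>)"
        using f\<gamma>_deriv[OF s that(2)] by (simp add: has_derivative_at_withinI)
    qed simp
    then show ?thesis using that(1) \<delta>(1) \<gamma>0 by (metis centre_in_ball)
  qed
  have "\<gamma> differentiable (at t)" if "t \<in> ball 0 \<delta>" for t
    using \<gamma>_deriv[OF that] unfolding differentiable_def by blast
  moreover have "\<forall>q\<in>U. dim ((\<lambda>j. r j q) ` F) = dim ((\<lambda>j. r j p) ` F)"
    using dim_eq unfolding R_def by blast
  ultimately show ?thesis using U(1,3) \<delta>(1) \<gamma>0 f_const f_e by blast
qed

text \<open>Configurations are vectors indexed by all pairs, so as to form a Euclidean space. Only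
  the coordinates in \<open>upper_pairs\<close> stand for vertices; the others are padding and keep
  their values from \<open>w0\<close>.\<close>

lemma generic_in_open:
  fixes w0 :: "real^'d::finite^('d option \<times> 'd option)"
  assumes \<psi>: "bij_betw \<psi> (upper_pairs :: ('d option \<times> 'd option) set) (V :: 'v set)"
    and "open Om" "w0 \<in> Om"
  obtains p :: "('v, 'd) realization" and w where "generic_realization V p" "w \<in> Om"
    "\<And>i. i \<in> upper_pairs \<Longrightarrow> w $ i = p (\<psi> i)"
proof -
  define n where "n = real CARD('d option \<times> 'd option)"
  have n: "n > 0" unfolding n_def of_nat_0_less_iff by (rule zero_less_card_finite)
  obtain \<epsilon> where \<epsilon>: "\<epsilon> > 0" "ball w0 \<epsilon> \<subseteq> Om"
    using assms(2,3) open_contains_ball by blast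
  have "finite V" using bij_betw_finite[OF \<psi>] by simp
  moreover have "\<epsilon> / n > 0" using \<epsilon>(1) n by simp
  ultimately obtain p :: "('v, 'd) realization" where p: "generic_realization V p"
    "\<And>v. v \<in> V \<Longrightarrow> norm (p v - w0 $ inv_into upper_pairs \<psi> v) < \<epsilon> / n"
    using generic_realization_dense[of V "\<epsilon> / n" "\<lambda>v. w0 $ inv_into upper_pairs \<psi> v"] by blast
  define w where "w = (\<chi> i. if i \<in> upper_pairs then p (\<psi> i) else w0 $ i)"
  have "norm ((w - w0) $ i) < \<epsilon> / n" for i
  proof (cases "i \<in> upper_pairs")
    case True
    then have "\<psi> i \<in> V" "inv_into upper_pairs \<psi> (\<psi> i) = i"
      using \<psi> by (auto simp: bij_betw_def)
    then show ?thesis using p(2)[of "\<psi> i"] True by (simp add: w_def)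
  next
    case False
    then show ?thesis using \<epsilon>(1) n by (simp add: w_def)
  qed
  then have "(\<Sum>i\<in>UNIV. norm ((w - w0) $ i)) < (\<Sum>i\<in>(UNIV :: ('d option \<times> 'd option) set). \<epsilon> / n)"
    by (intro sum_strict_mono) auto
  moreover have "norm (w - w0) \<le> (\<Sum>i\<in>UNIV. norm ((w - w0) $ i))"
    unfolding norm_vec_def by (rule L2_set_le_sum) simp
  moreover have "(\<Sum>i\<in>(UNIV :: ('d option \<times> 'd option) set). \<epsilon> / n) = \<epsilon>"
    unfolding sum_constant n_def[symmetric] using n by simp
  ultimately have "norm (w - w0) < \<epsilon>" by simp
  then have "w \<in> Om" using \<epsilon>(2) by (auto simp: dist_norm norm_minus_commute)
  then show ?thesis using that[of p w] p(1) by (simp add: w_def)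
qed

context chain
begin

lemma finite_E: "finite E"
  by (rule finite_subset[of _ "V \<times> V"]) (auto simp: E_iff finite_V)

text \<open>A stress-free edge has a rigidity row independent of the others. The maximal rank is
  attained at some well-placed \<open>w1\<close>, whose genericity is unknown. The rank is constant
  around it, so a generic realization nearby also has maximal rank, and the path that lengthens the
  edge is built there.\<close>

lemma bridge_imp_generic_flexible:
  fixes \<psi> :: "'d::finite option \<times> 'd option \<Rightarrow> 'v"
  assumes \<psi>: "bij_betw \<psi> upper_pairs V"
    and bridge: "card (A i) = CARD('d) + 1 \<and> card (A (Suc i)) = CARD('d) + 1
      \<or> i = 1 \<and> card (A 2) = CARD('d) + 1 \<or> i = k - 1 \<and> card (A (k - 1)) = CARD('d) + 1"
    and x: "x \<in> A i" and y: "y \<in> A (Suc i)"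
  obtains p :: "('v, 'd) realization" where "generic_realization V p"
    "\<not> locally_rigid V (remove_edge E (x, y)) p"
proof -
  define \<phi> where "\<phi> = inv_into upper_pairs \<psi>"
  define cfg :: "real^'d^('d option \<times> 'd option) \<Rightarrow> ('v, 'd) realization" where
    "cfg = (\<lambda>w v. w $ \<phi> v)"
  define f where "f = (\<lambda>(u, v) w. (norm (cfg w u - cfg w v))\<^sup>2 / 2)"
  \<comment> \<open>The row of the rigidity matrix at the edge, as gradient of half the squared
    length.\<close>
  define r where "r = (\<lambda>(u, v) w. axis (\<phi> u) (cfg w u - cfg w v) - axis (\<phi> v) (cfg w u - cfg w v))"
  define F where "F = remove_edge E (x, y)"
  define Om where "Om = {w. well_placed V (cfg w)}"
  have \<phi>: "\<psi> (\<phi> v) = v" "\<phi> v \<in> upper_pairs" if "v \<in> V" for v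
    using \<psi> that unfolding \<phi>_def
    by (simp_all add: bij_betw_inv_into_right bij_betwE[OF bij_betw_inv_into])
  have \<phi>\<psi>: "\<phi> (\<psi> i) = i" "\<psi> i \<in> V" if "i \<in> upper_pairs" for i
    using \<psi> that unfolding \<phi>_def by (auto simp: bij_betw_def)
  have \<phi>_inj: "\<phi> u = \<phi> v \<longleftrightarrow> u = v" if "u \<in> V" "v \<in> V" for u v
    using \<phi>(1) that by metis
  have FE: "F \<subseteq> E" by (auto simp: F_def remove_edge_def)
  then have finF: "finite F" using finite_E finite_subset by blast
  have xy: "(x, y) \<in> E" using x y by (auto simp: E_def)
  have deriv: "(f j has_derivative (\<lambda>h. r j w \<bullet> h)) (at w)" for j w
  proof -
    obtain u v where j: "j = (u, v)" by (cases j)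
    let ?L = "\<lambda>h :: real^'d^('d option \<times> 'd option). h $ \<phi> u - h $ \<phi> v"
    have L: "(?L has_derivative ?L) (at w)"
      by (intro has_derivative_diff bounded_linear_imp_has_derivative bounded_linear_vec_nth)
    have "((\<lambda>w. (?L w \<bullet> ?L w) * (1 / 2)) has_derivative (\<lambda>h. (?L w \<bullet> ?L h + ?L h \<bullet> ?L w) * (1 / 2))) (at w)"
      by (intro has_derivative_mult_left has_derivative_inner[OF L L])
    moreover have "f j = (\<lambda>w. (?L w \<bullet> ?L w) * (1 / 2))"
      by (simp add: j f_def cfg_def power2_norm_eq_inner)
    moreover have "r j w \<bullet> h = (?L w \<bullet> ?L h + ?L h \<bullet> ?L w) * (1 / 2)" for h
      by (simp add: j r_def cfg_def inner_diff_left inner_diff_right inner_axis inner_axis' inner_commute)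
    ultimately show ?thesis by (simp only:)
  qed
  have cont: "continuous_on UNIV (r j)" for j
  proof -
    obtain u v where j: "j = (u, v)" by (cases j)
    have ax: "continuous_on UNIV (\<lambda>w. axis l (cfg w u - cfg w v) :: real^'d^('d option \<times> 'd option))" for l
    proof (unfold axis_def, rule continuous_on_vec_lambda)
      show "continuous_on UNIV (\<lambda>w. if i = l then cfg w u - cfg w v else 0)" for i
        by (cases "i = l") (auto simp: cfg_def intro!: continuous_intros)
    qed
    have "r j = (\<lambda>w. axis (\<phi> u) (cfg w u - cfg w v) - axis (\<phi> v) (cfg w u - cfg w v))"
      by (simp add: j r_def)
    then show ?thesis by (simp only:) (intro continuous_on_diff ax)
  qed
  have "open Om"
    unfolding open_dist
  proof
    fix w assume "w \<in> Om"
    then have "\<forall>\<^sub>F w' in at w. well_placed V (cfg w')"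
      unfolding Om_def
      by (intro eventually_well_placed[OF \<psi>]) (auto simp: cfg_def intro!: tendsto_intros)
    then show "\<exists>e>0. \<forall>w'. dist w' w < e \<longrightarrow> w' \<in> Om"
      using \<open>w \<in> Om\<close> unfolding eventually_at Om_def by (metis UNIV_I mem_Collect_eq)
  qed
  obtain p0 :: "('v, 'd) realization" where p0: "generic_realization V p0"
    using generic_realization_dense[OF finite_V, of 1] by auto
  define w0 where "w0 = (\<chi> i. p0 (\<psi> i))"
  have "euclidean_motion (id :: real^'d \<Rightarrow> real^'d)"
    unfolding euclidean_motion_def
    by (intro exI[of _ id] exI[of _ 0]) (simp add: orthogonal_transformation_def linear_id)
  then have "well_placed V (cfg w0)"
    by (rule well_placed_motion[OF generic_imp_well_placed[OF \<psi> p0]])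
       (simp add: cfg_def w0_def \<phi>)
  then have "w0 \<in> Om" by (simp add: Om_def)
  define rank where "rank = (\<lambda>w. dim ((\<lambda>j. r j w) ` F))"
  have bound: "rank w < DIM(real^'d^('d option \<times> 'd option)) + 1" for w
    unfolding rank_def using dim_subset_UNIV[of "(\<lambda>j. r j w) ` F"] by linarith
  have "\<exists>w. w \<in> Om \<and> (\<forall>w'. w' \<in> Om \<longrightarrow> rank w' \<le> rank w)"
    by (rule ex_has_greatest_nat[of "\<lambda>w. w \<in> Om" w0 rank "DIM(real^'d^('d option \<times> 'd option)) + 1"])
       (use \<open>w0 \<in> Om\<close> bound in blast)+
  then obtain w1 where w1: "w1 \<in> Om" "\<And>w'. w' \<in> Om \<Longrightarrow> rank w' \<le> rank w1" by blast
  have indep: "r (x, y) w \<notin> span ((\<lambda>j. r j w) ` F)" if "w \<in> Om" for w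
  proof
    assume "r (x, y) w \<in> span ((\<lambda>j. r j w) ` F)"
    then obtain c where c: "r (x, y) w = (\<Sum>j\<in>F. c j *\<^sub>R r j w)"
      using span_image_finite_sum[OF finF, of "r (x, y) w" "\<lambda>j. r j w"] by blast
    define c' where "c' = (\<lambda>j. if j = (x, y) then - 1 else if j \<in> F then c j else 0)"
    have c'_supp: "c' j = 0" if "j \<notin> E" for j using that FE xy by (auto simp: c'_def)
    have xyF: "(x, y) \<notin> F" "(y, x) \<notin> F" by (auto simp: F_def remove_edge_def)
    have "(\<Sum>j\<in>V \<times> V. c' j *\<^sub>R r j w) = (\<Sum>j\<in>insert (x, y) F. c' j *\<^sub>R r j w)"
      by (rule sum.mono_neutral_right) (use finite_V FE xy in \<open>auto simp: c'_def E_iff\<close>)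
    also have "\<dots> = (\<Sum>j\<in>F. c' j *\<^sub>R r j w) - r (x, y) w"
      using finF xyF by (simp add: c'_def)
    also have "(\<Sum>j\<in>F. c' j *\<^sub>R r j w) = r (x, y) w"
      unfolding c by (rule sum.cong) (use xyF in \<open>auto simp: c'_def\<close>)
    finally have zero: "(\<Sum>u\<in>V. \<Sum>v\<in>V. c' (u, v) *\<^sub>R r (u, v) w) = 0"
      by (simp add: sum.cartesian_product)
    \<comment> \<open>Each edge occurs in \<open>E\<close> in both orientations, so the coefficients
      are symmetrized. Neither orientation of the removed edge is in \<open>F\<close>, so
      \<open>\<omega> x y\<close> equals -1, which contradicts its vanishing.\<close>
    define \<omega> where "\<omega> = (\<lambda>u v. c' (u, v) + c' (v, u))"
    have "\<omega> x y = 0"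
    proof (rule bridge_stress_zero[OF \<psi> _ _ _ _ bridge x y])
      show "well_placed V (cfg w)" using that by (simp add: Om_def)
      show "\<omega> u v = \<omega> v u" for u v by (simp add: \<omega>_def)
      show "\<omega> u v = 0" if "(u, v) \<notin> E" for u v
      proof -
        have "(v, u) \<notin> E" using that E_sym by blast
        then show ?thesis using c'_supp that by (simp add: \<omega>_def)
      qed
      show "(\<Sum>v\<in>V. \<omega> z v *\<^sub>R (cfg w z - cfg w v)) = 0" if "z \<in> V" for z
      proof -
        let ?d = "\<lambda>u v. cfg w u - cfg w v"
        have comp: "c' (u, v) *\<^sub>R r (u, v) w $ \<phi> z
            = (if u = z then c' (u, v) *\<^sub>R ?d u v else 0) - (if v = z then c' (u, v) *\<^sub>R ?d u v else 0)"
          if "u \<in> V" "v \<in> V" for u v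
        proof -
          have "r (u, v) w $ \<phi> z = (if u = z then ?d u v else 0) - (if v = z then ?d u v else 0)"
            unfolding r_def prod.case vector_minus_component axis_def vec_lambda_beta
            using \<phi>_inj[OF \<open>z \<in> V\<close> that(1)] \<phi>_inj[OF \<open>z \<in> V\<close> that(2)]
            by (simp only: eq_commute[of z])
          then show ?thesis by (simp only: scaleR_diff_right if_distrib[of "\<lambda>x. _ *\<^sub>R x"] scaleR_zero_right)
        qed
        have "0 = (\<Sum>u\<in>V. \<Sum>v\<in>V. c' (u, v) *\<^sub>R r (u, v) w) $ \<phi> z" using zero by simp
        also have "\<dots> = (\<Sum>u\<in>V. \<Sum>v\<in>V. c' (u, v) *\<^sub>R r (u, v) w $ \<phi> z)" by simp
        also have "\<dots> = (\<Sum>u\<in>V. \<Sum>v\<in>V. (if u = z then c' (u, v) *\<^sub>R ?d u v else 0) -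
            (if v = z then c' (u, v) *\<^sub>R ?d u v else 0))"
          by (intro sum.cong refl comp)
        also have "\<dots> = (\<Sum>v\<in>V. \<Sum>u\<in>V. (if u = z then c' (u, v) *\<^sub>R ?d u v else 0)) -
            (\<Sum>u\<in>V. \<Sum>v\<in>V. (if v = z then c' (u, v) *\<^sub>R ?d u v else 0))"
          unfolding sum_subtractf by (subst (1) sum.swap) simp
        also have "\<dots> = (\<Sum>v\<in>V. c' (z, v) *\<^sub>R ?d z v) - (\<Sum>u\<in>V. c' (u, z) *\<^sub>R ?d u z)"
          using finite_V \<open>z \<in> V\<close> by simp
        also have "\<dots> = (\<Sum>v\<in>V. \<omega> z v *\<^sub>R ?d z v)"
          unfolding sum_subtractf[symmetric]
          by (rule sum.cong) (auto simp: \<omega>_def algebra_simps)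
        finally show ?thesis by simp
      qed
    qed
    then have "c' (x, y) + c' (y, x) = 0" by (simp add: \<omega>_def)
    moreover have "x \<noteq> y" using xy by (auto simp: E_iff)
    ultimately show False using xyF by (auto simp: c'_def)
  qed
  have regular: "\<exists>U \<delta> \<gamma>. open U \<and> w \<in> U \<and> (\<forall>w'\<in>U. rank w' = rank w) \<and> \<delta> > 0 \<and> \<gamma> 0 = w \<and>
      (\<forall>t\<in>ball 0 \<delta>. \<gamma> differentiable (at (t :: real)) \<and> (\<forall>j\<in>F. f j (\<gamma> t) = f j w) \<and>
         f (x, y) (\<gamma> t) = f (x, y) w + t)"
    if "w \<in> Om" and "\<And>w'. w' \<in> Om \<Longrightarrow> rank w' \<le> rank w" for w
    unfolding rank_def
    by (rule constant_rank_path[where f = f and r = r,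
          OF \<open>open Om\<close> \<open>w \<in> Om\<close> deriv cont that(2)[unfolded rank_def] indep[OF \<open>w \<in> Om\<close>]])
  \<comment> \<open>Only the neighbourhood is taken from this use of \<open>regular\<close>; the
    path comes from its second use, at the configuration of the generic \<open>p\<close>.\<close>
  obtain U where U: "open U" "w1 \<in> U" "\<And>w. w \<in> U \<Longrightarrow> rank w = rank w1"
    using regular[OF w1] by blast
  have "open (U \<inter> Om)" "w1 \<in> U \<inter> Om" using U \<open>open Om\<close> w1(1) by auto
  then obtain p :: "('v, 'd) realization" and w where p: "generic_realization V p" and w: "w \<in> U \<inter> Om"
    and pw: "\<And>i. i \<in> upper_pairs \<Longrightarrow> w $ i = p (\<psi> i)"
    using generic_in_open[OF \<psi>] by blast
  have pcfg: "cfg w v = p v" if "v \<in> V" for v using pw \<phi>[OF that] by (simp add: cfg_def)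
  have wOm: "w \<in> Om" and maximal: "\<And>w'. w' \<in> Om \<Longrightarrow> rank w' \<le> rank w"
    using w1(2) U(3) w by auto
  obtain \<delta> \<gamma> where \<delta>: "\<delta> > 0" and \<gamma>0: "\<gamma> 0 = w"
    and diff: "\<And>t. t \<in> ball 0 \<delta> \<Longrightarrow> \<gamma> differentiable (at (t :: real))"
    and const: "\<And>t j. t \<in> ball 0 \<delta> \<Longrightarrow> j \<in> F \<Longrightarrow> f j (\<gamma> t) = f j w"
    and speed: "\<And>t. t \<in> ball 0 \<delta> \<Longrightarrow> f (x, y) (\<gamma> t) = f (x, y) w + t"
    using regular[OF wOm maximal] by blast
  have "flexing V F p (ball 0 \<delta>) (\<lambda>t. cfg (\<gamma> t))"
    unfolding flexing_def
  proof (intro conjI ballI)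
    show "is_interval (ball (0 :: real) \<delta>)" by (simp add: is_interval_convex_1)
    show "(\<lambda>t. cfg (\<gamma> t) v) differentiable_on ball 0 \<delta>" if "v \<in> V" for v
      unfolding differentiable_on_def
    proof
      fix t assume "t \<in> ball (0 :: real) \<delta>"
      then obtain D where "(\<gamma> has_derivative D) (at t)" using diff unfolding differentiable_def by blast
      then have "((\<lambda>t. \<gamma> t $ \<phi> v) has_derivative (\<lambda>h. D h $ \<phi> v)) (at t)"
        by (rule bounded_linear.has_derivative[OF bounded_linear_vec_nth])
      then show "(\<lambda>t. cfg (\<gamma> t) v) differentiable at t within ball 0 \<delta>"
        unfolding cfg_def by (meson differentiableI differentiable_at_withinI)
    qed
    show "\<exists>t\<^sub>0\<in>ball 0 \<delta>. \<forall>v\<in>V. cfg (\<gamma> t\<^sub>0) v = p v"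
      using \<delta> \<gamma>0 pcfg by (intro bexI[of _ 0]) auto
    show "edge_map F (cfg (\<gamma> t)) = edge_map F p" if "t \<in> ball 0 \<delta>" for t
      unfolding edge_map_eq_iff
    proof clarify
      fix u v assume uv: "(u, v) \<in> F"
      then have "u \<in> V" "v \<in> V" using FE by (auto simp: E_iff)
      then show "norm (cfg (\<gamma> t) u - cfg (\<gamma> t) v) = norm (p u - p v)"
        using const[OF that uv] pcfg by (simp add: f_def)
    qed
  qed
  \<comment> \<open>A motion preserves the length of the removed edge, whereas half its square grows
    at unit speed along the path.\<close>
  moreover have "\<not> trivial_flexing V p (ball 0 \<delta>) (\<lambda>t. cfg (\<gamma> t))"
  proof
    assume *: "trivial_flexing V p (ball 0 \<delta>) (\<lambda>t. cfg (\<gamma> t))"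
    have t: "\<delta> / 2 \<in> ball (0 :: real) \<delta>" using \<delta> by simp
    obtain T where T: "euclidean_motion T" "\<forall>v\<in>V. cfg (\<gamma> (\<delta> / 2)) v = T (p v)"
      using * t unfolding trivial_flexing_def by blast
    have "x \<in> V" "y \<in> V" using xy by (auto simp: E_iff)
    moreover have "norm (T a - T b) = norm (a - b)" for a b
      using T(1) unfolding euclidean_motion_def
      by (metis add_diff_cancel_right linear_diff orthogonal_transformation_linear orthogonal_transformation_norm)
    ultimately have "f (x, y) (\<gamma> (\<delta> / 2)) = f (x, y) w"
      using T(2) pcfg by (simp add: f_def)
    then show False using speed[OF t] \<delta> by simp
  qed
  ultimately have "\<not> locally_rigid V F p" unfolding locally_rigid_def by blast
  then show ?thesis using that p unfolding F_def by blast
qed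

end

section \<open>Quadrics and global rigidity\<close>

definition symmetric_matrices :: "(real^'o^'o) set" where
  "symmetric_matrices = {M. \<forall>i j. M $ i $ j = M $ j $ i}"

lemma subspace_symmetric_matrices: "subspace symmetric_matrices"
  by (auto simp: subspace_def symmetric_matrices_def)

lemma dim_symmetric_matrices: "dim (symmetric_matrices :: (real^'o::finite^'o) set) \<le> card (upper_pairs :: ('o \<times> 'o) set)"
proof -
  define B :: "'o \<times> 'o \<Rightarrow> real^'o^'o" where
    "B = (\<lambda>r. \<chi> a b. of_bool (r = (a, b)) + of_bool (a \<noteq> b \<and> r = (b, a)))"
  have "symmetric_matrices \<subseteq> span (B ` upper_pairs)"
  proof
    fix M :: "real^'o^'o" assume "M \<in> symmetric_matrices"
    then have sym: "M $ i $ j = M $ j $ i" for i j by (simp add: symmetric_matrices_def)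
    have "(\<Sum>r\<in>upper_pairs. (M $ fst r $ snd r) *\<^sub>R B r) $ a $ b = M $ a $ b" for a b
    proof -
      have "(\<Sum>r\<in>upper_pairs. (M $ fst r $ snd r) *\<^sub>R B r) $ a $ b
          = (\<Sum>r\<in>upper_pairs. (if r = (a, b) then M $ a $ b else 0) +
              (if r = (b, a) then (if a \<noteq> b then M $ b $ a else 0) else 0))"
        unfolding sum_component vector_scaleR_component
      proof (rule sum.cong)
        fix r :: "'o \<times> 'o"
        show "M $ fst r $ snd r *\<^sub>R B r $ a $ b = (if r = (a, b) then M $ a $ b else 0) +
              (if r = (b, a) then (if a \<noteq> b then M $ b $ a else 0) else 0)"
          by (cases "a = b"; cases r) (simp_all add: B_def)
      qed simp
      also have "\<dots> = (if (a, b) \<in> upper_pairs then M $ a $ b else 0) +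
          (if (b, a) \<in> upper_pairs then (if a \<noteq> b then M $ b $ a else 0) else 0)"
        by (simp add: sum.distrib)
      also have "\<dots> = M $ a $ b"
      proof (cases "a = b")
        case True then show ?thesis by (simp add: upper_pairs_refl)
      next
        case False
        then have "(a, b) \<in> upper_pairs \<longleftrightarrow> (b, a) \<notin> upper_pairs"
          using upper_pairs_total[of a b] upper_pairs_antisym[of a b] by blast
        then show ?thesis using False sym[of b a] by simp
      qed
      finally show ?thesis .
    qed
    then have "M = (\<Sum>r\<in>upper_pairs. (M $ fst r $ snd r) *\<^sub>R B r)" by (simp add: vec_eq_iff)
    also have "\<dots> \<in> span (B ` upper_pairs)"
      by (intro span_sum span_scale span_base imageI)
    finally show "M \<in> span (B ` upper_pairs)" .
  qed
  then have "dim (symmetric_matrices :: (real^'o^'o) set) \<le> card (B ` upper_pairs)"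
    by (rule dim_le_card) simp
  also have "\<dots> \<le> card (upper_pairs :: ('o \<times> 'o) set)" by (rule card_image_le) simp
  finally show ?thesis .
qed

lemma subspace_annihilator:
  assumes "subspace K" "\<And>x. linear (g x)"
  shows "subspace {M \<in> K. \<forall>u\<in>S. g (x u) M = (0 :: real)}"
  using assms(1) linear_0[OF assms(2)] linear_add[OF assms(2)] linear_cmul[OF assms(2)]
  by (auto simp: subspace_def)

lemma dim_less_subspace:
  fixes K L :: "'a::euclidean_space set"
  assumes "subspace K" "subspace L" "K \<subset> L"
  shows "dim K < dim L"
proof -
  have "span K = K" "span L = L" using assms by (simp_all add: span_eq_iff)
  then show ?thesis using dim_psubset[of K L] assms(3) by (simp only:)
qed

text \<open>Whenever a nonzero element survives the conditions imposed so far, some point of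
  \<open>P\<close> excludes it, and the condition there lowers the dimension by at least one.
  Truncated subtraction covers the case in which nothing survives.\<close>

lemma greedy_annihilator:
  fixes g :: "'x \<Rightarrow> 'a::euclidean_space \<Rightarrow> real"
  assumes "finite S" and K: "subspace K" and g: "\<And>x. linear (g x)"
    and sep: "\<And>M. M \<in> K \<Longrightarrow> M \<noteq> 0 \<Longrightarrow> \<exists>x\<in>P. g x M \<noteq> 0" and "P \<noteq> {}"
  shows "\<exists>x. (\<forall>u\<in>S. x u \<in> P) \<and> dim {M \<in> K. \<forall>u\<in>S. g (x u) M = 0} \<le> dim K - card S"
  using assms(1)
proof (induction S)
  case empty
  then show ?case by simp
next
  case (insert u S)
  then obtain x where x: "\<forall>u\<in>S. x u \<in> P" "dim {M \<in> K. \<forall>u\<in>S. g (x u) M = 0} \<le> dim K - card S"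
    by blast
  let ?K = "{M \<in> K. \<forall>u\<in>S. g (x u) M = 0}"
  obtain y where y: "y \<in> P" "?K \<subseteq> {0} \<or> (\<exists>M\<in>?K. g y M \<noteq> 0)"
    using sep \<open>P \<noteq> {}\<close> by blast
  let ?L = "{M \<in> K. \<forall>v\<in>insert u S. g ((x(u := y)) v) M = 0}"
  have L: "?L = {M \<in> ?K. g y M = 0}" using insert(2) by (auto split: if_splits)
  have "dim ?L \<le> dim ?K - 1"
    using y(2)
  proof
    assume "?K \<subseteq> {0}"
    then have "?L \<subseteq> {0}" unfolding L by blast
    then have "dim ?L = 0" by (simp only: dim_eq_0)
    then show ?thesis by linarith
  next
    assume "\<exists>M\<in>?K. g y M \<noteq> 0"
    then have "?L \<subset> ?K" unfolding L by blast
    then have "dim ?L < dim ?K"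
      by (intro dim_less_subspace subspace_annihilator K g)
    then show ?thesis by simp
  qed
  moreover have "\<forall>v\<in>insert u S. (x(u := y)) v \<in> P" using x(1) y(1) by simp
  ultimately show ?case using x(2) insert(1,2) by (intro exI[of _ "x(u := y)"]) auto
qed

text \<open>For symmetric \<open>M\<close> this is half the gradient of the quadratic function hat
  x^T M hat x, a normal field of the quadric.\<close>

definition quadric_flex :: "real^'d::finite option^'d option \<Rightarrow> real^'d \<Rightarrow> real^'d" where
  "quadric_flex M x = (\<chi> j. (M *v hat x) $ Some j)"

lemma inner_quadric_flex: "y \<bullet> quadric_flex M x = (hat y - axis None 1) \<bullet> (M *v hat x)"
  by (simp add: quadric_flex_def inner_vec_def sum_option axis_def)

text \<open>
  In a family of placements on quadrics near the sphere of radius 1, displaced along the flexes of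
  the quadrics, this is the linearisation of the equation of the quadric at a displaced point that
  is kept fixed.
\<close>

definition sphere_form :: "real \<Rightarrow> real^'d::finite \<Rightarrow> real^'d option^'d option \<Rightarrow> real" where
  "sphere_form \<kappa> x M = hat x \<bullet> (M *v hat x) - \<kappa> * (x \<bullet> quadric_flex M x)"

lemma linear_sphere_form: "linear (sphere_form \<kappa> x)"
  unfolding sphere_form_def inner_quadric_flex
  by (rule linearI) (simp_all add: matrix_vector_mult_add_rdistrib inner_add_right
      distrib_left scaleR_matrix_vector_assoc[symmetric] right_diff_distrib)

lemma sphere_form_expand:
  "sphere_form \<kappa> x M = (1 - \<kappa>) * (hat x \<bullet> (M *v hat x)) + \<kappa> * (axis None 1 \<bullet> (M *v hat x))"
  by (simp add: sphere_form_def inner_quadric_flex inner_diff_left algebra_simps)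

lemma hat_scaleR_axis: "hat (t *\<^sub>R axis i 1) = axis None 1 + t *\<^sub>R axis (Some i) 1"
  by (auto simp: vec_eq_iff axis_def hat_def split: option.splits)

lemma hat_add: "hat (x + y) = hat x + hat y - axis None 1"
  by (auto simp: vec_eq_iff axis_def hat_def split: option.splits)

lemmas axis_form_simps = inner_add_left inner_diff_left inner_add_right inner_diff_right
  matrix_vector_right_distrib matrix_vector_mult_diff_distrib inner_axis_matrix_axis
  matrix_vector_mult_scaleR inner_scaleR_left inner_scaleR_right

lemma sphere_form_axis:
  assumes "\<And>i j. M $ i $ j = M $ j $ i"
  shows "sphere_form \<kappa> (t *\<^sub>R axis i 1) M =
    M $ None $ None + t * (2 - \<kappa>) * M $ None $ Some i + (1 - \<kappa>) * t\<^sup>2 * M $ Some i $ Some i"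
  unfolding sphere_form_expand hat_scaleR_axis
  using assms[of "Some i" None]
  by (simp add: axis_form_simps power2_eq_square algebra_simps)

text \<open>The points e_i and -e_i separate odd from even terms, and
  \<open>\<kappa> \<noteq> 2\<close> removes the odd ones. The points (e_i + e_j) / sqrt 2 then
  remove the mixed terms, which takes \<open>\<kappa> \<noteq> 1\<close>. What remains is determined
  by the constant coefficient.\<close>

lemma sphere_form_vanishing:
  fixes M :: "real^'d::finite option^'d option"
  assumes sym: "\<And>i j. M $ i $ j = M $ j $ i" and \<kappa>: "\<kappa> \<noteq> 1" "\<kappa> \<noteq> 2"
    and 0: "\<And>x. norm x = 1 \<Longrightarrow> sphere_form \<kappa> x M = 0"
  shows "M $ None $ Some i = 0" "(\<kappa> - 1) * M $ Some i $ Some i = M $ None $ None"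
    "i \<noteq> j \<Longrightarrow> M $ Some i $ Some j = 0"
proof -
  have pm: "M $ None $ Some i = 0 \<and> (\<kappa> - 1) * M $ Some i $ Some i = M $ None $ None" for i
  proof -
    have "sphere_form \<kappa> (1 *\<^sub>R axis i 1) M = 0" "sphere_form \<kappa> ((-1) *\<^sub>R axis i 1) M = 0"
      by (auto intro!: 0)
    then have "M $ None $ None + (2 - \<kappa>) * M $ None $ Some i + (1 - \<kappa>) * M $ Some i $ Some i = 0"
      "M $ None $ None + (\<kappa> - 2) * M $ None $ Some i + (1 - \<kappa>) * M $ Some i $ Some i = 0"
      unfolding sphere_form_axis[OF sym] by simp_all
    moreover have "(\<kappa> - 2) * M $ None $ Some i = - ((2 - \<kappa>) * M $ None $ Some i)"
      by (simp add: algebra_simps)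
    ultimately have "(2 - \<kappa>) * M $ None $ Some i = 0" "M $ None $ None + (1 - \<kappa>) * M $ Some i $ Some i = 0"
      by linarith+
    then show ?thesis using \<kappa> by (simp add: left_diff_distrib)
  qed
  then show "M $ None $ Some i = 0" "(\<kappa> - 1) * M $ Some i $ Some i = M $ None $ None" by auto
  assume ij: "i \<noteq> j"
  define t where "t = 1 / sqrt 2"
  have t: "t * t = 1 / 2" by (simp add: t_def)
  let ?x = "t *\<^sub>R axis i 1 + t *\<^sub>R axis j (1 :: real)"
  have "?x \<bullet> ?x = 1"
    using ij t by (simp add: inner_add_left inner_add_right inner_axis_axis)
  then have "norm ?x = 1" by (simp add: norm_eq_1)
  then have "sphere_form \<kappa> ?x M = 0" by (rule 0)
  moreover have "sphere_form \<kappa> ?x M = M $ None $ None +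
     (1 - \<kappa>) * (t * t) * (M $ Some i $ Some i + M $ Some j $ Some j + 2 * M $ Some i $ Some j)"
    unfolding sphere_form_expand hat_add hat_scaleR_axis
    using pm[of i, THEN conjunct1] pm[of j, THEN conjunct1]
      sym[of "Some i" None] sym[of "Some j" None] sym[of "Some i" "Some j"]
    by (simp add: axis_form_simps algebra_simps)
  ultimately have "(1 - \<kappa>) * M $ Some i $ Some j = 0"
    using pm[of i] pm[of j] unfolding t by (simp add: algebra_simps)
  then show "M $ Some i $ Some j = 0" using \<kappa> by simp
qed

text \<open>Only the matrices diag(c, c/(\<kappa> - 1), ..., c/(\<kappa> - 1)) pass all tests for
  \<open>\<kappa>\<close>. On them the form for \<open>\<kappa>'\<close> at a unit vector is c
  (\<kappa> - \<kappa>') / (\<kappa> - 1), so one point with a different parameter forces c =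
  0.\<close>

lemma sphere_form_separates:
  fixes M :: "real^'d::finite option^'d option"
  assumes sym: "\<And>i j. M $ i $ j = M $ j $ i" and \<kappa>: "\<kappa> \<noteq> 1" "\<kappa> \<noteq> 2" "\<kappa>' \<noteq> \<kappa>"
    and 0: "\<And>x. norm x = 1 \<Longrightarrow> sphere_form \<kappa> x M = 0"
    and y: "norm y = 1" "sphere_form \<kappa>' y M = 0"
  shows "M = 0"
proof -
  note van = sphere_form_vanishing[OF sym \<kappa>(1,2) 0]
  define c where "c = M $ None $ None"
  have S: "M $ Some i $ Some j = (if i = j then c / (\<kappa> - 1) else 0)" for i j
    using van(2)[of i] van(3)[of i j] \<kappa>(1) by (auto simp: c_def field_simps)
  have N: "M $ None $ Some i = 0" "M $ Some i $ None = 0" for i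
    using van(1)[of i] sym[of None "Some i"] by auto
  have Mv: "(M *v hat x) $ None = c" "(M *v hat x) $ Some i = c / (\<kappa> - 1) * x $ i" for x i
    by (simp_all add: matrix_vector_mult_def sum_option N S c_def if_distrib[of "\<lambda>z. z * _"] cong: if_cong)
  have "y \<bullet> y = 1" using y(1) by (simp add: norm_eq_1)
  then have yy: "(\<Sum>j\<in>UNIV. y $ j * y $ j) = 1" by (simp add: inner_vec_def)
  have "y \<bullet> quadric_flex M y = c / (\<kappa> - 1) * (\<Sum>j\<in>UNIV. y $ j * y $ j)"
    unfolding sum_distrib_left by (simp add: inner_vec_def quadric_flex_def Mv mult_ac)
  moreover have "hat y \<bullet> (M *v hat y) = c + c / (\<kappa> - 1) * (\<Sum>j\<in>UNIV. y $ j * y $ j)"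
    unfolding sum_distrib_left by (simp add: inner_vec_def sum_option Mv mult_ac)
  ultimately have "c + c / (\<kappa> - 1) - \<kappa>' * (c / (\<kappa> - 1)) = 0"
    using y(2) yy by (simp add: sphere_form_def)
  moreover have "c = (\<kappa> - 1) * (c / (\<kappa> - 1))" using \<kappa>(1) by simp
  ultimately have "(\<kappa> - \<kappa>') * (c / (\<kappa> - 1)) = 0" by (simp only: left_diff_distrib)
  then have "c = 0" using \<kappa> by simp
  then have "M $ a $ b = 0" for a b
    by (cases a; cases b) (simp_all add: N S c_def[symmetric])
  then show ?thesis by (simp add: vec_eq_iff)
qed

section \<open>Derivatives for the open mapping argument\<close>

lemma bounded_bilinear_matrix_vector_mult:
  "bounded_bilinear ((*v) :: real^'n^'m \<Rightarrow> real^'n \<Rightarrow> real^'m)"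
  unfolding bilinear_conv_bounded_bilinear[symmetric] bilinear_def
  by (intro conjI allI linearI)
     (simp_all add: matrix_vector_mult_add_rdistrib matrix_vector_right_distrib
       scaleR_matrix_vector_assoc[symmetric] matrix_vector_mult_scaleR)

lemma has_derivative_vec_lambda:
  fixes f :: "'n::finite \<Rightarrow> 'a::real_normed_vector \<Rightarrow> 'b::real_normed_vector"
  assumes "\<And>i. (f i has_derivative f' i) F"
  shows "((\<lambda>x. \<chi> i. f i x) has_derivative (\<lambda>h. \<chi> i. f' i h)) F"
proof -
  have eq: "(\<chi> i. y i) = (\<Sum>i\<in>UNIV. axis i (y i))" for y :: "'n \<Rightarrow> 'b"
    by (simp add: vec_eq_iff axis_def)
  have axis: "bounded_linear (axis i :: 'b \<Rightarrow> 'b^'n)" for i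
  proof (rule bounded_linear_intro)
    fix x :: 'b
    have "norm (axis i x :: 'b^'n) \<le> (\<Sum>k\<in>UNIV. norm ((axis i x :: 'b^'n) $ k))"
      unfolding norm_vec_def by (rule L2_set_le_sum) simp
    also have "\<dots> = (\<Sum>k\<in>UNIV. if k = i then norm x else 0)"
      by (rule sum.cong) (simp_all add: axis_def)
    also have "\<dots> = norm x" by simp
    finally show "norm (axis i x :: 'b^'n) \<le> norm x * 1" by simp
  qed (auto simp: vec_eq_iff axis_def)
  show ?thesis
    unfolding eq by (rule has_derivative_sum) (rule bounded_linear.has_derivative[OF axis assms])
qed

lemma has_derivative_hat:
  assumes "(f has_derivative f') F"
  shows "((\<lambda>x. hat (f x)) has_derivative (\<lambda>h. hat (f' h) - axis None 1)) F"
proof -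
  let ?L = "\<lambda>x :: real^'c. hat x - axis None 1"
  have "linear ?L"
    by (rule linearI) (auto simp: vec_eq_iff hat_def axis_def split: option.splits)
  then have "bounded_linear ?L" by (simp add: linear_conv_bounded_linear)
  from bounded_linear.has_derivative[OF this assms]
  have "((\<lambda>x. ?L (f x) + axis None 1) has_derivative (\<lambda>h. ?L (f' h))) F"
    by (rule has_derivative_add_const)
  then show ?thesis by simp
qed

lemma norm_add_eq_norm_diff_iff: "norm (x + y) = norm (x - y) \<longleftrightarrow> x \<bullet> y = (0 :: real)"
  by (auto simp: norm_eq inner_add_left inner_add_right inner_diff_left inner_diff_right inner_commute)

context chain
begin

text \<open>
  At the base quadric $3 |x|^2 = 3$ the flex scales the two sides by $1 + 3$ and $1 - 3$; the value is
  $6 \sigma / (1 + 3 \sigma)$ for $\sigma = \pm 1$.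
\<close>

definition stretch :: "'v \<Rightarrow> real" where
  "stretch u = (if side u = 1 then 3/2 else 3)"

text \<open>Every vertex contributes one linear condition, and there are as many vertices as
  coefficients. Two vertices of one side are placed at antipodes, which later makes their distance
  change; the others are placed greedily. For the side with parameter 3, separation comes from the
  point \<open>e\<close> with parameter 3/2, and for the rest of the other side from the point of
  \<open>y\<close> with parameter 3.\<close>

lemma sphere_points_determine_form:
  fixes \<psi> :: "'d::finite option \<times> 'd option \<Rightarrow> 'v"
  assumes \<psi>: "bij_betw \<psi> upper_pairs V"
    and x: "x1 \<in> V" "x2 \<in> V" "x1 \<noteq> x2" "side x1 = 1" "side x2 = 1"
    and y: "y \<in> V" "side y = - 1"
  obtains a :: "'v \<Rightarrow> real^'d" where "\<And>u. u \<in> V \<Longrightarrow> norm (a u) = 1" "a x2 = - a x1"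
    "\<forall>M\<in>symmetric_matrices. (\<forall>u\<in>V. sphere_form (stretch u) (a u) M = 0) \<longrightarrow> M = 0"
proof -
  define e :: "real^'d" where "e = axis undefined 1"
  have e: "norm e = 1" "norm (- e) = 1" by (simp_all add: e_def)
  define Sp where "Sp = {x :: real^'d. norm x = 1}"
  have "Sp \<noteq> {}" using e by (auto simp: Sp_def)
  define P where "P = {u \<in> V. side u = 1} - {x1, x2}"
  define Q where "Q = {u \<in> V. side u = - 1}"
  have V: "V = {x1, x2} \<union> P \<union> Q" using x side_cases by (auto simp: P_def Q_def)
  have fin: "finite P" "finite Q" using finite_V by (simp_all add: P_def Q_def)
  have disj: "x1 \<notin> P" "x2 \<notin> P" "x1 \<notin> Q" "x2 \<notin> Q" "P \<inter> Q = {}" using x by (auto simp: P_def Q_def)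
  have "card V = card ({x1, x2} \<union> P) + card Q"
    unfolding V by (rule card_Un_disjoint) (use fin disj in auto)
  also have "card ({x1, x2} \<union> P) = card {x1, x2} + card P"
    by (rule card_Un_disjoint) (use fin disj in auto)
  finally have card_V: "card V = 2 + card P + card Q" using x by simp
  let ?Sym = "symmetric_matrices :: (real^'d option^'d option) set"
  have dim_Sym: "dim ?Sym \<le> card V"
    using dim_symmetric_matrices bij_betw_same_card[OF \<psi>] by metis
  define K0 where "K0 = {M \<in> ?Sym. \<forall>u\<in>{()}. sphere_form (3/2) e M = 0}"
  define K1 where "K1 = {M \<in> K0. \<forall>u\<in>{()}. sphere_form (3/2) (- e) M = 0}"
  have sub0: "subspace K0" unfolding K0_def
    by (rule subspace_annihilator[OF subspace_symmetric_matrices linear_sphere_form])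
  have sub1: "subspace K1" unfolding K1_def
    by (rule subspace_annihilator[OF sub0 linear_sphere_form])
  have form_e: "sphere_form \<kappa> e M = M $ None $ None + (2 - \<kappa>) * M $ None $ Some undefined + (1 - \<kappa>) * M $ Some undefined $ Some undefined"
    "sphere_form \<kappa> (- e) M = M $ None $ None - (2 - \<kappa>) * M $ None $ Some undefined + (1 - \<kappa>) * M $ Some undefined $ Some undefined"
    if "M \<in> ?Sym" for \<kappa> M
    using sphere_form_axis[of M \<kappa> 1 undefined] sphere_form_axis[of M \<kappa> "-1" undefined] that
    by (simp_all add: symmetric_matrices_def e_def algebra_simps)
  \<comment> \<open>The matrix of a constant shows that the condition at \<open>e\<close> is
    nontrivial. \<open>N1\<close>, of an affine function, does the same for the opposite point
    within \<open>K0\<close>: its form at \<open>e\<close> is -1/2 + (2 - 3/2) = 0, and at the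
    opposite point it is -1.\<close>
  define N0 :: "real^'d option^'d option" where
    "N0 = (\<chi> i j. of_bool (i = None \<and> j = None))"
  have "N0 \<in> ?Sym" by (simp add: N0_def symmetric_matrices_def conj_commute)
  moreover have "sphere_form (3/2) e N0 = 1"
    using form_e(1)[OF calculation] by (simp add: N0_def)
  ultimately have "N0 \<in> ?Sym" "N0 \<notin> K0" by (simp_all add: K0_def)
  then have "K0 \<subset> ?Sym" unfolding K0_def by blast
  then have dim0: "dim K0 < dim ?Sym" by (intro dim_less_subspace sub0 subspace_symmetric_matrices)
  define N1 :: "real^'d option^'d option" where
    "N1 = (\<chi> i j. if i = None \<and> j = None then - 1 / 2 else of_bool (i = None \<or> j = None))"
  have N1: "N1 \<in> ?Sym" by (simp add: N1_def symmetric_matrices_def conj_commute disj_commute)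
  have "sphere_form (3/2) e N1 = 0" "sphere_form (3/2) (- e) N1 = -1"
    using form_e[OF N1] by (simp_all add: N1_def)
  then have "N1 \<in> K0" "N1 \<notin> K1" using N1 by (simp_all add: K0_def K1_def)
  then have "K1 \<subset> K0" unfolding K1_def by blast
  then have dim1: "dim K1 < dim K0" by (intro dim_less_subspace sub0 sub1)
  have sepQ: "\<exists>x\<in>Sp. sphere_form 3 x M \<noteq> 0" if "M \<in> K1" "M \<noteq> 0" for M
  proof (rule ccontr)
    assume "\<not> ?thesis"
    then have "sphere_form 3 x M = 0" if "norm x = 1" for x using that by (simp add: Sp_def)
    moreover have "sphere_form (3/2) e M = 0" "\<And>i j. M $ i $ j = M $ j $ i"
      using \<open>M \<in> K1\<close> by (simp_all add: K1_def K0_def symmetric_matrices_def)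
    ultimately have "M = 0" using e(1) by (intro sphere_form_separates[of M 3 "3/2" e]) auto
    then show False using \<open>M \<noteq> 0\<close> by simp
  qed
  obtain b where b: "\<forall>u\<in>Q. b u \<in> Sp" "dim {M \<in> K1. \<forall>u\<in>Q. sphere_form 3 (b u) M = 0} \<le> dim K1 - card Q"
    using greedy_annihilator[where g="sphere_form 3", OF fin(2) sub1 linear_sphere_form sepQ \<open>Sp \<noteq> {}\<close>]
    by blast
  define K2 where "K2 = {M \<in> K1. \<forall>u\<in>Q. sphere_form 3 (b u) M = 0}"
  have sub2: "subspace K2" unfolding K2_def
    by (rule subspace_annihilator[OF sub1 linear_sphere_form])
  have yQ: "y \<in> Q" using y by (simp add: Q_def)
  have sepP: "\<exists>x\<in>Sp. sphere_form (3/2) x M \<noteq> 0" if "M \<in> K2" "M \<noteq> 0" for M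
  proof (rule ccontr)
    assume "\<not> ?thesis"
    then have "sphere_form (3/2) x M = 0" if "norm x = 1" for x using that by (simp add: Sp_def)
    moreover have "sphere_form 3 (b y) M = 0" "\<And>i j. M $ i $ j = M $ j $ i"
      using \<open>M \<in> K2\<close> yQ by (simp_all add: K2_def K1_def K0_def symmetric_matrices_def)
    moreover have "norm (b y) = 1" using b(1) yQ by (simp add: Sp_def)
    ultimately have "M = 0" by (intro sphere_form_separates[of M "3/2" 3 "b y"]) auto
    then show False using \<open>M \<noteq> 0\<close> by simp
  qed
  obtain c where c: "\<forall>u\<in>P. c u \<in> Sp" "dim {M \<in> K2. \<forall>u\<in>P. sphere_form (3/2) (c u) M = 0} \<le> dim K2 - card P"
    using greedy_annihilator[where g="sphere_form (3/2)", OF fin(1) sub2 linear_sphere_form sepP \<open>Sp \<noteq> {}\<close>]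
    by blast
  define K3 where "K3 = {M \<in> K2. \<forall>u\<in>P. sphere_form (3/2) (c u) M = 0}"
  have "dim K3 = 0"
    using c(2) b(2) dim0 dim1 dim_Sym card_V unfolding K3_def[symmetric] K2_def[symmetric] by linarith
  then have K3: "K3 \<subseteq> {0}" by (simp only: dim_eq_0)
  define a where "a = (\<lambda>u. if u = x1 then e else if u = x2 then - e else if u \<in> P then c u else b u)"
  have aQ: "a u = b u" if "u \<in> Q" for u using that disj by (auto simp: a_def)
  have aP: "a u = c u" if "u \<in> P" for u using that disj by (auto simp: a_def)
  have stretchP: "stretch u = 3/2" if "u \<in> P" for u using that by (simp add: stretch_def P_def)
  have stretchQ: "stretch u = 3" if "u \<in> Q" for u using that by (simp add: stretch_def Q_def)
  show ?thesis
  proof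
    show "norm (a u) = 1" if "u \<in> V" for u
      using that b(1) c(1) e unfolding V by (auto simp: a_def Sp_def)
    show "a x2 = - a x1" using x(3) by (simp add: a_def)
    show "\<forall>M\<in>?Sym. (\<forall>u\<in>V. sphere_form (stretch u) (a u) M = 0) \<longrightarrow> M = 0"
    proof (intro ballI impI)
      fix M assume M: "M \<in> ?Sym" and "\<forall>u\<in>V. sphere_form (stretch u) (a u) M = 0"
      then have 0: "sphere_form (stretch u) (a u) M = 0" if "u \<in> V" for u using that by blast
      have "sphere_form (3/2) e M = 0" "sphere_form (3/2) (- e) M = 0"
        using 0[OF x(1)] 0[OF x(2)] x by (simp_all add: a_def stretch_def)
      moreover have "sphere_form 3 (b u) M = 0" if "u \<in> Q" for u
        using 0[of u] that aQ stretchQ by (auto simp: V)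
      moreover have "sphere_form (3/2) (c u) M = 0" if "u \<in> P" for u
        using 0[of u] that aP stretchP by (auto simp: V)
      ultimately have "M \<in> K3" using M by (simp add: K3_def K2_def K1_def K0_def)
      then show "M = 0" using K3 by blast
    qed
  qed
qed

text \<open>
  Averaging: if $v$ is an infinitesimal flex at $w$, then $w + v$ and $w - v$ have equal edge lengths.
\<close>

lemma quadric_flex_edge_lengths:
  fixes w :: "('v, 'd::finite) realization"
  assumes M: "M \<in> symmetric_matrices" and quad: "\<And>v. v \<in> V \<Longrightarrow> hat (w v) \<bullet> (M *v hat (w v)) = 0"
  shows "edge_map E (\<lambda>v. w v + side v *\<^sub>R quadric_flex M (w v))
       = edge_map E (\<lambda>v. w v - side v *\<^sub>R quadric_flex M (w v))"
  unfolding edge_map_eq_iff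
proof clarify
  fix u v assume uv: "(u, v) \<in> E"
  let ?d = "w u - w v" and ?f = "side u *\<^sub>R quadric_flex M (w u) - side v *\<^sub>R quadric_flex M (w v)"
  have "u \<in> V" "v \<in> V" using uv by (auto simp: E_iff)
  then have q: "hat (w u) \<bullet> (M *v hat (w u)) = 0" "hat (w v) \<bullet> (M *v hat (w v)) = 0"
    using quad by auto
  \<comment> \<open>By symmetry of \<open>M\<close> the mixed terms cancel, leaving the difference
    of two quadric values, both 0. Opposite signs along an edge turn the sum of the two flexes into
    the relative displacement, up to sign.\<close>
  have "hat (w u) \<bullet> (M *v hat (w v)) = hat (w v) \<bullet> (M *v hat (w u))"
    using M by (intro symmetric_matrix_inner_swap) (simp add: symmetric_matrices_def)
  then have "?d \<bullet> (quadric_flex M (w u) + quadric_flex M (w v)) = 0"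
    using q unfolding inner_diff_left inner_add_right
    by (simp add: inner_diff_left inner_quadric_flex)
  moreover have "?f = side u *\<^sub>R (quadric_flex M (w u) + quadric_flex M (w v))"
    using side_edge[OF uv] by (simp add: scaleR_add_right)
  ultimately have df: "?d \<bullet> ?f = 0" by simp
  then have "norm (?d + ?f) = norm (?d - ?f)" by (simp only: norm_add_eq_norm_diff_iff)
  then show "norm (w u + side u *\<^sub>R quadric_flex M (w u) - (w v + side v *\<^sub>R quadric_flex M (w v))) =
    norm (w u - side u *\<^sub>R quadric_flex M (w u) - (w v - side v *\<^sub>R quadric_flex M (w v)))"
    by (simp add: algebra_simps)
qed

text \<open>The unknowns are a matrix and a placement; \<open>H\<close> returns the defect
  \<open>K\<close> together with the displaced placement \<open>X\<close>. Surjectivity of its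
  derivative at one zero of the defect makes the displaced placements over defect 0 contain an open
  set. A generic \<open>p\<close> in it has the opposite displacement as its second
  realization.\<close>

lemma generic_not_globally_rigid:
  fixes \<psi> :: "'d::finite option \<times> 'd option \<Rightarrow> 'v"
  assumes \<psi>: "bij_betw \<psi> upper_pairs V"
    and x: "x1 \<in> V" "x2 \<in> V" "x1 \<noteq> x2" "side x1 = 1" "side x2 = 1"
    and y: "y \<in> V" "side y = - 1"
  obtains p :: "('v, 'd) realization" where "generic_realization V p" "\<not> globally_rigid V E p"
proof -
  obtain a :: "'v \<Rightarrow> real^'d" where a: "\<And>u. u \<in> V \<Longrightarrow> norm (a u) = 1" "a x2 = - a x1"
    and det: "\<forall>M\<in>symmetric_matrices. (\<forall>u\<in>V. sphere_form (stretch u) (a u) M = 0) \<longrightarrow> M = 0"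
    using sphere_points_determine_form[OF assms] by metis
  define \<phi> where "\<phi> = inv_into upper_pairs \<psi>"
  have \<phi>: "\<psi> (\<phi> v) = v" "\<phi> v \<in> upper_pairs" if "v \<in> V" for v
    using \<psi> that unfolding \<phi>_def
    by (simp_all add: bij_betw_inv_into_right bij_betwE[OF bij_betw_inv_into])
  have \<psi>V: "\<psi> i \<in> V" if "i \<in> upper_pairs" for i using \<psi> that by (auto simp: bij_betw_def)
  \<comment> \<open>Sign 0 means that padding coordinates are not displaced.\<close>
  define s where "s = (\<lambda>i. if i \<in> upper_pairs then side (\<psi> i) else 0)"
  \<comment> \<open>The flex of this quadric is 3x, so the two sides of the unit sphere placement
    move to spheres of radius 4 and 2. The factor 1 in place of 3 would collapse one side to the
    origin.\<close>
  define M0 :: "real^'d option^'d option" where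
    "M0 = (\<chi> i j. if i = j then (if i = None then - 3 else 3) else 0)"
  define w0 :: "real^'d^('d option \<times> 'd option)" where "w0 = (\<chi> i. a (\<psi> i))"
  \<comment> \<open>As in \<open>quadric_matrix\<close>, labels outside \<open>upper_pairs\<close>
    carry the symmetry equations, so \<open>K\<close> vanishes exactly for symmetric matrices whose
    quadric contains all vertices.\<close>
  define K where "K = (\<lambda>(i, j) (z :: (real^'d option^'d option) \<times> (real^'d^('d option \<times> 'd option))).
    if (i, j) \<in> upper_pairs then hat (snd z $ (i, j)) \<bullet> (fst z *v hat (snd z $ (i, j)))
    else fst z $ i $ j - fst z $ j $ i)"
  define X where "X = (\<lambda>i (z :: (real^'d option^'d option) \<times> (real^'d^('d option \<times> 'd option))).
    snd z $ i + s i *\<^sub>R quadric_flex (fst z) (snd z $ i))"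
  define H where "H = (\<lambda>z. ((\<chi> i j. K (i, j) z) :: real^'d option^'d option, \<chi> i. X i z))"
  let ?h0 = "\<lambda>x :: real^'d. hat x - axis None 1"
  define L :: "real^'d option \<Rightarrow> real^'d" where "L = (\<lambda>y. \<chi> j. y $ Some j)"
  have linL: "linear L" by (rule linearI) (simp_all add: L_def vec_eq_iff)
  have flexL: "quadric_flex M x = L (M *v hat x)" for M x by (simp add: L_def quadric_flex_def)
  let ?z0 = "(M0, w0)"
  let ?DM = "\<lambda>i h. M0 *v ?h0 (snd h $ i) + fst h *v hat (w0 $ i)"
  define K' where "K' = (\<lambda>(i, j) (h :: (real^'d option^'d option) \<times> (real^'d^('d option \<times> 'd option))).
    if (i, j) \<in> upper_pairs
    then hat (w0 $ (i, j)) \<bullet> ?DM (i, j) h + ?h0 (snd h $ (i, j)) \<bullet> (M0 *v hat (w0 $ (i, j)))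
    else fst h $ i $ j - fst h $ j $ i)"
  define X' where "X' = (\<lambda>i h. snd h $ i + s i *\<^sub>R L (?DM i h))"
  define H' where "H' = (\<lambda>h. ((\<chi> i j. K' (i, j) h) :: real^'d option^'d option, \<chi> i. X' i h))"
  have M0: "M0 *v hat x = (\<chi> i. case i of None \<Rightarrow> - 3 | Some j \<Rightarrow> 3 * x $ j)"
    "M0 *v ?h0 x = 3 *\<^sub>R ?h0 x" for x
    by (simp_all add: M0_def vec_eq_iff matrix_vector_mult_def sum_option axis_def hat_def
        if_distrib[of "\<lambda>z. z * _"] cong: if_cong split: option.splits)
  have snd_deriv: "((\<lambda>z. snd z $ i) has_derivative (\<lambda>h. snd h $ i)) F"
    for F :: "((real^'d option^'d option) \<times> (real^'d^('d option \<times> 'd option))) filter" and i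
    by (intro bounded_linear.has_derivative[OF bounded_linear_vec_nth] has_derivative_snd has_derivative_ident)
  have fst_deriv: "((\<lambda>z. fst z $ i $ j) has_derivative (\<lambda>h. fst h $ i $ j)) F"
    for F :: "((real^'d option^'d option) \<times> (real^'d^('d option \<times> 'd option))) filter" and i j
    by (intro bounded_linear.has_derivative[OF bounded_linear_vec_nth] has_derivative_fst has_derivative_ident)
  have mv_deriv: "((\<lambda>z. fst z *v hat (snd z $ i)) has_derivative
      (\<lambda>h. fst z1 *v ?h0 (snd h $ i) + fst h *v hat (snd z1 $ i))) (at z1)"
    for z1 :: "(real^'d option^'d option) \<times> (real^'d^('d option \<times> 'd option))" and i
    using bounded_bilinear.FDERIV[OF bounded_bilinear_matrix_vector_mult
        bounded_linear_imp_has_derivative[OF bounded_linear_fst] has_derivative_hat[OF snd_deriv[of i "at z1"]]]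
    by simp
  have derX: "(X i has_derivative X' i) (at ?z0)" for i
    unfolding X_def X'_def flexL
    using bounded_linear.has_derivative[OF linL[unfolded linear_conv_bounded_linear] mv_deriv[of i ?z0]]
    by (intro has_derivative_add snd_deriv has_derivative_scaleR_right) simp
  have derK: "(K (i, j) has_derivative K' (i, j)) (at ?z0)" for i j
  proof (cases "(i, j) \<in> upper_pairs")
    case True
    have "((\<lambda>z. hat (snd z $ (i, j)) \<bullet> (fst z *v hat (snd z $ (i, j)))) has_derivative
        (\<lambda>h. hat (w0 $ (i, j)) \<bullet> ?DM (i, j) h + ?h0 (snd h $ (i, j)) \<bullet> (M0 *v hat (w0 $ (i, j))))) (at ?z0)"
      using has_derivative_inner[OF has_derivative_hat[OF snd_deriv[of "(i, j)" "at ?z0"]] mv_deriv[of "(i, j)" ?z0]]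
      by simp
    then show ?thesis using True by (simp add: K_def[abs_def] K'_def[abs_def])
  next
    case False
    then show ?thesis using has_derivative_diff[OF fst_deriv[of i j] fst_deriv[of j i]]
      by (simp add: K_def[abs_def] K'_def[abs_def])
  qed
  have derH: "(H has_derivative H') (at ?z0)"
    unfolding H_def H'_def by (intro has_derivative_Pair has_derivative_vec_lambda derK derX)
  have contH: "continuous_on UNIV H"
  proof -
    have "isCont (\<lambda>z. fst z *v hat (snd z $ i)) z1"
      for i and z1 :: "(real^'d option^'d option) \<times> (real^'d^('d option \<times> 'd option))"
      using has_derivative_continuous[OF mv_deriv] .
    then have mv: "continuous_on UNIV (\<lambda>z :: (real^'d option^'d option) \<times> (real^'d^('d option \<times> 'd option)).
        fst z *v hat (snd z $ i))" for i
      by (simp add: continuous_at_imp_continuous_on)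
    have "isCont (\<lambda>z :: (real^'d option^'d option) \<times> (real^'d^('d option \<times> 'd option)). hat (snd z $ i)) z1"
      for i and z1 :: "(real^'d option^'d option) \<times> (real^'d^('d option \<times> 'd option))"
      using has_derivative_continuous[OF has_derivative_hat[OF snd_deriv]] .
    then have ht: "continuous_on UNIV (\<lambda>z :: (real^'d option^'d option) \<times> (real^'d^('d option \<times> 'd option)).
        hat (snd z $ i))" for i
      by (simp add: continuous_at_imp_continuous_on)
    have "continuous_on UNIV (K (i, j))" for i j
      by (cases "(i, j) \<in> upper_pairs")
         (auto simp: K_def[abs_def] intro!: continuous_intros mv ht)
    moreover have "continuous_on UNIV (X i)" for i
      unfolding X_def flexL
      by (intro continuous_intros continuous_on_compose2[OF linear_continuous_on[OF linL[unfolded linear_conv_bounded_linear], of UNIV] mv]) auto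
    ultimately show ?thesis unfolding H_def
      by (intro continuous_on_Pair continuous_on_vec_lambda)
  qed
  have linH': "linear H'" using derH has_derivative_linear by blast
  have "inj H'"
    unfolding linear_injective_0[OF linH']
  proof (intro allI impI)
    fix h assume h: "H' h = 0"
    obtain dM dw where hh: "h = (dM, dw)" by (cases h)
    have eq: "(\<chi> i j. K' (i, j) h) = 0" "(\<chi> l. X' l h) = 0"
      using h by (simp_all add: H'_def zero_prod_def)
    have K0: "K' (i, j) h = 0" for i j using arg_cong[OF eq(1), of "\<lambda>m. m $ i $ j"] by simp
    have X0: "X' l h = 0" for l using arg_cong[OF eq(2), of "\<lambda>m. m $ l"] by simp
    have sym: "dM $ i $ j = dM $ j $ i" for i j
      using K0[of i j] K0[of j i] upper_pairs_antisym[of i j] by (auto simp: K'_def hh split: if_splits)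
    have Sym: "dM \<in> symmetric_matrices" using sym by (simp add: symmetric_matrices_def)
    have LDM: "L (?DM i h) = 3 *\<^sub>R (dw $ i) + quadric_flex dM (w0 $ i)" for i
      by (simp add: M0 hh flexL linear_add[OF linL] linear_cmul[OF linL]) (simp add: L_def vec_eq_iff axis_def)
    have "dM = 0"
    proof (rule det[rule_format, OF Sym])
      fix u assume u: "u \<in> V"
      obtain i j where ij: "\<phi> u = (i, j)" by (cases "\<phi> u")
      have up: "(i, j) \<in> upper_pairs" "\<psi> (i, j) = u" using \<phi>[OF u] ij by auto
      then have s: "s (i, j) = side u" and w: "w0 $ (i, j) = a u" by (simp_all add: s_def w0_def)
      let ?d = "dw $ (i, j)" and ?f = "quadric_flex dM (a u)"
      have "?d + side u *\<^sub>R (3 *\<^sub>R ?d + ?f) = 0"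
        using X0[of "(i, j)"] LDM[of "(i, j)"] by (simp add: X'_def hh s w)
      then have "a u \<bullet> ?d + side u * (3 * (a u \<bullet> ?d) + a u \<bullet> ?f) = 0"
        by (metis inner_add_right inner_scaleR_right inner_zero_right)
      \<comment> \<open>The displacement equation determines the normal component of
        \<open>dw\<close> from the flex of \<open>dM\<close>. Inserted into the linearized quadric
        equation it leaves a condition on \<open>dM\<close> alone, the sphere form with parameter
        \<open>stretch u\<close>.\<close>
      then have *: "6 * (a u \<bullet> ?d) = - stretch u * (a u \<bullet> ?f)"
        using side_cases[of u] by (auto simp: stretch_def)
      have "0 = hat (a u) \<bullet> (3 *\<^sub>R ?h0 ?d + dM *v hat (a u)) + ?h0 ?d \<bullet> (M0 *v hat (a u))"
        using K0[of i j] up(1) by (simp add: K'_def hh w M0(2))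
      also have "hat (a u) \<bullet> (3 *\<^sub>R ?h0 ?d + dM *v hat (a u)) = 3 * (a u \<bullet> ?d) + hat (a u) \<bullet> (dM *v hat (a u))"
        by (simp add: inner_add_right) (simp add: inner_vec_def sum_option axis_def)
      also have "?h0 ?d \<bullet> (M0 *v hat (a u)) = 3 * (a u \<bullet> ?d)"
        by (simp add: M0) (simp add: inner_vec_def sum_option axis_def sum_distrib_left mult_ac)
      finally show "sphere_form (stretch u) (a u) dM = 0"
        using * by (simp add: sphere_form_def)
    qed
    have "dw $ i = 0" for i
    proof -
      have "quadric_flex 0 (w0 $ i) = 0" by (simp add: quadric_flex_def vec_eq_iff)
      then have "dw $ i + s i *\<^sub>R (3 *\<^sub>R (dw $ i)) = 0"
        using X0[of i] LDM[of i] \<open>dM = 0\<close> by (simp add: X'_def hh)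
      then have "(1 + 3 * s i) *\<^sub>R (dw $ i) = 0" by (simp add: scaleR_add_left mult.commute)
      moreover have "1 + 3 * s i \<noteq> 0" using side_cases[of "\<psi> i"] by (auto simp: s_def)
      ultimately show ?thesis by simp
    qed
    then show "h = 0" using \<open>dM = 0\<close> by (simp add: hh zero_prod_def vec_eq_iff)
  qed
  then have "surj H'" using linear_injective_imp_surjective[OF linH'] by blast
  then obtain G where G: "linear G" "H' \<circ> G = id"
    using linear_surjective_right_inverse[OF linH'] by blast
  \<comment> \<open>A quarter of the difference between the squared distances of \<open>x1\<close>
    and \<open>x2\<close> in the two realizations. Restriction to the open set \<open>T\<close>
    keeps it nonzero; at the base the antipodes give 12.\<close>
  let ?sep = "\<lambda>z :: (real^'d option^'d option) \<times> (real^'d^('d option \<times> 'd option)). (snd z $ \<phi> x1 - snd z $ \<phi> x2) \<bullet>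
      (quadric_flex (fst z) (snd z $ \<phi> x1) - quadric_flex (fst z) (snd z $ \<phi> x2))"
  define T where "T = {z. ?sep z \<noteq> 0}"
  have "continuous_on UNIV ?sep"
  proof -
    have "isCont (\<lambda>z :: (real^'d option^'d option) \<times> (real^'d^('d option \<times> 'd option)).
        quadric_flex (fst z) (snd z $ i)) z1"
      for i and z1 :: "(real^'d option^'d option) \<times> (real^'d^('d option \<times> 'd option))"
      unfolding flexL
      using has_derivative_continuous[OF bounded_linear.has_derivative[OF linL[unfolded linear_conv_bounded_linear] mv_deriv]] .
    then have qf: "continuous_on UNIV (\<lambda>z :: (real^'d option^'d option) \<times> (real^'d^('d option \<times> 'd option)).
        quadric_flex (fst z) (snd z $ i))" for i
      by (simp add: continuous_at_imp_continuous_on)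
    show ?thesis by (intro continuous_intros qf)
  qed
  then have "open T" unfolding T_def by (intro open_Collect_neq continuous_on_const)
  have z0T: "?z0 \<in> T"
  proof -
    have "quadric_flex M0 x = 3 *\<^sub>R x" for x by (simp add: quadric_flex_def M0 vec_eq_iff)
    moreover have "w0 $ \<phi> x1 = a x1" "w0 $ \<phi> x2 = - a x1"
      using \<phi>(1)[OF x(1)] \<phi>(1)[OF x(2)] a(2) by (simp_all add: w0_def)
    ultimately have "?sep ?z0 = (a x1 - - a x1) \<bullet> (3 *\<^sub>R a x1 - 3 *\<^sub>R (- a x1))"
      by (simp only: fst_conv snd_conv)
    also have "\<dots> = 12 * (a x1 \<bullet> a x1)"
      unfolding inner_diff_left inner_diff_right inner_minus_left inner_minus_right inner_scaleR_right
      by simp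
    finally have "?sep ?z0 = 12 * (a x1 \<bullet> a x1)" .
    then show ?thesis using a(1)[OF x(1)] by (simp add: T_def norm_eq_1)
  qed
  have "H ?z0 \<in> interior (H ` T)"
  proof (rule sussmann_open_mapping[OF open_UNIV contH UNIV_I derH _ G(2) subset_UNIV])
    show "bounded_linear G" using G(1) by (simp add: linear_conv_bounded_linear)
    show "?z0 \<in> interior T" using \<open>open T\<close> z0T by (simp add: interior_open)
  qed
  moreover have "H ?z0 = (0, \<chi> i. X i ?z0)"
  proof -
    have "K (i, j) ?z0 = 0" for i j
    proof (cases "(i, j) \<in> upper_pairs")
      case True
      have "a (\<psi> (i, j)) \<bullet> a (\<psi> (i, j)) = 1"
        using a(1)[OF \<psi>V[OF True]] by (simp add: norm_eq_1)
      then show ?thesis using True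
        by (simp add: K_def w0_def M0 inner_vec_def sum_option mult_ac flip: sum_distrib_left)
    next
      case False then show ?thesis by (simp add: K_def M0_def)
    qed
    then show ?thesis by (simp add: H_def vec_eq_iff)
  qed
  \<comment> \<open>The slice of the interior of the image at defect 0 is open, so a generic
    placement can be taken from it, with a preimage in \<open>T\<close>.\<close>
  ultimately have "(\<chi> i. X i ?z0) \<in> {x. (0, x) \<in> interior (H ` T)}" by simp
  moreover have "open {x. (0 :: real^'d option^'d option, x) \<in> interior (H ` T)}"
    using open_vimage[OF open_interior, of "\<lambda>x. (0, x)"] by (simp add: vimage_def continuous_on_Pair)
  ultimately obtain p :: "('v, 'd) realization" and x where p: "generic_realization V p"
    and x': "x \<in> {x. (0, x) \<in> interior (H ` T)}" and px: "\<And>i. i \<in> upper_pairs \<Longrightarrow> x $ i = p (\<psi> i)"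
    using generic_in_open[OF \<psi>] by metis
  have "(0, x) \<in> H ` T" using x' interior_subset by blast
  then obtain M w where zT: "(M, w) \<in> T" and Hz: "H (M, w) = (0, x)" by (auto simp: image_iff)
  have eq: "(\<chi> i j. K (i, j) (M, w)) = 0" "(\<chi> l. X l (M, w)) = x"
    using Hz by (simp_all add: H_def)
  have Kz: "K (i, j) (M, w) = 0" for i j using arg_cong[OF eq(1), of "\<lambda>m. m $ i $ j"] by simp
  have Xz: "X l (M, w) = x $ l" for l using arg_cong[OF eq(2), of "\<lambda>m. m $ l"] by simp
  have "M $ i $ j = M $ j $ i" for i j
    using Kz[of i j] Kz[of j i] upper_pairs_antisym[of i j] by (auto simp: K_def split: if_splits)
  then have M: "M \<in> symmetric_matrices" by (simp add: symmetric_matrices_def)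
  define w' where "w' = (\<lambda>v. w $ \<phi> v)"
  have quad: "hat (w' v) \<bullet> (M *v hat (w' v)) = 0" if "v \<in> V" for v
    using Kz[of "fst (\<phi> v)" "snd (\<phi> v)"] \<phi>(2)[OF that]
    by (cases "\<phi> v") (simp add: K_def w'_def)
  have p_eq: "p v = w' v + side v *\<^sub>R quadric_flex M (w' v)" if "v \<in> V" for v
    using Xz[of "\<phi> v"] px[OF \<phi>(2)[OF that]] \<phi>[OF that] by (simp add: X_def s_def w'_def)
  define q where "q = (\<lambda>v. w' v - side v *\<^sub>R quadric_flex M (w' v))"
  have "edge_map E p = edge_map E (\<lambda>v. w' v + side v *\<^sub>R quadric_flex M (w' v))"
    unfolding edge_map_eq_iff using p_eq by (auto simp: E_iff)
  also have "\<dots> = edge_map E q" unfolding q_def by (rule quadric_flex_edge_lengths[OF M quad])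
  finally have pq: "edge_map E p = edge_map E q" .
  have "norm (p x1 - p x2) \<noteq> norm (q x1 - q x2)"
  proof
    let ?d = "w' x1 - w' x2" and ?f = "quadric_flex M (w' x1) - quadric_flex M (w' x2)"
    assume "norm (p x1 - p x2) = norm (q x1 - q x2)"
    moreover have "p x1 - p x2 = ?d + ?f" "q x1 - q x2 = ?d - ?f"
      using x p_eq by (simp_all add: q_def)
    ultimately have "norm (?d + ?f) = norm (?d - ?f)" by simp
    then have "?d \<bullet> ?f = 0" by (simp only: norm_add_eq_norm_diff_iff)
    then show False using zT by (simp add: T_def w'_def)
  qed
  then have "\<not> globally_rigid V E p" unfolding globally_rigid_def using pq x(1,2) by blast
  then show ?thesis using that p by blast
qed

end

section \<open>Connectivity and the characterization\<close>

context chain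
begin

lemma in_block: "u \<in> V \<Longrightarrow> u \<in> A (block u)"
  using block_eq by (auto simp: V_def)

text \<open>Without the inner block \<open>A i\<close> a walk from block 1 cannot pass the index
  \<open>i\<close>, since an edge changes the block index by one.\<close>

lemma vertex_connected_imp_card_block:
  assumes "vertex_connected n V E" "i \<in> {2..k - 1}"
  shows "card (A i) \<ge> n"
proof (rule ccontr)
  assume "\<not> ?thesis"
  then have conn: "connected_graph (V - A i) E"
    using assms(1) block_subset_V by (simp add: vertex_connected_def)
  have "A 1 \<noteq> {}" "A k \<noteq> {}" using block_eq_empty_iff k_ge_4 by auto
  then obtain u w where u: "u \<in> A 1" and w: "w \<in> A k" by blast
  have "u \<in> V - A i" "w \<in> V - A i"
    using u w block_subset_V disjoint_blocks[OF u, of i] disjoint_blocks[OF w, of i] assms(2) k_ge_4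
    by auto
  then have "(u, w) \<in> (E \<inter> (V - A i) \<times> (V - A i))\<^sup>*"
    using conn unfolding connected_graph_def by blast
  then have "block w < i"
  proof (induction rule: rtrancl_induct)
    case base
    show ?case using block_eq[OF u] assms(2) by simp
  next
    case (step y z)
    then have "z \<in> V" "z \<notin> A i" "block z = Suc (block y) \<or> block y = Suc (block z)"
      by (auto simp: E_iff)
    moreover from this have "block z \<noteq> i" using in_block by metis
    ultimately show ?case using step.IH by linarith
  qed
  then show False using block_eq[OF w] assms(2) by auto
qed

text \<open>Deleting fewer than \<open>n\<close> vertices leaves a survivor \<open>r i\<close> in
  each inner block. These form a path, and every surviving vertex is adjacent to one of them,
  because each block, the end blocks included, has an inner neighbour.\<close>

lemma vertex_connected_chain:
  assumes big: "\<And>i. i \<in> {2..k - 1} \<Longrightarrow> card (A i) \<ge> n" and V: "card V \<ge> n + 1"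
  shows "vertex_connected n V E"
  unfolding vertex_connected_def connected_graph_def
proof (intro conjI allI impI ballI, rule V)
  fix S u v assume S: "S \<subseteq> V \<and> card S < n" and uv: "u \<in> V - S" "v \<in> V - S"
  define R where "R = E \<inter> (V - S) \<times> (V - S)"
  have "\<exists>x. x \<in> A i - S" if "i \<in> {2..k - 1}" for i
  proof (rule ccontr)
    assume "\<not> ?thesis"
    then have "A i \<subseteq> S" by blast
    then have "card (A i) \<le> card S" using S finite_V finite_subset by (intro card_mono) blast+
    then show False using big[OF that] S by simp
  qed
  then obtain r where r: "\<And>i. i \<in> {2..k - 1} \<Longrightarrow> r i \<in> A i - S" by metis
  have R: "(x, y) \<in> R" if "x \<in> A i - S" "y \<in> A j - S" "j = Suc i \<or> i = Suc j" for x y i j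
    using that block_subset_V[of i] block_subset_V[of j] by (auto simp: R_def E_def)
  have "sym R" unfolding R_def sym_def using E_sym by blast
  then have symR: "(y, x) \<in> R\<^sup>*" if "(x, y) \<in> R\<^sup>*" for x y
    using that sym_rtrancl by (metis symD)
  have path: "i \<le> k - 1 \<longrightarrow> (r 2, r i) \<in> R\<^sup>*" if "2 \<le> i" for i
    using that
  proof (induction i rule: dec_induct)
    case base then show ?case by simp
  next
    case (step i)
    show ?case
    proof
      assume "Suc i \<le> k - 1"
      then have "(r i, r (Suc i)) \<in> R" using step(1) by (intro R[of _ i _ "Suc i"] r) auto
      then show "(r 2, r (Suc i)) \<in> R\<^sup>*"
        using step \<open>Suc i \<le> k - 1\<close> by (auto intro: rtrancl_into_rtrancl)
    qed
  qed
  have reach: "(r 2, x) \<in> R\<^sup>*" if "x \<in> V - S" for x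
  proof -
    obtain i where i: "i \<in> {1..k}" "x \<in> A i" using \<open>x \<in> V - S\<close> unfolding V_eq by blast
    obtain j where j: "j \<in> {2..k - 1}" "j = Suc i \<or> i = Suc j"
    proof (cases "Suc i \<le> k - 1")
      case True then show ?thesis using that[of "Suc i"] i by auto
    next
      case False
      then have "i - 1 \<in> {2..k - 1}" "i = Suc (i - 1)" using i k_ge_4 by auto
      then show ?thesis using that by blast
    qed
    have "(r j, x) \<in> R" using R[OF r[OF j(1)], of x i] i \<open>x \<in> V - S\<close> j(2) by auto
    then show ?thesis using path[of j] j(1) by (auto intro: rtrancl_into_rtrancl)
  qed
  show "(u, v) \<in> (E \<inter> (V - S) \<times> (V - S))\<^sup>*"
    using rtrancl_trans[OF symR[OF reach[OF uv(1)]] reach[OF uv(2)]] by (simp add: R_def)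
qed

lemma generically_partially_rigid_iff:
  assumes card: "card V = (CARD('d::finite) + 2) choose 2"
  shows "generically_partially_rigid TYPE(real ^ 'd) V E \<longleftrightarrow>
           (\<forall>i\<in>{2..k - 1}. card (A i) \<ge> CARD('d) + 1) \<and>
           (card (A 2) \<ge> CARD('d) + 2 \<and> card (A (k - 1)) \<ge> CARD('d) + 2) \<and>
           \<not> (\<exists>i\<in>{1..<k}. card (A i) = CARD('d) + 1 \<and> card (A (i + 1)) = CARD('d) + 1)"
    (is "?gpr \<longleftrightarrow> ?big \<and> ?ends \<and> \<not> ?pair")
proof -
  have "card (upper_pairs :: ('d option \<times> 'd option) set) = card V"
    using card card_upper_pairs[where 'o="'d option"] by (simp add: card_UNIV_option)
  then obtain \<psi> :: "'d option \<times> 'd option \<Rightarrow> 'v" where \<psi>: "bij_betw \<psi> upper_pairs V"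
    using finite_same_card_bij[OF finite finite_V] by blast
  show ?thesis
  proof
    assume gpr: ?gpr
    have "card (A i) \<ge> CARD('d) + 1" if "i \<in> {2..k - 1}" for i
      using gpr vertex_connected_imp_card_block[OF _ that]
      unfolding generically_partially_rigid_def by blast
    then have big: ?big by blast
    \<comment> \<open>One edge between the two blocks and one generic realization refute redundant
      rigidity.\<close>
    have no_bridge: False
      if bridge: "card (A i) = CARD('d) + 1 \<and> card (A (Suc i)) = CARD('d) + 1
          \<or> i = 1 \<and> card (A 2) = CARD('d) + 1 \<or> i = k - 1 \<and> card (A (k - 1)) = CARD('d) + 1"
        and i: "i \<in> {1..<k}" for i
    proof -
      have "A i \<noteq> {}" "A (Suc i) \<noteq> {}" using i block_eq_empty_iff by auto
      then obtain x y where xy: "x \<in> A i" "y \<in> A (Suc i)" by blast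
      obtain p :: "('v, 'd) realization" where p: "generic_realization V p"
        "\<not> locally_rigid V (remove_edge E (x, y)) p"
        by (rule bridge_imp_generic_flexible[OF \<psi> bridge xy])
      have "(x, y) \<in> E" using xy by (auto simp: E_def)
      moreover have "redundantly_rigid V E p"
        using gpr p(1) unfolding generically_partially_rigid_def generically_redundantly_rigid_def by blast
      ultimately show False using p(2) unfolding redundantly_rigid_def by blast
    qed
    have "2 \<in> {2..k - 1}" "k - 1 \<in> {2..k - 1}" "1 \<in> {1..<k}" "k - 1 \<in> {1..<k}" using k_ge_4 by auto
    moreover have "card (A 2) \<noteq> CARD('d) + 1" using no_bridge[of 1] calculation by blast
    moreover have "card (A (k - 1)) \<noteq> CARD('d) + 1" using no_bridge[of "k - 1"] calculation by blast
    ultimately have ends: ?ends using big by (metis Suc_eq_plus1 add_2_eq_Suc' le_antisym not_less_eq_eq)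
    have "\<not> ?pair" using no_bridge unfolding Suc_eq_plus1 by blast
    then show "?big \<and> ?ends \<and> \<not> ?pair" using big ends by blast
  next
    assume *: "?big \<and> ?ends \<and> \<not> ?pair"
    then have big: "\<And>i. i \<in> {2..k - 1} \<Longrightarrow> card (A i) \<ge> CARD('d) + 1"
      and ends: "card (A 2) \<ge> CARD('d) + 2" "card (A (k - 1)) \<ge> CARD('d) + 2"
      and pairs: "\<And>i. i \<in> {1..<k} \<Longrightarrow> \<not> (card (A i) = CARD('d) + 1 \<and> card (A (i + 1)) = CARD('d) + 1)"
      by blast+
    have "card V \<ge> card (A 2 \<union> A 3)"
      using block_subset_V finite_V by (intro card_mono) auto
    moreover have "card (A 2 \<union> A 3) = card (A 2) + card (A 3)"
      by (rule card_Un_disjoint) (use finite_block disjoint_blocks[of _ 2 3] in auto)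
    ultimately have "card V \<ge> CARD('d) + 1 + 1" using ends by linarith
    then have "vertex_connected (CARD('d) + 1) V E"
      by (intro vertex_connected_chain big)
    moreover have "generically_redundantly_rigid TYPE(real ^ 'd) V E"
      unfolding generically_redundantly_rigid_def redundantly_rigid_def
    proof (intro allI impI ballI)
      fix p :: "('v, 'd) realization" and e assume p: "generic_realization V p" and e: "e \<in> E"
      show "locally_rigid V (remove_edge E e) p"
      proof (rule infinitesimally_rigid_imp_locally_rigid[OF \<psi>])
        show "remove_edge E e \<subseteq> V \<times> V" by (auto simp: remove_edge_def E_iff)
        show "well_placed V p" by (rule generic_imp_well_placed[OF \<psi> p])
        show "infinitesimally_rigid V (remove_edge E e) q" if "well_placed V q" for q :: "('v, 'd) realization"
          by (rule infinitesimally_rigid_remove_edge[OF that big ends pairs e])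
      qed
    qed
    moreover have "\<not> generically_globally_rigid TYPE(real ^ 'd) V E"
    proof -
      \<comment> \<open>Two vertices of block 2 provide the nonadjacent pair on the side with sign
        1, and block 1 provides a vertex of the other side.\<close>
      obtain W where "W \<subseteq> A 2" "card W = 2"
        using obtain_subset_with_card_n[of 2 "A 2"] ends(1) by auto
      then obtain x1 x2 where x: "x1 \<in> A 2" "x2 \<in> A 2" "x1 \<noteq> x2" by (auto simp: card_2_iff)
      have "A 1 \<noteq> {}" using block_eq_empty_iff k_ge_4 by auto
      then obtain y where y: "y \<in> A 1" by blast
      have "side x1 = 1" "side x2 = 1" "side y = - 1"
        using x y by (simp_all add: side_def block_eq)
      then obtain p :: "('v, 'd) realization" where "generic_realization V p" "\<not> globally_rigid V E p"
        using generic_not_globally_rigid[OF \<psi>, of x1 x2 y] x y block_subset_V by blast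
      then show ?thesis unfolding generically_globally_rigid_def by blast
    qed
    ultimately show ?gpr unfolding generically_partially_rigid_def by blast
  qed
qed

end

theorem theorem8:
  fixes V :: "'v set" and E :: "('v \<times> 'v) set"
    and k :: nat and a :: "nat \<Rightarrow> nat"
  assumes "k \<ge> 4"
    and "\<And>i. i \<in> {1..k} \<Longrightarrow> a i \<ge> 1"
    and "(\<Sum>i=1..k. a i) = (CARD('d::finite) + 2) choose 2"
    and "is_chain k a V E"
  shows "generically_partially_rigid TYPE(real ^ 'd) V E \<longleftrightarrow>
           (\<forall>i\<in>{2..k - 1}. a i \<ge> CARD('d) + 1) \<and>
           (a 2 \<ge> CARD('d) + 2 \<and> a (k - 1) \<ge> CARD('d) + 2) \<and>
           \<not> (\<exists>i\<in>{1..<k}. a i = CARD('d) + 1 \<and> a (i + 1) = CARD('d) + 1)"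
proof -
  obtain A where disj: "disjoint_family_on A {1..k}"
    and fin: "\<forall>i\<in>{1..k}. finite (A i) \<and> card (A i) = a i"
    and V: "V = (\<Union>i\<in>{1..k}. A i)"
    and E: "E = (\<Union>i\<in>{1..<k}. A i \<times> A (i + 1) \<union> A (i + 1) \<times> A i)"
    using assms(4) unfolding is_chain_def by blast
  \<comment> \<open>\<open>is_chain\<close> leaves the values of \<open>A\<close> outside
    \<open>{1..k}\<close> open, while the locale wants empty blocks there.\<close>
  define B where "B = (\<lambda>i. if i \<in> {1..k} then A i else {})"
  have card_B: "card (B i) = a i" if "i \<in> {1..k}" for i using fin that by (simp add: B_def)
  interpret chain k B
  proof
    show "k \<ge> 4" by (rule assms(1))
    show "finite (B i)" for i using fin by (simp add: B_def)
    show "B i = {} \<longleftrightarrow> i \<notin> {1..k}" for i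
      using card_B[of i] assms(2)[of i] by (cases "i \<in> {1..k}") (auto simp: B_def)
    show "i = j" if "u \<in> B i" "u \<in> B j" for u i j
    proof (rule ccontr)
      assume "i \<noteq> j"
      moreover have "i \<in> {1..k}" "j \<in> {1..k}" "u \<in> A i" "u \<in> A j"
        using that by (auto simp: B_def split: if_splits)
      ultimately show False using disj unfolding disjoint_family_on_def by blast
    qed
  qed
  have VB: "local.V = V" unfolding V_eq V by (simp add: B_def)
  have EB: "local.E = E"
  proof -
    have "B i \<times> B (Suc i) \<union> B (Suc i) \<times> B i =
        (if i \<in> {1..<k} then A i \<times> A (i + 1) \<union> A (i + 1) \<times> A i else {})" for i
      by (auto simp: B_def)
    then show ?thesis unfolding local.E_def E by auto
  qed
  have "card V = (CARD('d) + 2) choose 2"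
    using is_chain_card[OF assms(4)] assms(3) by simp
  moreover have "card (B i) = a i" if "i \<in> {2..k - 1}" for i
    using card_B[of i] that by auto
  moreover have "card (B 2) = a 2" "card (B (k - 1)) = a (k - 1)" using card_B[of 2] card_B[of "k - 1"] assms(1) by auto
  moreover have "card (B i) = a i \<and> card (B (i + 1)) = a (i + 1)" if "i \<in> {1..<k}" for i
    using card_B[of i] card_B[of "i + 1"] that by auto
  ultimately show ?thesis
    using generically_partially_rigid_iff[where 'd='d] unfolding VB EB by simp
qed

end
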